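(* Consider the problem: for $y\in D$ find $u(y)\in H^1_0(\Omega)$ such that $$\sum_{i=1}^N y_i(\nabla u(y),\nabla v)_{\Omega_i}=(f,v)_\Omega\quad\text{for all } v\in H^1_0(\Omega),$$ with rectangular layers $\Omega_1,\dots,\Omega_N$. There exists a constant $C$ such that the relative Kolmogorov widths of $u$ satisfy $$\hat d_{2N-1+(N-1)n_s}\le C e^{-\pi(n_s+1)}\quad\text{for any } n_s\in\mathbb N.$$
   Context: Rectangular layers: $\Omega_i=(i-1,i)\times(p,q)$, $i=1,\dots,N$, for some real $p<q$; $\Omega=\mathrm{int}(\bigcup_{i=1}^N\overline\Omega_i)=(0,N)\times(p,q)$. $D\subset(m,M)^N$ with $m,M>0$, $f\in L^2(\Omega)$, and $(\cdot,\cdot)_\omega$ is the $L^2(\omega)$ inner product. For $y\in D$, $a(z,v)=\sum_{i=1}^N y_i(\nabla z,\nabla v)_{\Omega_i}$ and $\|v\|_E=a(v,v)^{1/2}$ (both depending on $y$). The relative Kolmogorov $n$-width is $$\hat d_n=\min_{\dim X=n}\ \max_{y\in D}\frac{\|u(y)-P_Eu(y)\|_E}{\|u(y)\|_E},$$ where $X$ ranges over $n$-dimensional subspaces of $H^1_0(\Omega)$ and $P_E$ is the orthogonal projection onto $X$ in the $y$-dependent inner product $a(\cdot,\cdot)$ (the quotient is read as $0$ if $u(y)=0$). *)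

theory Defs
  imports "HOL-Analysis.Analysis"
begin

text \<open>Elements of \<open>L\<^sup>2\<close> and of the Sobolev spaces are represented by functions on the whole space;
  only their values on the domain \<open>S\<close>, up to null sets, are relevant.\<close>

definition L2 :: "'a::euclidean_space set \<Rightarrow> ('a \<Rightarrow> 'b::euclidean_space) set" where
  "L2 S = {f. f \<in> borel_measurable (lebesgue_on S)
              \<and> integrable (lebesgue_on S) (\<lambda>x. (norm (f x))\<^sup>2)}"

definition L2_inner ::
    "'a::euclidean_space set \<Rightarrow> ('a \<Rightarrow> 'b::euclidean_space) \<Rightarrow> ('a \<Rightarrow> 'b) \<Rightarrow> real" where
  "L2_inner S f g = (LINT x|lebesgue_on S. f x \<bullet> g x)"

fun Ck :: "nat \<Rightarrow> ('a::euclidean_space \<Rightarrow> real) \<Rightarrow> bool" where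
  "Ck 0 \<phi> \<longleftrightarrow> continuous_on UNIV \<phi>"
| "Ck (Suc k) \<phi> \<longleftrightarrow> (\<forall>x. \<phi> differentiable (at x))
     \<and> (\<forall>b\<in>Basis. Ck k (\<lambda>x. frechet_derivative \<phi> (at x) b))"

definition test_functions :: "'a::euclidean_space set \<Rightarrow> ('a \<Rightarrow> real) set" where
  "test_functions S = {\<phi>. (\<forall>k. Ck k \<phi>) \<and> compact (closure {x. \<phi> x \<noteq> 0})
                            \<and> closure {x. \<phi> x \<noteq> 0} \<subseteq> S}"

definition gradient :: "('a::euclidean_space \<Rightarrow> real) \<Rightarrow> 'a \<Rightarrow> 'a" where
  "gradient \<phi> x = (\<Sum>b\<in>Basis. frechet_derivative \<phi> (at x) b *\<^sub>R b)"

definition has_weak_gradient ::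
    "'a::euclidean_space set \<Rightarrow> ('a \<Rightarrow> real) \<Rightarrow> ('a \<Rightarrow> 'a) \<Rightarrow> bool" where
  "has_weak_gradient S v g \<longleftrightarrow>
     (\<forall>\<phi>\<in>test_functions S.
        (LINT x|lebesgue_on S. v x *\<^sub>R gradient \<phi> x) = - (LINT x|lebesgue_on S. \<phi> x *\<^sub>R g x))"

definition H1 :: "'a::euclidean_space set \<Rightarrow> ('a \<Rightarrow> real) set" where
  "H1 S = {v \<in> L2 S. \<exists>g\<in>L2 S. has_weak_gradient S v g}"

text \<open>A weak gradient is unique up to null sets, so the choice below does not affect any integral.\<close>

definition weak_gradient :: "'a::euclidean_space set \<Rightarrow> ('a \<Rightarrow> real) \<Rightarrow> 'a \<Rightarrow> 'a" where
  "weak_gradient S v = (SOME g. g \<in> L2 S \<and> has_weak_gradient S v g)"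

definition H1_norm :: "'a::euclidean_space set \<Rightarrow> ('a \<Rightarrow> real) \<Rightarrow> real" where
  "H1_norm S v = sqrt (L2_inner S v v + L2_inner S (weak_gradient S v) (weak_gradient S v))"

definition H10 :: "'a::euclidean_space set \<Rightarrow> ('a \<Rightarrow> real) set" where
  "H10 S = {v \<in> H1 S. \<forall>\<epsilon>>0. \<exists>\<phi>\<in>test_functions S. H1_norm S (\<lambda>x. v x - \<phi> x) < \<epsilon>}"

text \<open>The \<open>n\<close>-dimensional subspaces of \<open>H\<^sup>1\<^sub>0\<close>, given by a basis \<open>w\<^sub>0, \<dots>, w\<^sub>n\<^sub>-\<^sub>1\<close>;
  linear independence and span are understood modulo equality almost everywhere.\<close>

definition H10_subspaces :: "'a::euclidean_space set \<Rightarrow> nat \<Rightarrow> ('a \<Rightarrow> real) set set" where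
  "H10_subspaces S n = {X. \<exists>w :: nat \<Rightarrow> 'a \<Rightarrow> real.
     (\<forall>j<n. w j \<in> H10 S)
     \<and> (\<forall>c. (AE x in lebesgue_on S. (\<Sum>j<n. c j * w j x) = 0) \<longrightarrow> (\<forall>j<n. c j = 0))
     \<and> X = {v \<in> H10 S. \<exists>c. AE x in lebesgue_on S. v x = (\<Sum>j<n. c j * w j x)}}"

definition layer :: "real \<Rightarrow> real \<Rightarrow> nat \<Rightarrow> (real \<times> real) set" where
  "layer p q i = {real i - 1<..<real i} \<times> {p<..<q}"

definition layered_domain :: "nat \<Rightarrow> real \<Rightarrow> real \<Rightarrow> (real \<times> real) set" where
  "layered_domain N p q = interior (\<Union>i\<in>{1..N}. closure (layer p q i))"

lemma layered_domain_eq: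
  assumes "N \<ge> 1" "p < q"
  shows "layered_domain N p q = {0<..<real N} \<times> {p<..<q}"
proof -
  have "(\<Union>i\<in>{1..N}. {real i - 1..real i}) = {0..real N}"
    using \<open>N \<ge> 1\<close>
  proof (induction N rule: dec_induct)
    case (step n)
    have "{1..Suc n} = insert (Suc n) {1..n}"
      by auto
    then show ?case
      using step by auto
  qed auto
  moreover have "(\<Union>i\<in>{1..N}. closure (layer p q i))
      = (\<Union>i\<in>{1..N}. {real i - 1..real i}) \<times> {p..q}"
    using \<open>p < q\<close> by (auto simp: layer_def closure_Times)
  ultimately show ?thesis
    by (simp add: layered_domain_def interior_Times)
qed

definition energy_inner ::
    "nat \<Rightarrow> real \<Rightarrow> real \<Rightarrow> (nat \<Rightarrow> real) \<Rightarrow> (real \<times> real \<Rightarrow> real) \<Rightarrow> (real \<times> real \<Rightarrow> real) \<Rightarrow> real"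
  where
  "energy_inner N p q y z v =
     (\<Sum>i=1..N. y i * L2_inner (layer p q i)
        (weak_gradient (layered_domain N p q) z) (weak_gradient (layered_domain N p q) v))"

definition energy_norm ::
    "nat \<Rightarrow> real \<Rightarrow> real \<Rightarrow> (nat \<Rightarrow> real) \<Rightarrow> (real \<times> real \<Rightarrow> real) \<Rightarrow> real" where
  "energy_norm N p q y v = sqrt (energy_inner N p q y v v)"

text \<open>Orthogonal projection onto a finite-dimensional subspace \<open>X\<close>; determined almost everywhere.\<close>

definition energy_proj ::
    "nat \<Rightarrow> real \<Rightarrow> real \<Rightarrow> (nat \<Rightarrow> real) \<Rightarrow> (real \<times> real \<Rightarrow> real) set
      \<Rightarrow> (real \<times> real \<Rightarrow> real) \<Rightarrow> real \<times> real \<Rightarrow> real" where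
  "energy_proj N p q y X z =
     (SOME w. w \<in> X \<and> (\<forall>v\<in>X. energy_inner N p q y (\<lambda>x. z x - w x) v = 0))"

text \<open>If \<open>u y\<close> vanishes almost everywhere, the quotient is \<open>0\<close> because division by \<open>0\<close> yields \<open>0\<close>
  on the reals. The values lie in \<open>ennreal\<close> so that suprema and infima are always meaningful.\<close>

definition relative_width ::
    "nat \<Rightarrow> real \<Rightarrow> real \<Rightarrow> (nat \<Rightarrow> real) set \<Rightarrow> ((nat \<Rightarrow> real) \<Rightarrow> real \<times> real \<Rightarrow> real)
      \<Rightarrow> nat \<Rightarrow> ennreal" where
  "relative_width N p q D u n =
     (INF X\<in>H10_subspaces (layered_domain N p q) n. SUP y\<in>D.
        ennreal (energy_norm N p q y (\<lambda>x. u y x - energy_proj N p q y X (u y) x)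
                 / energy_norm N p q y (u y)))"

end

theory Submission
  imports Defs "HOL-Library.Function_Algebras"
begin

text \<open>Every element of \<open>H\<^sup>1\<^sub>0\<close> is approximated by a sum of bubbles supported in single layers and of
  functions \<open>\<Sum>k i. c k i *\<^sub>R hat k i\<close>, where \<open>hat k i\<close> is harmonic in the layers and equals the \<open>k\<close>-th sine
  mode on the \<open>i\<close>-th interface. The two parts are orthogonal in every layer, and so are different modes. Fix
  \<open>z \<in> D\<close>. As all \<open>u y\<close> represent the same functional, \<open>u y\<close> arises from \<open>u z\<close> by scaling the bubble in
  layer \<open>i\<close> with \<open>z i / y i\<close> and by solving, for every mode \<open>k\<close>, a tridiagonal system in the \<open>N - 1\<close> interface
  values whose off-diagonal part carries the factor \<open>\<sigma> k = 1 / cosh (k \<pi> / (q - p))\<close>. The Jacobi iterates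
  of this system converge like \<open>(\<sigma> k) ^ J\<close>; their dependence on \<open>k\<close> is through monomials in \<open>\<sigma> k\<close> and the
  data, while \<open>y\<close> enters through the coefficients only. Hence for all high modes together,
  \<open>J \<ge> q - p\<close> steps stay in a space whose dimension does not depend on the number of modes, with an error
  \<open>O(exp (- \<pi> k))\<close>, and the low modes are included one by one. The fixed number of extra dimensions is paid
  for by the constant.\<close>

text \<open>How many modes of \<open>u z\<close> matter is unknown, and neither the dimension nor
  the constant may depend on it. This is why the iterates are organised as polynomials in
  \<open>\<sigma> k\<close> and not collected mode by mode. The tridiagonal systems are never
  solved: an iterate is judged by its residual, tested against bubbles and finite hat sums, and
  coercivity of the \<open>y\<close>-energy converts a small residual into a small error. The
  dimension count is \<open>N\<close> for the bubbles, \<open>(N - 1) * K\<close> for the low modes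
  and at most \<open>n0 = (J0 + 1) * (N - 1)\<close> monomials for each of the \<open>N - 1\<close>
  interfaces. With \<open>K = n - n0\<close> this is \<open>N + (N - 1) * n\<close>, at most the
  dimension in the claim; the \<open>n0\<close> modes given up cost the factor
  \<open>exp (pi * n0)\<close>. A relative bound also needs the energies of all \<open>u y\<close>
  to stay away from zero uniformly. The common right-hand side yields this, unless all of them
  vanish. Elements of the spaces are functions and not classes, so all forms are merely positive
  semidefinite, and dimensions have to be counted modulo null sets.\<close>

instantiation "fun" :: (type, real_vector) real_vector
begin

definition scaleR_fun_def: "c *\<^sub>R f = (\<lambda>x. c *\<^sub>R f x)"

instance
  by standard (simp_all add: scaleR_fun_def fun_eq_iff algebra_simps)

end

lemma scaleR_fun_apply [simp]: "(c *\<^sub>R f) x = c *\<^sub>R f x"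
  by (simp add: scaleR_fun_def)

lemma sum_fun_apply [simp]:
  fixes f :: "'i \<Rightarrow> 'a \<Rightarrow> 'b::comm_monoid_add"
  shows "(sum f I) x = (\<Sum>i\<in>I. f i x)"
  by (induction I rule: infinite_finite_induct) auto

section \<open>Positive semidefinite forms\<close>

locale psd_form =
  fixes V :: "'v::real_vector set" and B :: "'v \<Rightarrow> 'v \<Rightarrow> real"
  assumes V: "subspace V"
    and sym: "v \<in> V \<Longrightarrow> w \<in> V \<Longrightarrow> B v w = B w v"
    and add: "v \<in> V \<Longrightarrow> w \<in> V \<Longrightarrow> z \<in> V \<Longrightarrow> B (v + w) z = B v z + B w z"
    and scale: "v \<in> V \<Longrightarrow> z \<in> V \<Longrightarrow> B (c *\<^sub>R v) z = c * B v z"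
    and psd: "v \<in> V \<Longrightarrow> 0 \<le> B v v"
begin

lemmas V_closed [simp] = subspace_0[OF V] subspace_add[OF V] subspace_scale[OF V]
  subspace_diff[OF V] subspace_neg[OF V]

lemma V_sum [simp]: "(\<And>i. i \<in> I \<Longrightarrow> f i \<in> V) \<Longrightarrow> sum f I \<in> V"
  by (rule subspace_sum[OF V])

lemma V_span: "W \<subseteq> V \<Longrightarrow> w \<in> span W \<Longrightarrow> w \<in> V"
  using span_minimal[OF _ V] by blast

lemma add_right: "v \<in> V \<Longrightarrow> w \<in> V \<Longrightarrow> z \<in> V \<Longrightarrow> B z (v + w) = B z v + B z w"
  using add sym by (metis V_closed(2))

lemma scale_right: "v \<in> V \<Longrightarrow> z \<in> V \<Longrightarrow> B z (c *\<^sub>R v) = c * B z v"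
  using scale sym by (metis V_closed(3))

lemma diff: "v \<in> V \<Longrightarrow> w \<in> V \<Longrightarrow> z \<in> V \<Longrightarrow> B (v - w) z = B v z - B w z"
  using add[of v "- w" z] scale[of w z "-1"] by simp

lemma diff_right: "v \<in> V \<Longrightarrow> w \<in> V \<Longrightarrow> z \<in> V \<Longrightarrow> B z (v - w) = B z v - B z w"
  using add_right[of v "- w" z] scale_right[of w z "-1"] by simp

lemma zero [simp]: "z \<in> V \<Longrightarrow> B 0 z = 0"
  using scale[of 0 z 0] by simp

lemma zero_right [simp]: "z \<in> V \<Longrightarrow> B z 0 = 0"
  using scale_right[of 0 z 0] by simp

lemma sum: "finite I \<Longrightarrow> (\<And>i. i \<in> I \<Longrightarrow> f i \<in> V) \<Longrightarrow> z \<in> V \<Longrightarrow> B (sum f I) z = (\<Sum>i\<in>I. B (f i) z)"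
  by (induction I rule: finite_induct) (auto simp: add)

lemma sum_right: "finite I \<Longrightarrow> (\<And>i. i \<in> I \<Longrightarrow> f i \<in> V) \<Longrightarrow> z \<in> V \<Longrightarrow> B z (sum f I) = (\<Sum>i\<in>I. B z (f i))"
  by (induction I rule: finite_induct) (auto simp: add_right)

lemma Cauchy_Schwarz_squared:
  assumes v: "v \<in> V" and w: "w \<in> V"
  shows "(B v w)\<^sup>2 \<le> B v v * B w w"
proof -
  have q: "0 \<le> B v v + 2 * t * B v w + t\<^sup>2 * B w w" for t
    using psd[of "v + t *\<^sub>R w"] v w sym[of v w]
    by (simp add: add add_right scale scale_right power2_eq_square algebra_simps)
  show ?thesis
  proof (cases "B w w = 0")
    case True
    have "B v w = 0"
    proof (rule ccontr)
      assume "B v w \<noteq> 0"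
      \<comment> \<open>For \<open>B w w = 0\<close> the quadratic is affine in \<open>t\<close>,
        and this \<open>t\<close> gives it the value \<open>- 1\<close>.\<close>
      then show False
        using q[of "- (B v v + 1) / (2 * B v w)"] True by (simp add: field_simps)
    qed
    then show ?thesis using True by simp
  next
    case False
    then have "B w w > 0" using psd[OF w] by simp
    then show ?thesis
      using q[of "- B v w / B w w"]
      by (simp add: field_simps power2_eq_square)
  qed
qed

definition nrm :: "'v \<Rightarrow> real" where "nrm v = sqrt (B v v)"

lemma nrm_nonneg [simp]: "v \<in> V \<Longrightarrow> 0 \<le> nrm v"
  by (simp add: nrm_def psd)

lemma nrm_squared: "v \<in> V \<Longrightarrow> (nrm v)\<^sup>2 = B v v"
  by (simp add: nrm_def psd)

lemma Cauchy_Schwarz: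
  assumes "v \<in> V" and "w \<in> V"
  shows "\<bar>B v w\<bar> \<le> nrm v * nrm w"
  using real_sqrt_le_mono[OF Cauchy_Schwarz_squared[OF assms]] assms
  by (simp add: nrm_def real_sqrt_mult)

lemma nrm_triangle:
  assumes v: "v \<in> V" and w: "w \<in> V"
  shows "nrm (v + w) \<le> nrm v + nrm w"
proof (rule power2_le_imp_le)
  have "(nrm (v + w))\<^sup>2 = B v v + 2 * B v w + B w w"
    using v w sym[of v w] by (simp add: nrm_squared add add_right)
  also have "\<dots> \<le> (nrm v + nrm w)\<^sup>2"
    using Cauchy_Schwarz[OF v w] v w by (simp add: power2_sum nrm_squared)
  finally show "(nrm (v + w))\<^sup>2 \<le> (nrm v + nrm w)\<^sup>2" .
qed (use v w in simp)

lemma nrm_minus: "v \<in> V \<Longrightarrow> nrm (- v) = nrm v"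
  using scale[of v "- v" "-1"] scale_right[of v v "-1"] by (simp add: nrm_def)

lemma nrm_zero [simp]: "nrm 0 = 0"
  by (simp add: nrm_def)

text \<open>Gram-Schmidt, one spanning vector at a time: \<open>e\<close> is the part of
  \<open>x\<close> orthogonal to the earlier vectors. As \<open>B\<close> is only semidefinite,
  \<open>e\<close> may have length zero; by Cauchy-Schwarz it is then orthogonal to
  everything.\<close>

lemma projection_exists:
  assumes "finite W" "W \<subseteq> V" "z \<in> V"
  shows "\<exists>w\<in>span W. \<forall>v\<in>span W. B (z - w) v = 0"
  using assms
proof (induction W arbitrary: z rule: finite_induct)
  case empty
  then show ?case by auto
next
  case (insert x W)
  have xV: "x \<in> V" and WV: "W \<subseteq> V" using insert by auto
  obtain px where px: "px \<in> span W" "\<forall>v\<in>span W. B (x - px) v = 0"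
    using insert.IH[OF WV xV] by auto
  obtain pz where pz: "pz \<in> span W" "\<forall>v\<in>span W. B (z - pz) v = 0"
    using insert.IH[OF WV insert.prems(2)] by auto
  have pV: "px \<in> V" "pz \<in> V" using V_span[OF WV] px pz by auto
  define e where "e = x - px"
  have eV: "e \<in> V" using xV pV by (simp add: e_def)
  define t where "t = B (z - pz) e / B e e"
  define w where "w = pz + t *\<^sub>R e"
  have span_mono': "span W \<subseteq> span (insert x W)" by (rule span_mono) auto
  have e_span: "e \<in> span (insert x W)"
    unfolding e_def using px span_mono' by (intro span_diff) (auto intro: span_base)
  have zw: "z - w = (z - pz) - t *\<^sub>R e" by (simp add: w_def)
  have orthW: "B (z - w) v = 0" if "v \<in> span W" for v
    using that px pz V_span[OF WV that] eV pV insert.prems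
    by (simp add: zw diff[of "z - pz" "t *\<^sub>R e" v] scale e_def[symmetric])
  have orthe: "B (z - w) e = 0"
  proof (cases "B e e = 0")
    case True
    then have "B (z - pz) e = 0"
      using Cauchy_Schwarz_squared[of "z - pz" e] eV pV insert.prems by simp
    then show ?thesis using True eV pV insert.prems
      by (simp add: zw diff[of "z - pz" "t *\<^sub>R e" e] scale)
  next
    case False
    have "B (z - w) e = B (z - pz) e - t * B e e"
      using eV pV insert.prems by (simp add: zw diff[of "z - pz" "t *\<^sub>R e" e] scale)
    then show ?thesis using False by (simp add: t_def)
  qed
  show ?case
  proof (intro bexI ballI)
    show "w \<in> span (insert x W)"
      unfolding w_def using pz e_span span_mono' by (auto intro!: span_add span_scale)
    fix v assume "v \<in> span (insert x W)"
    then obtain k where k: "v - k *\<^sub>R x \<in> span W" using span_breakdown_eq by blast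
    \<comment> \<open>Replacing \<open>x\<close> by \<open>px + e\<close> splits \<open>v\<close>
      into a vector of \<open>span W\<close> and a multiple of \<open>e\<close>, the two directions
      already treated.\<close>
    define v' where "v' = (v - k *\<^sub>R x) + k *\<^sub>R px"
    have v': "v' \<in> span W" unfolding v'_def using k px by (intro span_add span_scale)
    have "v = v' + k *\<^sub>R e" by (simp add: v'_def e_def algebra_simps)
    moreover have "z - w \<in> V" "v' \<in> V"
      using insert.prems pV eV V_span[OF WV v'] by (auto simp: w_def)
    ultimately show "B (z - w) v = 0"
      using orthW[OF v'] orthe eV by (simp add: add_right scale_right)
  qed
qed

text \<open>Pythagoras for \<open>z - x = (z - w) + (w - x)\<close>. Orthogonality is asked for the
  single direction \<open>w - x\<close>, so the lemma also serves subspaces that are described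
  modulo null sets and not as a span.\<close>

lemma projection_optimal:
  assumes "z \<in> V" "w \<in> V" "x \<in> V" and orth: "B (z - w) (w - x) = 0"
  shows "nrm (z - w) \<le> nrm (z - x)"
proof -
  have "z - x = (z - w) + (w - x)" by simp
  then have "B (z - x) (z - x) = B (z - w) (z - w) + B (w - x) (w - x)"
    using assms sym[of "z - w" "w - x"]
    by (metis (no_types, lifting) V_closed(4) add add_right add_0_right add_0 V_closed(2))
  then show ?thesis
    using psd[of "w - x"] assms by (simp add: nrm_def)
qed

end

section \<open>Jacobi iteration\<close>

text \<open>Jacobi iteration, started at zero, for the system \<open>tridiag y s x = g\<close> on
  the interior nodes. The value \<open>0\<close> elsewhere encodes the Dirichlet condition at the
  nodes \<open>0\<close> and \<open>N\<close>.\<close>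

fun jacobi :: "nat \<Rightarrow> (nat \<Rightarrow> real) \<Rightarrow> real \<Rightarrow> (nat \<Rightarrow> real) \<Rightarrow> nat \<Rightarrow> nat \<Rightarrow> real" where
  "jacobi N y s g 0 = (\<lambda>i. 0)"
| "jacobi N y s g (Suc J) = (\<lambda>i. if i \<in> {1..<N}
     then (g i + s * (y i * jacobi N y s g J (i - 1) + y (Suc i) * jacobi N y s g J (Suc i)))
       / (y i + y (Suc i))
     else 0)"

text \<open>One row of the interface system of a single mode, divided by \<open>\<alpha> k\<close>;
  \<open>s\<close> stands for \<open>\<sigma> k\<close>. Layer \<open>i\<close> joins the nodes
  \<open>i - 1\<close> and \<open>i\<close>, so node \<open>i\<close> sees the weights
  \<open>y i\<close> and \<open>y (Suc i)\<close>.\<close>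

definition tridiag :: "(nat \<Rightarrow> real) \<Rightarrow> real \<Rightarrow> (nat \<Rightarrow> real) \<Rightarrow> nat \<Rightarrow> real" where
  "tridiag y s x i = (y i + y (Suc i)) * x i - s * (y i * x (i - 1) + y (Suc i) * x (Suc i))"

lemma jacobi_outside: "i \<notin> {1..<N} \<Longrightarrow> jacobi N y s g J i = 0"
  by (cases J) auto

text \<open>A Jacobi step divides the residual by the diagonal. The residual is therefore controlled
  by the next increment, and the exact solution does not have to be mentioned.\<close>

lemma jacobi_residual:
  assumes "i \<in> {1..<N}" "y i > 0" "y (Suc i) > 0"
  shows "tridiag y s (jacobi N y s g J) i - g i
    = (y i + y (Suc i)) * (jacobi N y s g J i - jacobi N y s g (Suc J) i)"
proof -
  have "y i + y (Suc i) \<noteq> 0" using assms by simp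
  then show ?thesis using assms(1) by (simp add: tridiag_def field_simps)
qed

text \<open>In each row the off-diagonal entries add up to \<open>s\<close> times the diagonal,
  whatever \<open>y\<close> is, so a step contracts the maximum norm by \<open>s\<close> uniformly
  in \<open>y\<close>. The increments vanish outside \<open>{1..<N}\<close>, which lets the
  induction use both neighbours of every node.\<close>

lemma jacobi_diff:
  assumes y: "\<And>i. i \<in> {1..N} \<Longrightarrow> y i > 0" and s: "0 \<le> s"
    and G: "\<And>i. \<bar>jacobi N y s g 1 i\<bar> \<le> G"
  shows "\<bar>jacobi N y s g (Suc J) i - jacobi N y s g J i\<bar> \<le> s ^ J * G"
proof (induction J arbitrary: i)
  case 0
  then show ?case using G[of i] by simp
next
  case (Suc J)
  define d where "d j = jacobi N y s g (Suc J) j - jacobi N y s g J j" for j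
  have G0: "0 \<le> G" using G[of 0] by linarith
  show ?case
  proof (cases "i \<in> {1..<N}")
    case True
    then have p: "y i > 0" "y (Suc i) > 0" using y by auto
    have "jacobi N y s g (Suc (Suc J)) i - jacobi N y s g (Suc J) i
        = (s * (y i * d (i - 1) + y (Suc i) * d (Suc i))) / (y i + y (Suc i))"
      unfolding jacobi.simps(2)[of N y s g "Suc J"] jacobi.simps(2)[of N y s g J] d_def
      using True p by (simp only: if_True) (simp add: diff_divide_distrib[symmetric] algebra_simps)
    also have "\<bar>\<dots>\<bar> \<le> s ^ Suc J * G"
    proof -
      have "\<bar>y i * d (i - 1) + y (Suc i) * d (Suc i)\<bar> \<le> y i * (s ^ J * G) + y (Suc i) * (s ^ J * G)"
        using Suc.IH[of "i - 1"] Suc.IH[of "Suc i"] p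
        by (intro order.trans[OF abs_triangle_ineq] add_mono)
          (auto simp: abs_mult d_def simp del: jacobi.simps)
      then have "s * \<bar>y i * d (i - 1) + y (Suc i) * d (Suc i)\<bar> \<le> s * ((y i + y (Suc i)) * (s ^ J * G))"
        using s by (intro mult_left_mono) (auto simp: algebra_simps)
      then show ?thesis
        using p s by (simp only: abs_mult abs_divide) (simp add: divide_le_eq mult_ac)
    qed
    finally show ?thesis .
  next
    case False
    then show ?thesis using G0 s by (simp add: jacobi_outside del: jacobi.simps)
  qed
qed

text \<open>The data \<open>tridiag z s c\<close> have size at most \<open>4 * M * r\<close>, the
  first increment is at most this over \<open>2 * m\<close>, and the residual is an increment times
  a diagonal entry of at most \<open>2 * M\<close>.\<close>

lemma jacobi_error:
  assumes y: "\<And>i. i \<in> {1..N} \<Longrightarrow> m < y i \<and> y i < M" and z: "\<And>i. i \<in> {1..N} \<Longrightarrow> m < z i \<and> z i < M"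
    and m: "0 < m" and s: "0 \<le> s" "s \<le> 1" and c: "\<And>i. \<bar>c i\<bar> \<le> r" and i: "i \<in> {1..<N}"
  shows "\<bar>tridiag y s (jacobi N y s (tridiag z s c) J) i - tridiag z s c i\<bar> \<le> 4 * M\<^sup>2 / m * s ^ J * r"
proof -
  have r: "0 \<le> r" using c[of 0] by linarith
  have M: "0 < M" using y[of i] i m by auto
  have g: "\<bar>tridiag z s c j\<bar> \<le> 4 * M * r" if j: "j \<in> {1..<N}" for j
  proof -
    have zj: "0 < z j" "z j \<le> M" "0 < z (Suc j)" "z (Suc j) \<le> M"
      using z[of j] z[of "Suc j"] j m by auto
    have le: "\<bar>z j * c l\<bar> \<le> M * r" "\<bar>z (Suc j) * c l\<bar> \<le> M * r" for l
      using zj c[of l] r by (auto simp: abs_mult intro!: mult_mono)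
    have "\<bar>s * (z j * c (j - 1) + z (Suc j) * c (Suc j))\<bar>
        = s * \<bar>z j * c (j - 1) + z (Suc j) * c (Suc j)\<bar>"
      using s by (simp add: abs_mult)
    also have "\<dots> \<le> 1 * (2 * M * r)"
      using le(1)[of "j - 1"] le(2)[of "Suc j"] s by (intro mult_mono) auto
    finally show ?thesis
      using le(1)[of j] le(2)[of j] by (simp add: tridiag_def algebra_simps)
  qed
  have G: "\<bar>jacobi N y s (tridiag z s c) 1 j\<bar> \<le> 2 * M * r / m" for j
  proof (cases "j \<in> {1..<N}")
    case True
    then have yj: "2 * m \<le> y j + y (Suc j)" using y[of j] y[of "Suc j"] by auto
    have "\<bar>tridiag z s c j\<bar> / (y j + y (Suc j)) \<le> 4 * M * r / (2 * m)"
      using g[OF True] yj m by (intro frac_le) auto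
    then show ?thesis using True yj m by (simp add: abs_divide)
  next
    case False
    then show ?thesis using M r m by (auto simp: jacobi_outside)
  qed
  have ypos: "\<And>i. i \<in> {1..N} \<Longrightarrow> y i > 0" using y m by force
  have yi: "0 < y i" "0 < y (Suc i)" "y i + y (Suc i) \<le> 2 * M"
    using y[of i] y[of "Suc i"] i m by auto
  have "\<bar>tridiag y s (jacobi N y s (tridiag z s c) J) i - tridiag z s c i\<bar>
     = (y i + y (Suc i)) * \<bar>jacobi N y s (tridiag z s c) (Suc J) i - jacobi N y s (tridiag z s c) J i\<bar>"
    using yi by (simp only: jacobi_residual[OF i yi(1,2)] abs_mult) (simp add: abs_minus_commute)
  also have "\<dots> \<le> 2 * M * (s ^ J * (2 * M * r / m))"
    using yi M by (intro mult_mono jacobi_diff[OF ypos s(1) G]) auto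
  finally show ?thesis by (simp add: power2_eq_square mult_ac)
qed

lemma sum_shift_down: "(\<Sum>j\<in>{1..N}. f (j - 1) j) = (\<Sum>i\<in>{0..<N}. f i (Suc i))" for f :: "nat \<Rightarrow> nat \<Rightarrow> real"
  by (rule sum.reindex_bij_witness[of _ Suc "\<lambda>j. j - 1"]) auto

text \<open>A sum over layers is rearranged into a sum over nodes: each interior node collects its
  terms from the layers on both sides, and \<open>v\<close> removes the two boundary nodes. This
  turns layer energies into the rows of the interface system.\<close>

lemma tridiag_sum:
  fixes x v y :: "nat \<Rightarrow> real"
  assumes z: "v 0 = 0" "v N = 0" and N: "N \<ge> 1"
  shows "(\<Sum>j\<in>{1..N}. y j * (x (j - 1) * v (j - 1) + x j * v j - s * (x (j - 1) * v j + x j * v (j - 1))))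
       = (\<Sum>i\<in>{1..<N}. v i * tridiag y s x i)"
proof -
  have "(\<Sum>j\<in>{1..N}. y j * (x (j - 1) * v (j - 1) + x j * v j - s * (x (j - 1) * v j + x j * v (j - 1))))
    = (\<Sum>j\<in>{1..N}. v j * (y j * x j - s * (y j * x (j - 1))))
    + (\<Sum>j\<in>{1..N}. v (j - 1) * (y j * x (j - 1) - s * (y j * x j)))"
    by (simp add: sum.distrib[symmetric] algebra_simps)
  also have "(\<Sum>j\<in>{1..N}. v j * (y j * x j - s * (y j * x (j - 1))))
      = (\<Sum>j\<in>{1..<N}. v j * (y j * x j - s * (y j * x (j - 1))))"
    by (rule sum.mono_neutral_right) (use z in \<open>auto simp: not_less le_antisym\<close>)
  also have "(\<Sum>j\<in>{1..N}. v (j - 1) * (y j * x (j - 1) - s * (y j * x j)))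
     = (\<Sum>i\<in>{0..<N}. v i * (y (Suc i) * x i - s * (y (Suc i) * x (Suc i))))"
    by (rule sum_shift_down[of "\<lambda>i j. v i * (y j * x i - s * (y j * x j))"])
  also have "\<dots> = (\<Sum>i\<in>{1..<N}. v i * (y (Suc i) * x i - s * (y (Suc i) * x (Suc i))))"
    by (rule sum.mono_neutral_right) (use z in \<open>auto simp: not_less_eq_eq\<close>)
  finally show ?thesis
    by (simp add: sum.distrib[symmetric] tridiag_def algebra_simps)
qed

section \<open>Polynomial dependence of the iterates on the data of a mode\<close>

definition monomials :: "nat \<Rightarrow> nat \<Rightarrow> (real \<times> (nat \<Rightarrow> real) \<Rightarrow> real) set" where
  "monomials N J = (\<lambda>(j, l). \<lambda>(s, c). s ^ j * c l) ` ({..J} \<times> {1..<N})"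

lemma finite_monomials: "finite (monomials N J)"
  by (simp add: monomials_def)

lemma card_monomials: "card (monomials N J) \<le> (J + 1) * (N - 1)"
  unfolding monomials_def by (rule order.trans[OF card_image_le]) auto

lemma span_monomials_times:
  assumes "f \<in> span (monomials N J)"
  shows "(\<lambda>p. fst p * f p) \<in> span (monomials N (Suc J))"
proof -
  define L :: "(real \<times> (nat \<Rightarrow> real) \<Rightarrow> real) \<Rightarrow> real \<times> (nat \<Rightarrow> real) \<Rightarrow> real"
    where "L f = (\<lambda>p. fst p * f p)" for f
  have lin: "linear L"
    by (rule linearI) (auto simp: L_def fun_eq_iff algebra_simps)
  have "L ` monomials N J \<subseteq> monomials N (Suc J)"
  proof (clarsimp simp: monomials_def L_def)
    fix j l assume "j \<le> J" "Suc 0 \<le> l" "l < N"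
    then show "(\<lambda>p :: real \<times> (nat \<Rightarrow> real). fst p * (case p of (s, c) \<Rightarrow> s ^ j * c l))
       \<in> (\<lambda>(j, l) (s, c). s ^ j * c l) ` ({..Suc J} \<times> {Suc 0..<N})"
      by (intro image_eqI[of _ _ "(Suc j, l)"]) (auto simp: fun_eq_iff mult.assoc)
  qed
  then have "span (L ` monomials N J) \<subseteq> span (monomials N (Suc J))"
    by (rule span_mono)
  then show ?thesis
    using assms linear_span_image[OF lin, of "monomials N J"] by (auto simp: L_def)
qed

definition monomial_comb :: "nat \<Rightarrow> nat \<Rightarrow> (real \<Rightarrow> (nat \<Rightarrow> real) \<Rightarrow> real) \<Rightarrow> bool" where
  "monomial_comb N J F \<longleftrightarrow> (\<exists>f\<in>span (monomials N J).
     \<forall>s c. (\<forall>i. i \<notin> {1..<N} \<longrightarrow> c i = 0) \<longrightarrow> F s c = f (s, c))"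

lemma monomial_combI:
  assumes "f \<in> span (monomials N J)" "\<And>s c. (\<forall>i. i \<notin> {1..<N} \<longrightarrow> c i = 0) \<Longrightarrow> F s c = f (s, c)"
  shows "monomial_comb N J F"
  using assms unfolding monomial_comb_def by blast

lemma monomial_combE:
  assumes "monomial_comb N J F"
  obtains f where "f \<in> span (monomials N J)"
    "\<forall>s c. (\<forall>i. i \<notin> {1..<N} \<longrightarrow> c i = 0) \<longrightarrow> F s c = f (s, c)"
  using assms unfolding monomial_comb_def by blast

lemma monomial_comb_add:
  assumes "monomial_comb N J F" "monomial_comb N J G"
  shows "monomial_comb N J (\<lambda>s c. F s c + G s c)"
proof -
  obtain f where f: "f \<in> span (monomials N J)"
      "\<forall>s c. (\<forall>i. i \<notin> {1..<N} \<longrightarrow> c i = 0) \<longrightarrow> F s c = f (s, c)"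
    using monomial_combE[OF assms(1)] .
  obtain g where g: "g \<in> span (monomials N J)"
      "\<forall>s c. (\<forall>i. i \<notin> {1..<N} \<longrightarrow> c i = 0) \<longrightarrow> G s c = g (s, c)"
    using monomial_combE[OF assms(2)] .
  show ?thesis
    by (rule monomial_combI[of "f + g"]) (simp_all add: f g span_add)
qed

lemma monomial_comb_scale:
  assumes "monomial_comb N J F"
  shows "monomial_comb N J (\<lambda>s c. t * F s c)"
proof -
  obtain f where f: "f \<in> span (monomials N J)"
      "\<forall>s c. (\<forall>i. i \<notin> {1..<N} \<longrightarrow> c i = 0) \<longrightarrow> F s c = f (s, c)"
    using monomial_combE[OF assms(1)] .
  show ?thesis
    by (rule monomial_combI[of "t *\<^sub>R f"]) (simp_all add: f span_scale)
qed

lemma monomial_comb_times: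
  assumes "monomial_comb N J F"
  shows "monomial_comb N (Suc J) (\<lambda>s c. s * F s c)"
proof -
  obtain f where f: "f \<in> span (monomials N J)"
      "\<forall>s c. (\<forall>i. i \<notin> {1..<N} \<longrightarrow> c i = 0) \<longrightarrow> F s c = f (s, c)"
    using monomial_combE[OF assms(1)] .
  show ?thesis
    by (rule monomial_combI[OF span_monomials_times[OF f(1)]]) (simp add: f)
qed

lemma monomial_comb_0: "monomial_comb N J (\<lambda>s c. 0)"
  by (rule monomial_combI[of 0]) (simp_all add: span_zero)

lemma monomial_comb_coeff: "monomial_comb N J (\<lambda>s c. c l)"
proof (cases "l \<in> {1..<N}")
  case True
  then have "(\<lambda>(s, c). c l) \<in> monomials N J"
    unfolding monomials_def by (intro image_eqI[of _ _ "(0, l)"]) (auto simp: fun_eq_iff)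
  then show ?thesis
    by (intro monomial_combI[of "\<lambda>(s, c). c l"]) (simp_all add: span_base)
next
  case False
  then show ?thesis by (intro monomial_combI[of 0]) (simp_all add: span_zero)
qed

lemma monomial_comb_tridiag: "monomial_comb N (Suc J) (\<lambda>s c. tridiag z s c j)"
proof -
  have 1: "monomial_comb N (Suc J) (\<lambda>s c. (z j + z (Suc j)) * c j)"
    by (rule monomial_comb_scale[OF monomial_comb_coeff])
  have 2: "monomial_comb N (Suc J) (\<lambda>s c. (- 1) * (s * (z j * c (j - 1) + z (Suc j) * c (Suc j))))"
    by (rule monomial_comb_scale[OF monomial_comb_times[OF monomial_comb_add[OF
      monomial_comb_scale[OF monomial_comb_coeff] monomial_comb_scale[OF monomial_comb_coeff]]]])
  show ?thesis using monomial_comb_add[OF 1 2] by (simp add: tridiag_def)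
qed

text \<open>After \<open>J\<close> steps the parameter \<open>y\<close> enters only through the coefficients of a fixed
  finite set of monomials, uniformly in the mode (i.e. in \<open>s\<close> and \<open>c\<close>).\<close>

lemma monomial_comb_jacobi: "monomial_comb N J (\<lambda>s c. jacobi N y s (tridiag z s c) J i)"
proof (induction J arbitrary: i)
  case 0
  then show ?case by (simp add: monomial_comb_0)
next
  case (Suc J)
  show ?case
  proof (cases "i \<in> {1..<N}")
    case True
    note scaled = monomial_comb_scale[OF Suc.IH]
    have 1: "monomial_comb N (Suc J) (\<lambda>s c. s * (y i * jacobi N y s (tridiag z s c) J (i - 1)
        + y (Suc i) * jacobi N y s (tridiag z s c) J (Suc i)))"
      by (rule monomial_comb_times[OF monomial_comb_add[OF scaled scaled]])
    have "monomial_comb N (Suc J) (\<lambda>s c. inverse (y i + y (Suc i)) * (tridiag z s c i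
        + s * (y i * jacobi N y s (tridiag z s c) J (i - 1)
        + y (Suc i) * jacobi N y s (tridiag z s c) J (Suc i))))"
      by (rule monomial_comb_scale[OF monomial_comb_add[OF monomial_comb_tridiag 1]])
    moreover have "jacobi N y s (tridiag z s c) (Suc J) i = inverse (y i + y (Suc i)) * (tridiag z s c i
        + s * (y i * jacobi N y s (tridiag z s c) J (i - 1)
        + y (Suc i) * jacobi N y s (tridiag z s c) J (Suc i)))" for s c
      unfolding jacobi.simps(2)[of N y s "tridiag z s c" J] if_P[OF True]
      by (rule trans[OF divide_inverse mult.commute])
    ultimately show ?thesis by presburger
  next
    case False
    then show ?thesis by (simp add: monomial_comb_0 jacobi_outside del: jacobi.simps)
  qed
qed

section \<open>Abstract layered systems\<close>

text \<open>In the application, \<open>a j\<close> is the Dirichlet form of the \<open>j\<close>-th layer, \<open>hat k i\<close> is the function with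
  trace \<open>sin (k \<pi> (y - p) / (q - p))\<close> on the interface \<open>x = i\<close> and trace \<open>0\<close> on the other interfaces
  which is harmonic in every layer, \<open>Bub i\<close> consists of functions supported in the \<open>i\<close>-th layer, and
  \<open>\<sigma> k = 1 / cosh (k \<pi> / (q - p))\<close> is the coupling of neighbouring interfaces. Since \<open>\<sigma> k\<close> decays only
  like \<open>exp (- k \<pi> / (q - p))\<close>, it has to be raised to a power \<open>J0 \<ge> q - p\<close> to reach the rate \<open>exp (- \<pi> k)\<close>.\<close>

locale layered_system =
  fixes V :: "'v::real_vector set" and N :: nat and a :: "nat \<Rightarrow> 'v \<Rightarrow> 'v \<Rightarrow> real"
    and hat :: "nat \<Rightarrow> nat \<Rightarrow> 'v" and Bub :: "nat \<Rightarrow> 'v set"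
    and \<alpha> \<sigma> :: "nat \<Rightarrow> real" and s C0 :: real and J0 :: nat
  assumes N: "N \<ge> 1"
    and form: "\<And>j. j \<in> {1..N} \<Longrightarrow> psd_form V (a j)"
    and hat_V: "\<And>k i. k \<ge> 1 \<Longrightarrow> i \<in> {1..<N} \<Longrightarrow> hat k i \<in> V"
    and Bub_V: "\<And>i b. i \<in> {1..N} \<Longrightarrow> b \<in> Bub i \<Longrightarrow> b \<in> V"
    and Bub_scale: "\<And>i b c. i \<in> {1..N} \<Longrightarrow> b \<in> Bub i \<Longrightarrow> c *\<^sub>R b \<in> Bub i"
    and Bub_local: "\<And>i j b v. i \<in> {1..N} \<Longrightarrow> j \<in> {1..N} \<Longrightarrow> i \<noteq> j \<Longrightarrow> b \<in> Bub i \<Longrightarrow> v \<in> V \<Longrightarrow> a j b v = 0"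
    and Bub_hat: "\<And>i j b k l. i \<in> {1..N} \<Longrightarrow> j \<in> {1..N} \<Longrightarrow> b \<in> Bub i \<Longrightarrow> k \<ge> 1 \<Longrightarrow> l \<in> {1..<N} \<Longrightarrow>
      a j (hat k l) b = 0"
    and hat_cross: "\<And>j k l i i'. j \<in> {1..N} \<Longrightarrow> k \<ge> 1 \<Longrightarrow> l \<ge> 1 \<Longrightarrow> k \<noteq> l \<Longrightarrow> i \<in> {1..<N} \<Longrightarrow> i' \<in> {1..<N} \<Longrightarrow>
      a j (hat k i) (hat l i') = 0"
    and trace: "\<And>j k x v. j \<in> {1..N} \<Longrightarrow> k \<ge> 1 \<Longrightarrow> x 0 = 0 \<Longrightarrow> x N = 0 \<Longrightarrow> v 0 = 0 \<Longrightarrow> v N = 0 \<Longrightarrow>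
      a j (\<Sum>i\<in>{1..<N}. x i *\<^sub>R hat k i) (\<Sum>i\<in>{1..<N}. v i *\<^sub>R hat k i) =
        \<alpha> k * (x (j - 1) * v (j - 1) + x j * v j - \<sigma> k * (x (j - 1) * v j + x j * v (j - 1)))"
    and \<alpha>: "\<And>k. k \<ge> 1 \<Longrightarrow> 0 < \<alpha> k"
    and \<sigma>: "\<And>k. k \<ge> 1 \<Longrightarrow> 0 \<le> \<sigma> k" "\<And>k. k \<ge> 1 \<Longrightarrow> \<sigma> k \<le> s"
    and s: "s < 1"
    and \<sigma>_decay: "\<And>k. k \<ge> 1 \<Longrightarrow> \<sigma> k ^ J0 \<le> C0 * exp (- pi * real k)"
    and dense: "\<And>v e. v \<in> V \<Longrightarrow> 0 < e \<Longrightarrow> \<exists>b c K. (\<forall>i\<in>{1..N}. b i \<in> Bub i) \<and>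
      (\<Sum>j\<in>{1..N}. a j (v - ((\<Sum>i\<in>{1..N}. b i) + (\<Sum>k\<in>{1..K}. \<Sum>i\<in>{1..<N}. c k i *\<^sub>R hat k i)))
                      (v - ((\<Sum>i\<in>{1..N}. b i) + (\<Sum>k\<in>{1..K}. \<Sum>i\<in>{1..<N}. c k i *\<^sub>R hat k i)))) < e"
begin

section \<open>Block structure of the energy\<close>

definition H :: "nat \<Rightarrow> (nat \<Rightarrow> real) \<Rightarrow> 'v" where
  "H k x = (\<Sum>i\<in>{1..<N}. x i *\<^sub>R hat k i)"

definition A :: "(nat \<Rightarrow> real) \<Rightarrow> 'v \<Rightarrow> 'v \<Rightarrow> real" where
  "A y v w = (\<Sum>j\<in>{1..N}. y j * a j v w)"

lemma psd_form_A:
  assumes "\<And>j. j \<in> {1..N} \<Longrightarrow> 0 \<le> y j"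
  shows "psd_form V (A y)"
proof
  have f1: "psd_form V (a 1)" using N by (intro form) auto
  show "subspace V" by (rule psd_form.V[OF f1])
  fix v w z c assume v: "v \<in> V" and w: "w \<in> V" and z: "z \<in> V"
  show "A y v w = A y w v"
    unfolding A_def using v w by (intro sum.cong refl) (simp add: psd_form.sym[OF form, of _ v w])
  show "A y (v + w) z = A y v z + A y w z"
    unfolding A_def sum.distrib[symmetric] using v w z
    by (intro sum.cong refl) (simp add: psd_form.add[OF form] algebra_simps)
  show "A y (c *\<^sub>R v) z = c * A y v z"
    unfolding A_def sum_distrib_left using v z
    by (intro sum.cong refl) (simp add: psd_form.scale[OF form])
  show "0 \<le> A y v v"
    unfolding A_def using v assms by (intro sum_nonneg mult_nonneg_nonneg psd_form.psd[OF form]) auto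
qed

sublocale one: psd_form V "A (\<lambda>_. 1)"
  by (rule psd_form_A) simp

definition vect :: "nat \<Rightarrow> (nat \<Rightarrow> 'v) \<Rightarrow> (nat \<Rightarrow> nat \<Rightarrow> real) \<Rightarrow> 'v" where
  "vect L b c = (\<Sum>i\<in>{1..N}. b i) + (\<Sum>k\<in>{1..L}. H k (c k))"

lemma H_V [simp]: "k \<ge> 1 \<Longrightarrow> H k x \<in> V"
  unfolding H_def by (intro one.V_sum one.V_closed(3) hat_V) auto

lemma Bub_sum_V: "(\<And>i. i \<in> {1..N} \<Longrightarrow> b i \<in> Bub i) \<Longrightarrow> (\<Sum>i\<in>{1..N}. b i) \<in> V"
  using Bub_V by (intro one.V_sum) auto

lemma H_sum_V [simp]: "(\<Sum>k\<in>{1..L}. H k (c k)) \<in> V"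
  by (intro one.V_sum) auto

lemma vect_V: "(\<And>i. i \<in> {1..N} \<Longrightarrow> b i \<in> Bub i) \<Longrightarrow> vect L b c \<in> V"
  unfolding vect_def by (intro one.V_closed(2) Bub_sum_V H_sum_V)

lemma H_zero [simp]: "H k (\<lambda>_. 0) = 0"
  by (simp add: H_def)

text \<open>Three orthogonalities make the form of a layer block diagonal: bubbles of other layers
  are invisible, hats are orthogonal to bubbles, and different modes are orthogonal. Both vectors
  carry the same truncation \<open>L\<close>, so their modes pair off.\<close>

lemma a_vect:
  assumes b: "\<And>i. i \<in> {1..N} \<Longrightarrow> b i \<in> Bub i" and b': "\<And>i. i \<in> {1..N} \<Longrightarrow> b' i \<in> Bub i"
    and j: "j \<in> {1..N}"
  shows "a j (vect L b c) (vect L b' v) = a j (b j) (b' j) + (\<Sum>k\<in>{1..L}. a j (H k (c k)) (H k (v k)))"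
proof -
  interpret F: psd_form V "a j" by (rule form[OF j])
  have bV: "b i \<in> V" "b' i \<in> V" if "i \<in> {1..N}" for i
    using that b b' Bub_V by auto
  have HB: "a j (H k x) z = 0" if "k \<ge> 1" "i \<in> {1..N}" "z \<in> Bub i" for k x i z
  proof -
    have "a j (H k x) z = (\<Sum>l\<in>{1..<N}. x l * a j (hat k l) z)"
      unfolding H_def using that Bub_V hat_V by (subst F.sum) (auto simp: F.scale)
    also have "\<dots> = 0" using that j by (intro sum.neutral ballI) (simp add: Bub_hat)
    finally show ?thesis .
  qed
  have HH: "a j (H k x) (H l x') = 0" if "k \<ge> 1" "l \<ge> 1" "k \<noteq> l" for k l x x'
  proof -
    have z: "a j (hat k i) (H l x') = 0" if i: "i \<in> {1..<N}" for i
    proof -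
      have "a j (hat k i) (H l x') = (\<Sum>i'\<in>{1..<N}. x' i' * a j (hat k i) (hat l i'))"
        unfolding H_def using \<open>k \<ge> 1\<close> \<open>l \<ge> 1\<close> i hat_V by (subst F.sum_right) (auto simp: F.scale_right)
      also have "\<dots> = 0" using that \<open>k \<ge> 1\<close> \<open>l \<ge> 1\<close> \<open>k \<noteq> l\<close> j i
        by (intro sum.neutral ballI) (simp add: hat_cross)
      finally show ?thesis .
    qed
    have "a j (H k x) (H l x') = (\<Sum>i\<in>{1..<N}. x i * a j (hat k i) (H l x'))"
      using that hat_V unfolding H_def[of k] by (subst F.sum) (auto simp: F.scale)
    also have "\<dots> = 0" using z by simp
    finally show ?thesis .
  qed
  have SB: "a j (\<Sum>i\<in>{1..N}. b i) (\<Sum>i\<in>{1..N}. b' i) = a j (b j) (b' j)"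
  proof -
    have "a j (\<Sum>i\<in>{1..N}. b i) (\<Sum>i\<in>{1..N}. b' i) = (\<Sum>i\<in>{1..N}. a j (b i) (\<Sum>i\<in>{1..N}. b' i))"
      by (intro F.sum Bub_sum_V bV b') auto
    also have "\<dots> = (\<Sum>i\<in>{1..N}. if i = j then a j (b j) (\<Sum>i\<in>{1..N}. b' i) else 0)"
    proof (intro sum.cong refl)
      fix i assume i: "i \<in> {1..N}"
      have "a j (b i) (\<Sum>i\<in>{1..N}. b' i) = 0" if "i \<noteq> j"
        using i j that b[OF i] Bub_sum_V[OF b'] by (rule Bub_local)
      then show "a j (b i) (\<Sum>i\<in>{1..N}. b' i) = (if i = j then a j (b j) (\<Sum>i\<in>{1..N}. b' i) else 0)"
        by simp
    qed
    also have "\<dots> = a j (b j) (\<Sum>i\<in>{1..N}. b' i)" using j by (simp add: sum.delta)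
    also have "\<dots> = (\<Sum>i\<in>{1..N}. a j (b j) (b' i))"
      using bV j by (intro F.sum_right) auto
    also have "\<dots> = (\<Sum>i\<in>{1..N}. if i = j then a j (b j) (b' j) else 0)"
    proof (intro sum.cong refl)
      fix i assume i: "i \<in> {1..N}"
      have "a j (b j) (b' i) = 0" if "i \<noteq> j"
        using Bub_local[OF i j that b'[OF i] bV(1)[OF j]] F.sym bV i j by metis
      then show "a j (b j) (b' i) = (if i = j then a j (b j) (b' j) else 0)" by simp
    qed
    also have "\<dots> = a j (b j) (b' j)" using j by (simp add: sum.delta)
    finally show ?thesis .
  qed
  have SHB: "a j (\<Sum>k\<in>{1..L}. H k (c k)) (\<Sum>i\<in>{1..N}. b' i) = 0" if "\<And>i. i \<in> {1..N} \<Longrightarrow> b' i \<in> Bub i" for c b'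
  proof -
    have *: "\<And>i. i \<in> {1..N} \<Longrightarrow> b' i \<in> V" using that Bub_V by auto
    have "a j (\<Sum>k\<in>{1..L}. H k (c k)) (\<Sum>i\<in>{1..N}. b' i) = (\<Sum>k\<in>{1..L}. a j (H k (c k)) (\<Sum>i\<in>{1..N}. b' i))"
      by (intro F.sum Bub_sum_V that) auto
    also have "\<dots> = (\<Sum>k\<in>{1..L}. \<Sum>i\<in>{1..N}. a j (H k (c k)) (b' i))"
      by (intro sum.cong refl F.sum_right *) auto
    also have "\<dots> = 0" using HB that by (intro sum.neutral ballI) auto
    finally show ?thesis .
  qed
  have SHH: "a j (\<Sum>k\<in>{1..L}. H k (c k)) (\<Sum>k\<in>{1..L}. H k (v k)) = (\<Sum>k\<in>{1..L}. a j (H k (c k)) (H k (v k)))"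
  proof -
    have "a j (\<Sum>k\<in>{1..L}. H k (c k)) (\<Sum>k\<in>{1..L}. H k (v k)) =
        (\<Sum>k\<in>{1..L}. a j (H k (c k)) (\<Sum>k\<in>{1..L}. H k (v k)))"
      by (intro F.sum H_sum_V) auto
    also have "\<dots> = (\<Sum>k\<in>{1..L}. \<Sum>l\<in>{1..L}. a j (H k (c k)) (H l (v l)))"
      by (intro sum.cong refl F.sum_right) auto
    also have "\<dots> = (\<Sum>k\<in>{1..L}. \<Sum>l\<in>{1..L}. if l = k then a j (H k (c k)) (H k (v k)) else 0)"
      by (intro sum.cong refl) (auto simp: HH)
    also have "\<dots> = (\<Sum>k\<in>{1..L}. a j (H k (c k)) (H k (v k)))"
      by (intro sum.cong refl) (simp add: sum.delta)
    finally show ?thesis .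
  qed
  have V1: "(\<Sum>i\<in>{1..N}. b i) \<in> V" "(\<Sum>i\<in>{1..N}. b' i) \<in> V" using Bub_sum_V b b' by blast+
  have "a j (\<Sum>i\<in>{1..N}. b i) (\<Sum>k\<in>{1..L}. H k (v k)) = 0"
    using F.sym[OF V1(1) H_sum_V] SHB[OF b] by simp
  then show ?thesis
    unfolding vect_def F.add[OF V1(1) H_sum_V F.V_closed(2)[OF V1(2) H_sum_V]]
      F.add_right[OF V1(2) H_sum_V V1(1)] F.add_right[OF V1(2) H_sum_V H_sum_V]
    using SB SHB[OF b'] SHH by simp
qed

lemma A_H:
  assumes "k \<ge> 1" "x 0 = 0" "x N = 0" "v 0 = 0" "v N = 0"
  shows "A y (H k x) (H k v) = \<alpha> k * (\<Sum>i\<in>{1..<N}. v i * tridiag y (\<sigma> k) x i)"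
proof -
  have "A y (H k x) (H k v) = \<alpha> k * (\<Sum>j\<in>{1..N}. y j * (x (j - 1) * v (j - 1) + x j * v j
      - \<sigma> k * (x (j - 1) * v j + x j * v (j - 1))))"
    unfolding A_def sum_distrib_left H_def using assms
    by (intro sum.cong refl) (simp add: trace del: One_nat_def)
  then show ?thesis using tridiag_sum[of v N y x "\<sigma> k"] assms N by simp
qed

text \<open>In these coordinates the variational problem falls apart into small ones: one for each
  layer, in which \<open>y j\<close> is a mere factor, and one tridiagonal system for each
  mode.\<close>

lemma A_vect:
  assumes b: "\<And>i. i \<in> {1..N} \<Longrightarrow> b i \<in> Bub i" and b': "\<And>i. i \<in> {1..N} \<Longrightarrow> b' i \<in> Bub i"
    and c: "\<And>k i. i \<notin> {1..<N} \<Longrightarrow> c k i = 0" and v: "\<And>k i. i \<notin> {1..<N} \<Longrightarrow> v k i = 0"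
  shows "A y (vect L b c) (vect L b' v) = (\<Sum>j\<in>{1..N}. y j * a j (b j) (b' j))
     + (\<Sum>k\<in>{1..L}. \<alpha> k * (\<Sum>i\<in>{1..<N}. v k i * tridiag y (\<sigma> k) (c k) i))"
proof -
  have "A y (vect L b c) (vect L b' v) = (\<Sum>j\<in>{1..N}. y j * a j (b j) (b' j))
     + (\<Sum>j\<in>{1..N}. \<Sum>k\<in>{1..L}. y j * a j (H k (c k)) (H k (v k)))"
    unfolding A_def sum.distrib[symmetric]
  proof (intro sum.cong refl)
    fix j assume j: "j \<in> {1..N}"
    have "a j (vect L b c) (vect L b' v) = a j (b j) (b' j) + (\<Sum>k\<in>{1..L}. a j (H k (c k)) (H k (v k)))"
      using b b' j by (rule a_vect)
    then show "y j * a j (vect L b c) (vect L b' v) = y j * a j (b j) (b' j)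
        + (\<Sum>k\<in>{1..L}. y j * a j (H k (c k)) (H k (v k)))"
      by (simp add: distrib_left sum_distrib_left)
  qed
  also have "(\<Sum>j\<in>{1..N}. \<Sum>k\<in>{1..L}. y j * a j (H k (c k)) (H k (v k))) = (\<Sum>k\<in>{1..L}. A y (H k (c k)) (H k (v k)))"
    unfolding A_def by (rule sum.swap)
  also have "\<dots> = (\<Sum>k\<in>{1..L}. \<alpha> k * (\<Sum>i\<in>{1..<N}. v k i * tridiag y (\<sigma> k) (c k) i))"
    using c v by (intro sum.cong refl A_H) auto
  finally show ?thesis .
qed

text \<open>Arithmetic-geometric mean: the coupling term of a layer is at most \<open>s\<close>
  times its diagonal terms, and \<open>s < 1\<close> leaves a fixed fraction of them. An interior
  node belongs to two layers, whence the factor \<open>2\<close>; the bubble energies are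
  nonnegative and are dropped.\<close>

lemma coercive:
  assumes b: "\<And>i. i \<in> {1..N} \<Longrightarrow> b i \<in> Bub i" and v: "\<And>k i. i \<notin> {1..<N} \<Longrightarrow> v k i = 0"
  shows "2 * (1 - s) * (\<Sum>k\<in>{1..L}. \<alpha> k * (\<Sum>i\<in>{1..<N}. (v k i)\<^sup>2)) \<le> A (\<lambda>_. 1) (vect L b v) (vect L b v)"
proof -
  have *: "2 * (1 - s) * (\<Sum>i\<in>{1..<N}. (x i)\<^sup>2) \<le> (\<Sum>i\<in>{1..<N}. x i * tridiag (\<lambda>_. 1) (\<sigma> k) x i)"
    if k: "k \<ge> 1" and x: "x 0 = 0" "x N = 0" for k x
  proof -
    \<comment> \<open>With coupling \<open>0\<close> and weights \<open>1\<close>,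
      \<open>tridiag_sum\<close> says that every interior node is counted twice.\<close>
    have 1: "(\<Sum>j\<in>{1..N}. (x (j - 1))\<^sup>2 + (x j)\<^sup>2) = 2 * (\<Sum>i\<in>{1..<N}. (x i)\<^sup>2)"
      using tridiag_sum[of x N "\<lambda>_. 1" x 0] x N
      by (simp add: tridiag_def power2_eq_square sum_distrib_left mult_ac)
    have "(\<Sum>j\<in>{1..N}. (1 - s) * ((x (j - 1))\<^sup>2 + (x j)\<^sup>2))
       \<le> (\<Sum>j\<in>{1..N}. 1 * (x (j - 1) * x (j - 1) + x j * x j - \<sigma> k * (x (j - 1) * x j + x j * x (j - 1))))"
    proof (intro sum_mono)
      fix j
      have "\<sigma> k * (2 * (x (j - 1) * x j)) \<le> \<sigma> k * ((x (j - 1))\<^sup>2 + (x j)\<^sup>2)"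
        using \<sigma>(1)[OF k] sum_squares_bound[of "x (j - 1)" "x j"] by (intro mult_left_mono) auto
      also have "\<dots> \<le> s * ((x (j - 1))\<^sup>2 + (x j)\<^sup>2)"
        using \<sigma>(2)[OF k] by (intro mult_right_mono) auto
      finally show "(1 - s) * ((x (j - 1))\<^sup>2 + (x j)\<^sup>2)
         \<le> 1 * (x (j - 1) * x (j - 1) + x j * x j - \<sigma> k * (x (j - 1) * x j + x j * x (j - 1)))"
        by (simp add: power2_eq_square algebra_simps)
    qed
    also have "\<dots> = (\<Sum>i\<in>{1..<N}. x i * tridiag (\<lambda>_. 1) (\<sigma> k) x i)"
      using tridiag_sum[of x N "\<lambda>_. 1" x "\<sigma> k"] x N by simp
    finally show ?thesis unfolding sum_distrib_left[symmetric] 1 by (simp only: mult_ac)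
  qed
  have "2 * (1 - s) * (\<Sum>k\<in>{1..L}. \<alpha> k * (\<Sum>i\<in>{1..<N}. (v k i)\<^sup>2))
      = (\<Sum>k\<in>{1..L}. \<alpha> k * (2 * (1 - s) * (\<Sum>i\<in>{1..<N}. (v k i)\<^sup>2)))"
    by (simp only: sum_distrib_left mult_ac)
  also have "\<dots> \<le> (\<Sum>k\<in>{1..L}. \<alpha> k * (\<Sum>i\<in>{1..<N}. v k i * tridiag (\<lambda>_. 1) (\<sigma> k) (v k) i))"
    using v \<alpha> by (intro sum_mono mult_left_mono *) (auto intro: less_imp_le)
  also have "\<dots> \<le> (\<Sum>j\<in>{1..N}. 1 * a j (b j) (b j)) + \<dots>"
    using psd_form.psd[OF form] b Bub_V by (auto intro!: sum_nonneg)
  also have "\<dots> = A (\<lambda>_. 1) (vect L b v) (vect L b v)"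
    by (rule A_vect[OF b b v v, symmetric])
  finally show ?thesis .
qed

text \<open>Padding the coefficients with zeros makes the approximant independent of the truncation
  beyond \<open>K\<close>. Vectors approximated separately can then be compared at a common
  truncation.\<close>

lemma dense':
  assumes "v \<in> V" "0 < e"
  shows "\<exists>b c K. (\<forall>i\<in>{1..N}. b i \<in> Bub i) \<and> (\<forall>k i. i \<notin> {1..<N} \<longrightarrow> c k i = 0) \<and>
    (\<forall>L\<ge>K. one.nrm (v - vect L b c) < e)"
proof -
  obtain b c K where *: "\<forall>i\<in>{1..N}. b i \<in> Bub i"
      "(\<Sum>j\<in>{1..N}. a j (v - ((\<Sum>i\<in>{1..N}. b i) + (\<Sum>k\<in>{1..K}. \<Sum>i\<in>{1..<N}. c k i *\<^sub>R hat k i)))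
                      (v - ((\<Sum>i\<in>{1..N}. b i) + (\<Sum>k\<in>{1..K}. \<Sum>i\<in>{1..<N}. c k i *\<^sub>R hat k i)))) < e\<^sup>2"
    using dense[OF assms(1), of "e\<^sup>2"] assms(2) by auto
  define c' where "c' k i = (if k \<le> K \<and> i \<in> {1..<N} then c k i else 0)" for k i
  have vect: "vect L b c' = (\<Sum>i\<in>{1..N}. b i) + (\<Sum>k\<in>{1..K}. \<Sum>i\<in>{1..<N}. c k i *\<^sub>R hat k i)" if "L \<ge> K" for L
  proof -
    have "(\<Sum>k\<in>{1..L}. H k (c' k)) = (\<Sum>k\<in>{1..K}. H k (c' k))"
      using that by (intro sum.mono_neutral_right) (auto simp: c'_def H_def)
    also have "\<dots> = (\<Sum>k\<in>{1..K}. \<Sum>i\<in>{1..<N}. c k i *\<^sub>R hat k i)"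
      by (intro sum.cong refl) (auto simp: c'_def H_def intro!: sum.cong)
    finally show ?thesis by (simp add: vect_def)
  qed
  have "one.nrm (v - vect L b c') < e" if "L \<ge> K" for L
  proof -
    have "A (\<lambda>_. 1) (v - vect L b c') (v - vect L b c') < e\<^sup>2"
      using *(2) unfolding vect[OF that] A_def by simp
    then show ?thesis
      unfolding one.nrm_def using assms(2) real_less_lsqrt by simp
  qed
  then show ?thesis using * by (intro exI[of _ b] exI[of _ c'] exI[of _ K]) (auto simp: c'_def)
qed

lemma A_bound:
  assumes v: "v \<in> V" and y: "\<And>j. j \<in> {1..N} \<Longrightarrow> m \<le> y j \<and> y j \<le> M"
  shows "m * A (\<lambda>_. 1) v v \<le> A y v v" "A y v v \<le> M * A (\<lambda>_. 1) v v"
proof -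
  have p: "0 \<le> a j v v" if "j \<in> {1..N}" for j using psd_form.psd[OF form[OF that] v] .
  show "m * A (\<lambda>_. 1) v v \<le> A y v v"
    unfolding A_def sum_distrib_left mult_1 using y p by (intro sum_mono mult_right_mono) auto
  show "A y v v \<le> M * A (\<lambda>_. 1) v v"
    unfolding A_def sum_distrib_left mult_1 using y p by (intro sum_mono mult_right_mono) auto
qed

lemma A_Cauchy_Schwarz:
  assumes v: "v \<in> V" and w: "w \<in> V" and y: "\<And>j. j \<in> {1..N} \<Longrightarrow> 0 \<le> y j \<and> y j \<le> M"
  shows "\<bar>A y v w\<bar> \<le> M * one.nrm v * one.nrm w"
proof -
  interpret Y: psd_form V "A y" by (rule psd_form_A) (use y in auto)
  have "0 \<le> M" using y[of 1] N by force
  have n: "Y.nrm z \<le> sqrt M * one.nrm z" if "z \<in> V" for z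
    using A_bound(2)[OF that y] by (simp add: Y.nrm_def one.nrm_def real_sqrt_mult[symmetric])
  have "\<bar>A y v w\<bar> \<le> Y.nrm v * Y.nrm w" by (rule Y.Cauchy_Schwarz[OF v w])
  also have "\<dots> \<le> (sqrt M * one.nrm v) * (sqrt M * one.nrm w)"
    using v w n \<open>0 \<le> M\<close> by (intro mult_mono) auto
  also have "\<dots> = M * one.nrm v * one.nrm w"
    using \<open>0 \<le> M\<close> by (simp add: algebra_simps)
  finally show ?thesis .
qed

text \<open>The bubble terms cancel exactly, since \<open>y j * (z j / y j) = z j\<close>. For the
  hats, \<open>jacobi_error\<close> bounds each row by the size of \<open>c k\<close>;
  Cauchy-Schwarz over all pairs of a mode and a node with weight \<open>\<alpha> k\<close>, followed
  by \<open>coercive\<close> for both factors, leads back to energy norms, and the number of modes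
  drops out. The number \<open>J k\<close> of steps may vary with the mode as long as the bound
  \<open>E\<close> is common.\<close>

lemma residual_bound:
  assumes y: "\<And>j. j \<in> {1..N} \<Longrightarrow> m < y j \<and> y j < M" and z: "\<And>j. j \<in> {1..N} \<Longrightarrow> m < z j \<and> z j < M"
    and m: "0 < m"
    and b: "\<And>i. i \<in> {1..N} \<Longrightarrow> b i \<in> Bub i" and c: "\<And>k i. i \<notin> {1..<N} \<Longrightarrow> c k i = 0"
    and b': "\<And>i. i \<in> {1..N} \<Longrightarrow> b' i \<in> Bub i" and v: "\<And>k i. i \<notin> {1..<N} \<Longrightarrow> v k i = 0"
    and E: "\<And>k. k \<in> {1..L} \<Longrightarrow> \<sigma> k ^ J k \<le> E" and E0: "0 \<le> E"
    and x: "\<And>k. x k = jacobi N y (\<sigma> k) (tridiag z (\<sigma> k) (c k)) (J k)"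
  shows "\<bar>A y (vect L (\<lambda>i. (z i / y i) *\<^sub>R b i) x) (vect L b' v) - A z (vect L b c) (vect L b' v)\<bar>
    \<le> 2 * M\<^sup>2 * sqrt (real N) / (m * (1 - s)) * E * one.nrm (vect L b c) * one.nrm (vect L b' v)"
proof -
  define P where "P = vect L b c"
  define Q where "Q = vect L b' v"
  define K where "K = 4 * M\<^sup>2 / m * E"
  define r where "r k = L2_set (c k) {1..<N}" for k
  have x0: "\<And>k i. i \<notin> {1..<N} \<Longrightarrow> x k i = 0"
    unfolding x by (rule jacobi_outside)
  have zb: "(z i / y i) *\<^sub>R b i \<in> Bub i" if "i \<in> {1..N}" for i
    using Bub_scale[OF that b[OF that]] .
  have Kpos: "0 \<le> K" using m E0 by (simp add: K_def)
  have PV: "P \<in> V" and QV: "Q \<in> V"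
    unfolding P_def Q_def using b b' by (auto intro!: vect_V)
  have "(\<Sum>j\<in>{1..N}. y j * a j ((z j / y j) *\<^sub>R b j) (b' j)) = (\<Sum>j\<in>{1..N}. z j * a j (b j) (b' j))"
  proof (intro sum.cong refl)
    fix j assume j: "j \<in> {1..N}"
    then have "y j \<noteq> 0" using y m by force
    then show "y j * a j ((z j / y j) *\<^sub>R b j) (b' j) = z j * a j (b j) (b' j)"
      using psd_form.scale[OF form[OF j] Bub_V[OF j b[OF j]] Bub_V[OF j b'[OF j]]] by simp
  qed
  moreover have "A y (vect L (\<lambda>i. (z i / y i) *\<^sub>R b i) x) Q =
      (\<Sum>j\<in>{1..N}. y j * a j ((z j / y j) *\<^sub>R b j) (b' j))
      + (\<Sum>k\<in>{1..L}. \<alpha> k * (\<Sum>i\<in>{1..<N}. v k i * tridiag y (\<sigma> k) (x k) i))"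
    unfolding Q_def by (rule A_vect[OF zb b' x0 v])
  moreover have "A z P Q = (\<Sum>j\<in>{1..N}. z j * a j (b j) (b' j))
      + (\<Sum>k\<in>{1..L}. \<alpha> k * (\<Sum>i\<in>{1..<N}. v k i * tridiag z (\<sigma> k) (c k) i))"
    unfolding P_def Q_def by (rule A_vect[OF b b' c v])
  ultimately have "A y (vect L (\<lambda>i. (z i / y i) *\<^sub>R b i) x) Q - A z P Q
     = (\<Sum>k\<in>{1..L}. \<alpha> k * (\<Sum>i\<in>{1..<N}. v k i * tridiag y (\<sigma> k) (x k) i))
     - (\<Sum>k\<in>{1..L}. \<alpha> k * (\<Sum>i\<in>{1..<N}. v k i * tridiag z (\<sigma> k) (c k) i))"
    by simp
  also have "\<dots> = (\<Sum>k\<in>{1..L}. \<Sum>i\<in>{1..<N}. \<alpha> k * (v k i * (tridiag y (\<sigma> k) (x k) i - tridiag z (\<sigma> k) (c k) i)))"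
    by (simp only: sum_subtractf[symmetric] sum_distrib_left right_diff_distrib)
  finally have "\<bar>A y (vect L (\<lambda>i. (z i / y i) *\<^sub>R b i) x) Q - A z P Q\<bar>
     \<le> (\<Sum>k\<in>{1..L}. \<Sum>i\<in>{1..<N}. \<bar>\<alpha> k * (v k i * (tridiag y (\<sigma> k) (x k) i - tridiag z (\<sigma> k) (c k) i))\<bar>)"
    by (simp only:) (intro order.trans[OF sum_abs] sum_mono order.refl)
  also have "\<dots> \<le> (\<Sum>k\<in>{1..L}. \<Sum>i\<in>{1..<N}. \<alpha> k * (\<bar>v k i\<bar> * (K * r k)))"
  proof (intro sum_mono)
    fix k i assume k: "k \<in> {1..L}" and i: "i \<in> {1..<N}"
    \<comment> \<open>The Euclidean norm takes the place of the maximum norm because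
      \<open>coercive\<close> controls it; using it at every interior node produces the factor
      \<open>sqrt (real N)\<close>.\<close>
    have cr: "\<bar>c k j\<bar> \<le> r k" for j
    proof (cases "j \<in> {1..<N}")
      case True
      have "\<bar>c k j\<bar> \<le> L2_set (\<lambda>i. \<bar>c k i\<bar>) {1..<N}"
        using True by (intro member_le_L2_set) auto
      then show ?thesis by (simp add: r_def L2_set_def)
    next
      case False
      then show ?thesis using c by (simp add: r_def L2_set_nonneg)
    qed
    have "\<bar>tridiag y (\<sigma> k) (x k) i - tridiag z (\<sigma> k) (c k) i\<bar> \<le> 4 * M\<^sup>2 / m * \<sigma> k ^ J k * r k"
      unfolding x using k \<sigma>[of k] s by (intro jacobi_error[OF y z m _ _ cr i]) auto
    also have "\<dots> \<le> 4 * M\<^sup>2 / m * E * r k"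
      using E[OF k] m by (intro mult_right_mono mult_left_mono) (auto simp: r_def L2_set_nonneg)
    finally show "\<bar>\<alpha> k * (v k i * (tridiag y (\<sigma> k) (x k) i - tridiag z (\<sigma> k) (c k) i))\<bar> \<le> \<alpha> k * (\<bar>v k i\<bar> * (K * r k))"
      using \<alpha>[of k] k unfolding abs_mult K_def by (intro mult_mono) (auto simp: less_imp_le)
  qed
  also have "\<dots> = K * (\<Sum>(k, i)\<in>{1..L} \<times> {1..<N}. \<bar>sqrt (\<alpha> k) * v k i\<bar> * \<bar>sqrt (\<alpha> k) * r k\<bar>)"
  proof -
    have "\<alpha> k * (\<bar>v k i\<bar> * (K * r k)) = K * (\<bar>sqrt (\<alpha> k) * v k i\<bar> * \<bar>sqrt (\<alpha> k) * r k\<bar>)" if "k \<in> {1..L}" for k i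
    proof -
      have 1: "\<bar>sqrt (\<alpha> k)\<bar> * \<bar>sqrt (\<alpha> k)\<bar> = \<alpha> k" using \<alpha>[of k] that by simp
      have 2: "\<bar>r k\<bar> = r k" by (simp add: r_def L2_set_nonneg)
      have "K * (\<bar>sqrt (\<alpha> k) * v k i\<bar> * \<bar>sqrt (\<alpha> k) * r k\<bar>)
          = (\<bar>sqrt (\<alpha> k)\<bar> * \<bar>sqrt (\<alpha> k)\<bar>) * (\<bar>v k i\<bar> * (K * \<bar>r k\<bar>))"
        by (simp only: abs_mult mult_ac)
      then show ?thesis unfolding 1 2 by (rule sym)
    qed
    then have "(\<Sum>k\<in>{1..L}. \<Sum>i\<in>{1..<N}. \<alpha> k * (\<bar>v k i\<bar> * (K * r k)))
      = (\<Sum>k\<in>{1..L}. \<Sum>i\<in>{1..<N}. K * (\<bar>sqrt (\<alpha> k) * v k i\<bar> * \<bar>sqrt (\<alpha> k) * r k\<bar>))"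
      by (intro sum.cong refl) auto
    then show ?thesis by (simp only: sum.cartesian_product sum_distrib_left split_def)
  qed
  also have "\<dots> \<le> K * (L2_set (\<lambda>(k, i). sqrt (\<alpha> k) * v k i) ({1..L} \<times> {1..<N})
       * L2_set (\<lambda>(k, i). sqrt (\<alpha> k) * r k) ({1..L} \<times> {1..<N}))"
    using Kpos unfolding split_def by (intro mult_left_mono L2_set_mult_ineq)
  also have "\<dots> \<le> K * (sqrt (A (\<lambda>_. 1) Q Q / (2 * (1 - s))) * sqrt (N * (A (\<lambda>_. 1) P P / (2 * (1 - s)))))"
  proof (intro mult_left_mono mult_mono)
    have sq: "(sqrt (\<alpha> k) * t)\<^sup>2 = \<alpha> k * t\<^sup>2" if "k \<in> {1..L}" for k t
      using \<alpha>[of k] that by (simp add: power_mult_distrib)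
    have "(\<Sum>(k, i)\<in>{1..L} \<times> {1..<N}. (sqrt (\<alpha> k) * v k i)\<^sup>2) = (\<Sum>k\<in>{1..L}. \<alpha> k * (\<Sum>i\<in>{1..<N}. (v k i)\<^sup>2))"
      unfolding sum.cartesian_product[symmetric] sum_distrib_left by (intro sum.cong refl) (simp add: sq)
    also have "\<dots> \<le> A (\<lambda>_. 1) Q Q / (2 * (1 - s))"
    proof -
      have "2 * (1 - s) * (\<Sum>k\<in>{1..L}. \<alpha> k * (\<Sum>i\<in>{1..<N}. (v k i)\<^sup>2)) \<le> A (\<lambda>_. 1) Q Q"
        unfolding Q_def by (rule coercive[OF b' v])
      then show ?thesis using s by (simp add: pos_le_divide_eq mult.commute)
    qed
    finally show "L2_set (\<lambda>(k, i). sqrt (\<alpha> k) * v k i) ({1..L} \<times> {1..<N}) \<le> sqrt (A (\<lambda>_. 1) Q Q / (2 * (1 - s)))"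
      unfolding L2_set_def split_def by simp
    have "(\<Sum>(k, i)\<in>{1..L} \<times> {1..<N}. (sqrt (\<alpha> k) * r k)\<^sup>2) = (N - 1) * (\<Sum>k\<in>{1..L}. \<alpha> k * (r k)\<^sup>2)"
      unfolding sum.cartesian_product[symmetric] sum_distrib_left
      by (intro sum.cong refl) (simp add: sq)
    also have "\<dots> \<le> N * (\<Sum>k\<in>{1..L}. \<alpha> k * (r k)\<^sup>2)"
      using \<alpha> by (intro mult_right_mono sum_nonneg) (auto simp: less_imp_le)
    also have "(\<Sum>k\<in>{1..L}. \<alpha> k * (r k)\<^sup>2) = (\<Sum>k\<in>{1..L}. \<alpha> k * (\<Sum>i\<in>{1..<N}. (c k i)\<^sup>2))"
      by (intro sum.cong refl) (simp add: r_def L2_set_def sum_nonneg)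
    also have "N * \<dots> \<le> N * (A (\<lambda>_. 1) P P / (2 * (1 - s)))"
    proof (rule mult_left_mono)
      have "2 * (1 - s) * (\<Sum>k\<in>{1..L}. \<alpha> k * (\<Sum>i\<in>{1..<N}. (c k i)\<^sup>2)) \<le> A (\<lambda>_. 1) P P"
        unfolding P_def by (rule coercive[OF b c])
      then show "(\<Sum>k\<in>{1..L}. \<alpha> k * (\<Sum>i\<in>{1..<N}. (c k i)\<^sup>2)) \<le> A (\<lambda>_. 1) P P / (2 * (1 - s))"
        using s by (simp add: pos_le_divide_eq mult.commute)
    qed simp
    finally show "L2_set (\<lambda>(k, i). sqrt (\<alpha> k) * r k) ({1..L} \<times> {1..<N}) \<le> sqrt (N * (A (\<lambda>_. 1) P P / (2 * (1 - s))))"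
      unfolding L2_set_def split_def by simp
  qed (use Kpos QV one.psd s in \<open>auto intro!: L2_set_nonneg\<close>)
  also have "\<dots> = 2 * M\<^sup>2 * sqrt (real N) / (m * (1 - s)) * E * one.nrm P * one.nrm Q"
  proof -
    have "sqrt (A (\<lambda>_. 1) Q Q / (2 * (1 - s))) * sqrt (N * (A (\<lambda>_. 1) P P / (2 * (1 - s))))
       = one.nrm Q * (sqrt N * one.nrm P) / (sqrt (2 * (1 - s)) * sqrt (2 * (1 - s)))"
      by (simp only: one.nrm_def real_sqrt_mult real_sqrt_divide) simp
    also have "\<dots> = one.nrm Q * (sqrt N * one.nrm P) / (2 * (1 - s))"
      using s by simp
    finally have e: "sqrt (A (\<lambda>_. 1) Q Q / (2 * (1 - s))) * sqrt (N * (A (\<lambda>_. 1) P P / (2 * (1 - s))))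
       = one.nrm Q * (sqrt N * one.nrm P) / (2 * (1 - s))" .
    show ?thesis
      unfolding e K_def using s m by (simp add: field_simps)
  qed
  finally show ?thesis unfolding P_def Q_def .
qed

text \<open>For fixed \<open>y\<close>, the coefficients of \<open>hat k i\<close> for all
  \<open>k\<close> are the values of one combination of monomials at the points
  \<open>(\<sigma> k, c k)\<close>. Summing over the modes is linear in that combination, so the
  result lies in the span of the images of the monomials, whose number depends neither on
  \<open>I\<close> nor on \<open>y\<close>.\<close>

lemma jacobi_span:
  fixes c :: "nat \<Rightarrow> nat \<Rightarrow> real" and I :: "nat set" and J :: nat
  assumes c: "\<And>k i. i \<notin> {1..<N} \<Longrightarrow> c k i = 0"
  defines "W \<equiv> (\<Union>i\<in>{1..<N}. (\<lambda>f. \<Sum>k\<in>I. f (\<sigma> k, c k) *\<^sub>R hat k i) ` monomials N J)"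
  shows "(\<Sum>k\<in>I. H k (jacobi N y (\<sigma> k) (tridiag z (\<sigma> k) (c k)) J)) \<in> span W"
proof -
  have "(\<Sum>k\<in>I. jacobi N y (\<sigma> k) (tridiag z (\<sigma> k) (c k)) J i *\<^sub>R hat k i) \<in> span W"
    if i: "i \<in> {1..<N}" for i
  proof -
    define L where "L f = (\<Sum>k\<in>I. f (\<sigma> k, c k) *\<^sub>R hat k i)" for f :: "real \<times> (nat \<Rightarrow> real) \<Rightarrow> real"
    have lin: "linear L"
      by (rule linearI) (simp_all add: L_def sum.distrib scaleR_add_left scaleR_sum_right)
    obtain f where f: "f \<in> span (monomials N J)"
      "\<forall>s c. (\<forall>i. i \<notin> {1..<N} \<longrightarrow> c i = 0) \<longrightarrow> jacobi N y s (tridiag z s c) J i = f (s, c)"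
      using monomial_combE[OF monomial_comb_jacobi] .
    have "(\<Sum>k\<in>I. jacobi N y (\<sigma> k) (tridiag z (\<sigma> k) (c k)) J i *\<^sub>R hat k i) = L f"
      unfolding L_def using f(2) c by (intro sum.cong refl) auto
    also have "L f \<in> span (L ` monomials N J)"
      using f(1) linear_span_image[OF lin, of "monomials N J"] by auto
    also have "\<dots> \<subseteq> span W"
      using i by (intro span_mono) (auto simp: W_def L_def)
    finally show ?thesis .
  qed
  then have "(\<Sum>i\<in>{1..<N}. \<Sum>k\<in>I. jacobi N y (\<sigma> k) (tridiag z (\<sigma> k) (c k)) J i *\<^sub>R hat k i) \<in> span W"
    by (rule span_sum)
  then show ?thesis
    unfolding H_def by (subst sum.swap)
qed

text \<open>The common functional is tested with \<open>u\<close> itself. The bound is used in both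
  directions: it shows that all solutions vanish together, and with the roles exchanged it keeps
  their energies away from zero.\<close>

lemma solution_norms:
  assumes y: "\<And>j. j \<in> {1..N} \<Longrightarrow> m < y j \<and> y j < M" and z: "\<And>j. j \<in> {1..N} \<Longrightarrow> m < z j \<and> z j < M"
    and m: "0 < m" and u: "u \<in> V" and w: "w \<in> V"
    and eq: "\<And>v. v \<in> V \<Longrightarrow> A y u v = A z w v"
  shows "sqrt (A y u u) \<le> M / sqrt m * one.nrm w"
proof -
  interpret Y: psd_form V "A y" by (rule psd_form_A) (use y m in force)
  have "0 < M" using y[of 1] N m by force
  have n: "one.nrm u \<le> Y.nrm u / sqrt m"
  proof -
    have "m * A (\<lambda>_. 1) u u \<le> A y u u" using y by (intro A_bound(1)[OF u, where M = M]) (auto simp: less_imp_le)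
    then have "sqrt m * one.nrm u \<le> Y.nrm u"
      by (simp add: one.nrm_def Y.nrm_def real_sqrt_mult[symmetric])
    then show ?thesis using m by (simp add: field_simps)
  qed
  have "(Y.nrm u)\<^sup>2 = A z w u" using u eq[OF u] by (simp add: Y.nrm_squared)
  also have "\<dots> \<le> M * one.nrm w * one.nrm u"
    using A_Cauchy_Schwarz[OF w u, of z M] z m by force
  also have "\<dots> \<le> M * one.nrm w * (Y.nrm u / sqrt m)"
    using n w \<open>0 < M\<close> by (intro mult_left_mono) auto
  finally have le: "Y.nrm u * Y.nrm u \<le> (M / sqrt m * one.nrm w) * Y.nrm u"
    by (simp add: power2_eq_square mult_ac)
  have "Y.nrm u \<le> M / sqrt m * one.nrm w"
  proof (cases "Y.nrm u = 0")
    case True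
    then show ?thesis using \<open>0 < M\<close> m w by simp
  next
    case False
    then have "0 < Y.nrm u" using u Y.nrm_nonneg[of u] by linarith
    with le show ?thesis by (simp only: mult_le_cancel_right_pos)
  qed
  then show ?thesis by (simp add: Y.nrm_def)
qed

text \<open>An approximant of the single function \<open>u z\<close> by bubbles and finitely many
  hats determines an approximant of every \<open>u y\<close>. Its error \<open>e\<close> is small
  because the residual is small on a dense set, hence also when tested with
  \<open>e\<close>.\<close>

lemma approximation:
  fixes n :: nat
  assumes D: "\<And>y j. y \<in> D \<Longrightarrow> j \<in> {1..N} \<Longrightarrow> m < y j \<and> y j < M" and m: "0 < m"
    and uV: "\<And>y. y \<in> D \<Longrightarrow> u y \<in> V" and z: "z \<in> D"
    and eq: "\<And>y v. y \<in> D \<Longrightarrow> v \<in> V \<Longrightarrow> A y (u y) v = A z (u z) v"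
    and n: "(J0 + 1) * (N - 1) \<le> n"
  defines "B \<equiv> 1 + \<bar>C0\<bar> * exp (pi * real ((J0 + 1) * (N - 1)))"
  shows "\<exists>W. finite W \<and> W \<subseteq> V \<and> card W \<le> N + (N - 1) * n \<and>
    (\<forall>y\<in>D. \<exists>x\<in>span W. sqrt (A y (u y - x) (u y - x)) \<le>
       (M + 2 * M\<^sup>2 * sqrt (real N) / (m * (1 - s)) * B * (one.nrm (u z) + 1)) / sqrt m * exp (- pi * (real n + 1)))"
proof -
  define \<epsilon> where "\<epsilon> = exp (- pi * (real n + 1))"
  \<comment> \<open>\<open>n0\<close> bounds the number of monomials spent on each interface.
    Keeping only \<open>n - n0\<close> modes individually pays for them.\<close>
  define n0 where "n0 = (J0 + 1) * (N - 1)"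
  define K where "K = n - n0"
  have M: "0 < M" using D[OF z, of 1] N m by force
  have \<epsilon>: "0 < \<epsilon>" "\<epsilon> \<le> 1" by (auto simp: \<epsilon>_def)
  have B: "1 \<le> B" by (simp add: B_def)
  have s0: "0 \<le> s" using \<sigma>[of 1] by linarith
  obtain J1 where J1: "s ^ J1 < \<epsilon>"
    using real_arch_pow_inv[OF \<epsilon>(1) s] by auto
  \<comment> \<open>The low modes belong to the approximation space entirely, so for them the number of iterations
    is irrelevant to the dimension and may depend on \<open>\<epsilon>\<close>.\<close>
  define Jk where "Jk k = (if k \<le> K then J1 else J0)" for k
  have E: "\<sigma> k ^ Jk k \<le> B * \<epsilon>" if k: "k \<ge> 1" for k
  proof (cases "k \<le> K")
    case True
    have "\<sigma> k ^ J1 \<le> s ^ J1" using \<sigma>[OF k] by (intro power_mono) auto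
    also have "\<dots> \<le> 1 * \<epsilon>" using J1 by simp
    also have "\<dots> \<le> B * \<epsilon>" using B \<epsilon> by (intro mult_right_mono) auto
    finally show ?thesis using True by (simp add: Jk_def)
  next
    case False
    \<comment> \<open>A high mode has \<open>k \<ge> n - n0 + 1\<close>, so its decay misses
      \<open>\<epsilon>\<close> by at most the factor \<open>exp (pi * n0)\<close>, which is
      contained in \<open>B\<close>.\<close>
    then have "real n + 1 \<le> real n0 + real k" by (simp add: K_def)
    then have "pi * (real n + 1) \<le> pi * (real n0 + real k)" by (intro mult_left_mono) auto
    then have "exp (- pi * real k) \<le> exp (pi * real n0 - pi * (real n + 1))"
      by (simp only: exp_le_cancel_iff) (simp add: algebra_simps)
    also have "\<dots> = exp (pi * real n0) * \<epsilon>"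
      by (simp add: \<epsilon>_def exp_add[symmetric])
    finally have le: "exp (- pi * real k) \<le> exp (pi * real n0) * \<epsilon>" .
    have "\<sigma> k ^ J0 \<le> C0 * exp (- pi * real k)" by (rule \<sigma>_decay[OF k])
    also have "\<dots> \<le> \<bar>C0\<bar> * exp (- pi * real k)" by (intro mult_right_mono) auto
    also have "\<dots> \<le> \<bar>C0\<bar> * (exp (pi * real n0) * \<epsilon>)" using le by (intro mult_left_mono) auto
    also have "\<dots> \<le> B * \<epsilon>" using \<epsilon> by (simp add: B_def n0_def algebra_simps)
    finally show ?thesis using False by (simp add: Jk_def)
  qed
  obtain b c L where "\<forall>i\<in>{1..N}. b i \<in> Bub i" "\<forall>k i. i \<notin> {1..<N} \<longrightarrow> c k i = 0"
    "\<forall>L'\<ge>L. one.nrm (u z - vect L' b c) < \<epsilon>"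
    using dense'[OF uV[OF z] \<epsilon>(1)] by blast
  then have b: "\<And>i. i \<in> {1..N} \<Longrightarrow> b i \<in> Bub i" and c: "\<And>k i. i \<notin> {1..<N} \<Longrightarrow> c k i = 0"
    and L: "\<And>L'. L' \<ge> L \<Longrightarrow> one.nrm (u z - vect L' b c) < \<epsilon>"
    by auto
  \<comment> \<open>Zero data beyond \<open>L\<close> give zero iterates. Hence neither
    \<open>P\<close> nor the approximant of \<open>u y\<close> changes when a test vector forces a
    larger truncation.\<close>
  define c1 where "c1 k = (if k \<le> L then c k else (\<lambda>_. 0))" for k
  have c1: "\<And>k i. i \<notin> {1..<N} \<Longrightarrow> c1 k i = 0" using c by (simp add: c1_def)
  have vect_c1: "vect L' b c1 = vect L b c" if "L' \<ge> L" for L'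
  proof -
    have "(\<Sum>k\<in>{1..L'}. H k (c1 k)) = (\<Sum>k\<in>{1..L}. H k (c1 k))"
      using that by (intro sum.mono_neutral_right) (auto simp: c1_def)
    also have "\<dots> = (\<Sum>k\<in>{1..L}. H k (c k))"
      by (intro sum.cong refl) (auto simp: c1_def)
    finally show ?thesis by (simp add: vect_def)
  qed
  define P where "P = vect L b c"
  have PV: "P \<in> V" unfolding P_def using b by (rule vect_V)
  have uP: "one.nrm (u z - P) < \<epsilon>" unfolding P_def by (rule L) simp
  have nP: "one.nrm P \<le> one.nrm (u z) + 1"
  proof -
    have "P = u z + - (u z - P)" by simp
    then have "one.nrm P \<le> one.nrm (u z) + one.nrm (- (u z - P))"
      using one.nrm_triangle[of "u z" "- (u z - P)"] uV[OF z] PV by simp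
    also have "\<dots> = one.nrm (u z) + one.nrm (u z - P)"
      using one.nrm_minus[of "u z - P"] uV[OF z] PV by simp
    finally show ?thesis using uP \<epsilon> by linarith
  qed
  define G where "G i f = (\<Sum>k\<in>{K+1..L}. f (\<sigma> k, c1 k) *\<^sub>R hat k i)"
    for i and f :: "real \<times> (nat \<Rightarrow> real) \<Rightarrow> real"
  \<comment> \<open>One bubble for each layer, the low modes individually, and for each interface
    the monomial vectors that serve all high modes together. Only the reference \<open>z\<close>
    enters, through \<open>b\<close> and \<open>c1\<close>, so \<open>W\<close> is the same for
    every \<open>y\<close>.\<close>
  define W where "W = b ` {1..N} \<union> (\<lambda>(k, i). hat k i) ` ({1..K} \<times> {1..<N}) \<union> (\<Union>i\<in>{1..<N}. G i ` monomials N J0)"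
  have finW: "finite W" by (auto simp: W_def finite_monomials)
  have WV: "W \<subseteq> V"
    unfolding W_def G_def using b Bub_V hat_V by (auto intro!: one.V_sum one.V_closed(3))
  have cardW: "card W \<le> N + (N - 1) * n"
  proof -
    have 1: "card (b ` {1..N}) \<le> N"
      using card_image_le[of "{1..N}" b] by simp
    have 2: "card ((\<lambda>(k, i). hat k i) ` ({1..K} \<times> {1..<N})) \<le> K * (N - 1)"
      using card_image_le[of "{1..K} \<times> {1..<N}" "\<lambda>(k, i). hat k i"] by simp
    have "card (\<Union>i\<in>{1..<N}. G i ` monomials N J0) \<le> (\<Sum>i\<in>{1..<N}. card (G i ` monomials N J0))"
      by (intro card_UN_le) auto
    also have "\<dots> \<le> (\<Sum>i\<in>{1..<N}. n0)"
      unfolding n0_def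
      by (intro sum_mono order.trans[OF card_image_le[OF finite_monomials] card_monomials])
    finally have 3: "card (\<Union>i\<in>{1..<N}. G i ` monomials N J0) \<le> (N - 1) * n0" by simp
    have "card W \<le> N + K * (N - 1) + (N - 1) * n0"
      unfolding W_def
      by (intro order.trans[OF card_Un_le add_mono[OF order.trans[OF card_Un_le add_mono[OF 1 2]] 3]])
    also have "\<dots> = N + (N - 1) * (K + n0)" by (simp add: add_mult_distrib2 mult.commute[of K])
    finally show ?thesis using n by (simp add: K_def n0_def)
  qed
  define T where "T = 2 * M\<^sup>2 * sqrt (real N) / (m * (1 - s)) * B * (one.nrm (u z) + 1)"
  have T0: "0 \<le> T" using m s B uV[OF z] by (simp add: T_def)
  have main: "\<exists>x\<in>span W. sqrt (A y (u y - x) (u y - x)) \<le> (M + T) / sqrt m * \<epsilon>" if y: "y \<in> D" for y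
  proof -
    interpret Y: psd_form V "A y" by (rule psd_form_A) (use D[OF y] m in force)
    define xk where "xk k = jacobi N y (\<sigma> k) (tridiag z (\<sigma> k) (c1 k)) (Jk k)" for k
    \<comment> \<open>Bubbles solve a problem on a single layer, so they depend on \<open>y\<close> only through a factor.\<close>
    define b1 where "b1 = (\<lambda>i. (z i / y i) *\<^sub>R b i)"
    define x where "x = vect L b1 xk"
    have b1: "b1 i \<in> Bub i" if "i \<in> {1..N}" for i
      unfolding b1_def using Bub_scale that b by blast
    have xV: "x \<in> V" unfolding x_def using b1 by (rule vect_V)
    have jac0: "jacobi N y t (tridiag z t (\<lambda>_. 0)) J = (\<lambda>_. 0)" for t J
      by (induction J) (auto simp: fun_eq_iff tridiag_def)
    have x_vect: "vect L' b1 xk = x" if "L' \<ge> L" for L'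
    proof -
      have "(\<Sum>k\<in>{1..L'}. H k (xk k)) = (\<Sum>k\<in>{1..L}. H k (xk k))"
        using that by (intro sum.mono_neutral_right) (auto simp: c1_def xk_def jac0)
      then show ?thesis by (simp add: x_def vect_def)
    qed
    have xW: "x \<in> span W"
    proof -
      have 1: "(\<Sum>i\<in>{1..N}. b1 i) \<in> span W"
        unfolding b1_def by (intro span_sum span_scale span_base) (auto simp: W_def)
      have 2: "(\<Sum>k\<in>{1..L} \<inter> {..K}. H k (xk k)) \<in> span W"
        unfolding H_def by (intro span_sum span_scale span_base) (auto simp: W_def)
      have "(\<Sum>k\<in>{K+1..L}. H k (xk k)) = (\<Sum>k\<in>{K+1..L}. H k (jacobi N y (\<sigma> k) (tridiag z (\<sigma> k) (c1 k)) J0))"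
        by (intro sum.cong refl) (auto simp: xk_def Jk_def)
      also have "\<dots> \<in> span (\<Union>i\<in>{1..<N}. (\<lambda>f. \<Sum>k\<in>{K+1..L}. f (\<sigma> k, c1 k) *\<^sub>R hat k i) ` monomials N J0)"
        by (rule jacobi_span[OF c1])
      also have "\<dots> \<subseteq> span W"
        by (rule span_mono) (auto simp: W_def G_def)
      finally have 3: "(\<Sum>k\<in>{K+1..L}. H k (xk k)) \<in> span W" .
      have "(\<Sum>k\<in>({1..L} \<inter> {..K}) \<union> {K+1..L}. H k (xk k))
          = (\<Sum>k\<in>{1..L} \<inter> {..K}. H k (xk k)) + (\<Sum>k\<in>{K+1..L}. H k (xk k))"
        by (rule sum.union_disjoint) auto
      also have "({1..L} \<inter> {..K}) \<union> {K+1..L} = {1..L}" by auto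
      finally have "(\<Sum>k\<in>{1..L}. H k (xk k))
          = (\<Sum>k\<in>{1..L} \<inter> {..K}. H k (xk k)) + (\<Sum>k\<in>{K+1..L}. H k (xk k))" .
      then show ?thesis
        unfolding x_def vect_def using span_add[OF 1 span_add[OF 2 3]] by simp
    qed
    define e where "e = u y - x"
    have eV: "e \<in> V" using uV[OF y] xV by (simp add: e_def)
    have ybd: "\<And>j. j \<in> {1..N} \<Longrightarrow> 0 \<le> y j \<and> y j \<le> M" using D[OF y] m by force
    have zbd: "\<And>j. j \<in> {1..N} \<Longrightarrow> 0 \<le> z j \<and> z j \<le> M" using D[OF z] m by force
    have zform: "psd_form V (A z)" by (rule psd_form_A) (use zbd in auto)
    \<comment> \<open>The residual has two sources: replacing \<open>u z\<close> by \<open>P\<close>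
      contributes \<open>M\<close>, stopping the iteration contributes \<open>T\<close>.\<close>
    have step: "\<bar>A y e Q\<bar> \<le> (M + T) * \<epsilon> * one.nrm Q"
      if b': "\<And>i. i \<in> {1..N} \<Longrightarrow> b' i \<in> Bub i" and v: "\<And>k i. i \<notin> {1..<N} \<Longrightarrow> v k i = 0"
        and Q: "Q = vect L' b' v" "L' \<ge> L" for b' v L' Q
    proof -
      have QV: "Q \<in> V" unfolding Q using b' by (rule vect_V)
      have "\<bar>A z (u z - P) Q\<bar> \<le> M * one.nrm (u z - P) * one.nrm Q"
        using uV[OF z] PV QV zbd by (intro A_Cauchy_Schwarz) auto
      also have "\<dots> \<le> M * \<epsilon> * one.nrm Q"
        using uP M QV by (intro mult_right_mono mult_left_mono) auto
      finally have 1: "\<bar>A z (u z - P) Q\<bar> \<le> M * \<epsilon> * one.nrm Q" .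
      have "\<bar>A y (vect L' b1 xk) (vect L' b' v) - A z (vect L' b c1) (vect L' b' v)\<bar>
        \<le> 2 * M\<^sup>2 * sqrt (real N) / (m * (1 - s)) * (B * \<epsilon>) * one.nrm (vect L' b c1) * one.nrm (vect L' b' v)"
        unfolding b1_def
        by (rule residual_bound[OF D[OF y] D[OF z] m b c1 b' v _ _ xk_def]) (use E B \<epsilon> in auto)
      then have "\<bar>A y x Q - A z P Q\<bar> \<le> 2 * M\<^sup>2 * sqrt (real N) / (m * (1 - s)) * (B * \<epsilon>) * one.nrm P * one.nrm Q"
        using vect_c1[OF Q(2)] x_vect[OF Q(2)] by (simp add: Q(1) P_def)
      also have "\<dots> \<le> 2 * M\<^sup>2 * sqrt (real N) / (m * (1 - s)) * (B * \<epsilon>) * (one.nrm (u z) + 1) * one.nrm Q"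
        using nP m s B \<epsilon> QV by (intro mult_right_mono mult_left_mono) auto
      also have "\<dots> = T * \<epsilon> * one.nrm Q" by (simp add: T_def)
      finally have 2: "\<bar>A y x Q - A z P Q\<bar> \<le> T * \<epsilon> * one.nrm Q" .
      have "A y e Q = A z (u z - P) Q - (A y x Q - A z P Q)"
        using uV[OF y] uV[OF z] xV PV QV eq[OF y QV]
        by (simp add: e_def Y.diff psd_form.diff[OF zform])
      then show ?thesis using 1 2 by (simp add: algebra_simps)
    qed
    have dual: "\<bar>A y e e\<bar> \<le> (M + T) * \<epsilon> * one.nrm e"
    proof (rule field_le_epsilon)
      fix \<delta> :: real assume "0 < \<delta>"
      \<comment> \<open>\<open>R\<close> dominates the total factor of \<open>\<delta> / R\<close>
        that arises when \<open>e\<close> is replaced by \<open>Q\<close> in both estimates; the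
        summand \<open>1\<close> makes positivity evident.\<close>
      define R where "R = (M + T) * \<epsilon> + M * one.nrm e + 1"
      have R: "0 < R" using M T0 \<epsilon> eV by (auto simp: R_def intro!: add_nonneg_pos)
      have "0 < \<delta> / R" using \<open>0 < \<delta>\<close> R by simp
      then obtain b' v L' where "\<forall>i\<in>{1..N}. b' i \<in> Bub i" "\<forall>k i. i \<notin> {1..<N} \<longrightarrow> v k i = 0"
        "\<forall>L''\<ge>L'. one.nrm (e - vect L'' b' v) < \<delta> / R"
        using dense'[OF eV] by blast
      then have b': "\<And>i. i \<in> {1..N} \<Longrightarrow> b' i \<in> Bub i" and v: "\<And>k i. i \<notin> {1..<N} \<Longrightarrow> v k i = 0"
        and L': "\<And>L''. L'' \<ge> L' \<Longrightarrow> one.nrm (e - vect L'' b' v) < \<delta> / R"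
        by auto
      define Q where "Q = vect (max L L') b' v"
      have QV: "Q \<in> V" unfolding Q_def using b' by (rule vect_V)
      have eQ: "one.nrm (e - Q) < \<delta> / R" unfolding Q_def by (rule L') simp
      have "one.nrm Q \<le> one.nrm e + one.nrm (e - Q)"
        using one.nrm_triangle[of e "- (e - Q)"] one.nrm_minus[of "e - Q"] eV QV by simp
      then have nQ: "one.nrm Q \<le> one.nrm e + \<delta> / R" using eQ by simp
      have 1: "\<bar>A y e Q\<bar> \<le> (M + T) * \<epsilon> * (one.nrm e + \<delta> / R)"
      proof (rule order.trans[OF step[OF b' v Q_def]])
        show "(M + T) * \<epsilon> * one.nrm Q \<le> (M + T) * \<epsilon> * (one.nrm e + \<delta> / R)"
          using nQ M T0 \<epsilon> by (intro mult_left_mono) auto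
      qed auto
      have "\<bar>A y e (e - Q)\<bar> \<le> M * one.nrm e * one.nrm (e - Q)"
        using eV QV ybd by (intro A_Cauchy_Schwarz) auto
      also have "\<dots> \<le> M * one.nrm e * (\<delta> / R)"
        using eQ M eV by (intro mult_left_mono) auto
      finally have 2: "\<bar>A y e (e - Q)\<bar> \<le> M * one.nrm e * (\<delta> / R)" .
      have "A y e e = A y e Q + A y e (e - Q)"
        using eV QV by (simp add: Y.diff_right)
      then have "\<bar>A y e e\<bar> \<le> (M + T) * \<epsilon> * one.nrm e + ((M + T) * \<epsilon> + M * one.nrm e) * (\<delta> / R)"
        using 1 2 by (simp add: algebra_simps)
      also have "((M + T) * \<epsilon> + M * one.nrm e) * (\<delta> / R) \<le> R * (\<delta> / R)"
        using \<open>0 < \<delta>\<close> R by (intro mult_right_mono) (auto simp: R_def)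
      also have "R * (\<delta> / R) = \<delta>" using R by simp
      finally show "\<bar>A y e e\<bar> \<le> (M + T) * \<epsilon> * one.nrm e + \<delta>" by simp
    qed
    have "one.nrm e \<le> Y.nrm e / sqrt m"
    proof -
      have "m * A (\<lambda>_. 1) e e \<le> A y e e" using D[OF y] by (intro A_bound(1)[OF eV, where M = M]) (auto simp: less_imp_le)
      then have "sqrt m * one.nrm e \<le> Y.nrm e"
        by (simp add: one.nrm_def Y.nrm_def real_sqrt_mult[symmetric])
      then show ?thesis using m by (simp add: field_simps)
    qed
    then have "(M + T) * \<epsilon> * one.nrm e \<le> (M + T) * \<epsilon> * (Y.nrm e / sqrt m)"
      using M T0 \<epsilon> by (intro mult_left_mono) auto
    \<comment> \<open>The estimate \<open>dual\<close> contains the norm for unit weights. Passing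
      to the \<open>y\<close>-energy costs \<open>1 / sqrt m\<close>, after which one factor of the
      norm of \<open>e\<close> can be cancelled.\<close>
    then have le: "Y.nrm e * Y.nrm e \<le> ((M + T) / sqrt m * \<epsilon>) * Y.nrm e"
      using dual Y.nrm_squared[OF eV] by (simp add: power2_eq_square mult_ac)
    have "Y.nrm e \<le> (M + T) / sqrt m * \<epsilon>"
    proof (cases "Y.nrm e = 0")
      case True
      then show ?thesis using M T0 m \<epsilon> by simp
    next
      case False
      then have "0 < Y.nrm e" using eV Y.nrm_nonneg[of e] by linarith
      with le show ?thesis by (simp only: mult_le_cancel_right_pos)
    qed
    then show ?thesis using xW unfolding e_def Y.nrm_def by blast
  qed
  show ?thesis
    using finW WV cardW main unfolding T_def \<epsilon>_def by blast
qed

text \<open>All solutions represent the same functional, so their energies are comparable: either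
  all of them vanish, or \<open>lo\<close> is a common positive lower bound. Dividing by
  \<open>lo\<close> makes the absolute estimate relative.\<close>

theorem relative_approximation:
  assumes D: "\<And>y j. y \<in> D \<Longrightarrow> j \<in> {1..N} \<Longrightarrow> m < y j \<and> y j < M" and m: "0 < m"
    and uV: "\<And>y. y \<in> D \<Longrightarrow> u y \<in> V"
    and eq: "\<And>y z v. y \<in> D \<Longrightarrow> z \<in> D \<Longrightarrow> v \<in> V \<Longrightarrow> A y (u y) v = A z (u z) v"
  shows "\<exists>C. \<forall>n. \<exists>W. finite W \<and> W \<subseteq> V \<and> card W \<le> N + (N - 1) * n \<and>
    (\<forall>y\<in>D. \<exists>x\<in>span W. sqrt (A y (u y - x) (u y - x)) \<le> C * exp (- pi * (real n + 1)) * sqrt (A y (u y) (u y)))"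
proof (cases "D = {}")
  case True
  then show ?thesis by (intro exI[of _ 0] allI exI[of _ "{}"]) auto
next
  case False
  then obtain z where z: "z \<in> D" by auto
  have M: "0 < M" using D[OF z, of 1] N m by force
  have nn: "0 \<le> A y v v" if "y \<in> D" "v \<in> V" for y v
    using psd_form.psd[OF psd_form_A[of y] that(2)] D[OF that(1)] m by force
  define q where "q = one.nrm (u z)"
  have q: "0 \<le> q" using uV[OF z] by (simp add: q_def)
  show ?thesis
  proof (cases "q = 0")
    case True
    have "sqrt (A y (u y) (u y)) = 0" if y: "y \<in> D" for y
    proof -
      have "sqrt (A y (u y) (u y)) \<le> M / sqrt m * one.nrm (u z)"
        by (rule solution_norms[OF D[OF y] D[OF z] m uV[OF y] uV[OF z] eq[OF y z]])
      then show ?thesis using True nn[OF y uV[OF y]] by (simp add: q_def)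
    qed
    then show ?thesis
      by (intro exI[of _ 0] allI exI[of _ "{}"]) (auto simp: span_empty)
  next
    case False
    then have qpos: "0 < q" using q by simp
    \<comment> \<open>\<open>solution_norms\<close> with \<open>y\<close> and \<open>z\<close>
      exchanged bounds the norm of \<open>u y\<close> from below by \<open>m * q / M\<close>; the
      factor \<open>sqrt m\<close> passes to the \<open>y\<close>-energy.\<close>
    define lo where "lo = m * q / M * sqrt m"
    have lo: "0 < lo" using qpos m M by (simp add: lo_def)
    have lower: "lo \<le> sqrt (A y (u y) (u y))" if y: "y \<in> D" for y
    proof -
      have "sqrt m * q \<le> sqrt (A z (u z) (u z))"
      proof -
        have "m * A (\<lambda>_. 1) (u z) (u z) \<le> A z (u z) (u z)"
          using D[OF z] by (intro A_bound(1)[OF uV[OF z], where M = M]) (auto simp: less_imp_le)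
        then show ?thesis by (simp add: q_def one.nrm_def real_sqrt_mult[symmetric])
      qed
      also have "\<dots> \<le> M / sqrt m * one.nrm (u y)"
        by (rule solution_norms[OF D[OF z] D[OF y] m uV[OF z] uV[OF y] eq[OF z y]])
      finally have "m * q / M \<le> one.nrm (u y)" using m M by (simp add: field_simps)
      then have "lo \<le> one.nrm (u y) * sqrt m"
        unfolding lo_def using m by (intro mult_right_mono) auto
      also have "\<dots> \<le> sqrt (A y (u y) (u y))"
      proof -
        have "m * A (\<lambda>_. 1) (u y) (u y) \<le> A y (u y) (u y)"
          using D[OF y] by (intro A_bound(1)[OF uV[OF y], where M = M]) (auto simp: less_imp_le)
        then show ?thesis by (simp add: one.nrm_def real_sqrt_mult[symmetric] mult.commute)
      qed
      finally show ?thesis .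
    qed
    define n0 where "n0 = (J0 + 1) * (N - 1)"
    define B where "B = 1 + \<bar>C0\<bar> * exp (pi * real n0)"
    define C1 where "C1 = (M + 2 * M\<^sup>2 * sqrt (real N) / (m * (1 - s)) * B * (q + 1)) / sqrt m"
    \<comment> \<open>The first summand is the constant for \<open>n0 \<le> n\<close>. The second
      makes \<open>C * exp (- pi * (real n + 1))\<close> at least \<open>1\<close> for the finitely
      many smaller \<open>n\<close>, where the zero approximant suffices.\<close>
    define C where "C = C1 / lo + exp (pi * (real n0 + 1))"
    have B0: "0 \<le> B" by (simp add: B_def add_nonneg_nonneg)
    have C10: "0 \<le> C1" using M m s q B0 by (simp add: C1_def)
    show ?thesis
    proof (intro exI[of _ C] allI)
      fix n
      show "\<exists>W. finite W \<and> W \<subseteq> V \<and> card W \<le> N + (N - 1) * n \<and>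
        (\<forall>y\<in>D. \<exists>x\<in>span W. sqrt (A y (u y - x) (u y - x)) \<le> C * exp (- pi * (real n + 1)) * sqrt (A y (u y) (u y)))"
      proof (cases "n0 \<le> n")
        case True
        have eqz: "A y (u y) v = A z (u z) v" if "y \<in> D" "v \<in> V" for y v
          using that z by (intro eq)
        have "\<exists>W. finite W \<and> W \<subseteq> V \<and> card W \<le> N + (N - 1) * n \<and>
          (\<forall>y\<in>D. \<exists>x\<in>span W. sqrt (A y (u y - x) (u y - x)) \<le> C1 * exp (- pi * (real n + 1)))"
          unfolding C1_def B_def n0_def q_def
        proof (rule approximation)
          show "m < y j \<and> y j < M" if "y \<in> D" "j \<in> {1..N}" for y j using that by (rule D)
          show "u y \<in> V" if "y \<in> D" for y using that by (rule uV)
          show "A y (u y) v = A z (u z) v" if "y \<in> D" "v \<in> V" for y v using that by (rule eqz)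
        qed (use m z True in \<open>auto simp: n0_def\<close>)
        then obtain W where W: "finite W" "W \<subseteq> V" "card W \<le> N + (N - 1) * n"
          and app: "\<forall>y\<in>D. \<exists>x\<in>span W. sqrt (A y (u y - x) (u y - x)) \<le> C1 * exp (- pi * (real n + 1))"
          by blast
        have "C1 * exp (- pi * (real n + 1)) \<le> C * exp (- pi * (real n + 1)) * sqrt (A y (u y) (u y))" if y: "y \<in> D" for y
        proof -
          have "C1 = C1 / lo * lo" using lo by simp
          also have "\<dots> \<le> C * sqrt (A y (u y) (u y))"
            using lower[OF y] lo C10 by (intro mult_mono) (auto simp: C_def intro!: add_nonneg_nonneg)
          finally have "C1 * exp (- pi * (real n + 1)) \<le> C * sqrt (A y (u y) (u y)) * exp (- pi * (real n + 1))"
            by (rule mult_right_mono) simp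
          then show ?thesis by (simp only: mult_ac)
        qed
        then show ?thesis using W app by (meson order.trans)
      next
        case False
        have "1 \<le> C * exp (- pi * (real n + 1))"
        proof -
          have "1 \<le> exp (pi * (real n0 + 1)) * exp (- pi * (real n + 1))"
            using False by (simp add: exp_add[symmetric])
          also have "\<dots> \<le> C * exp (- pi * (real n + 1))"
            using C10 lo by (intro mult_right_mono) (auto simp: C_def)
          finally show ?thesis .
        qed
        then have "sqrt (A y (u y) (u y)) \<le> C * exp (- pi * (real n + 1)) * sqrt (A y (u y) (u y))" if "y \<in> D" for y
          using mult_right_mono[of 1 _ "sqrt (A y (u y) (u y))"] nn[OF that uV[OF that]] by simp
        then show ?thesis by (intro exI[of _ "{}"]) (auto simp: span_empty)
      qed
    qed
  qed
qed

end

section \<open>Smooth functions\<close>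

lemma Ck_Suc_imp: "Ck (Suc k) f \<Longrightarrow> Ck k f"
proof (induction k arbitrary: f)
  case 0
  then show ?case
    by (auto simp: continuous_on_eq_continuous_at intro: differentiable_imp_continuous_within)
next
  case (Suc k)
  have "Ck k (\<lambda>x. frechet_derivative f (at x) b)" if "b \<in> Basis" for b
    using Suc.prems that by (intro Suc.IH) simp
  then show ?case using Suc.prems by simp
qed

lemma Ck_SucI:
  assumes "\<And>x. (f has_derivative f' x) (at x)" "\<And>b. b \<in> Basis \<Longrightarrow> Ck k (\<lambda>x. f' x b)"
  shows "Ck (Suc k) f"
proof -
  have "frechet_derivative f (at x) = f' x" for x
    using frechet_derivative_at[OF assms(1)] by simp
  then show ?thesis using assms by (auto simp: differentiable_def)
qed

lemma Ck_SucD: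
  assumes "Ck (Suc k) f"
  shows "(f has_derivative frechet_derivative f (at x)) (at x)"
    "b \<in> Basis \<Longrightarrow> Ck k (\<lambda>x. frechet_derivative f (at x) b)"
  using assms frechet_derivative_works by auto

lemma Ck_const: "Ck k (\<lambda>x. c)"
proof (induction k arbitrary: c)
  case (Suc k)
  show ?case by (rule Ck_SucI[where f' = "\<lambda>_ _. 0"]) (auto intro: Suc)
qed simp

lemma Ck_add: "Ck k f \<Longrightarrow> Ck k g \<Longrightarrow> Ck k (\<lambda>x. f x + g x)"
proof (induction k arbitrary: f g)
  case 0
  then show ?case by (simp add: continuous_on_add continuous_on_mult)
next
  case (Suc k)
  show ?case
    by (rule Ck_SucI[OF has_derivative_add[OF Ck_SucD(1)[OF Suc.prems(1)] Ck_SucD(1)[OF Suc.prems(2)]]])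
      (intro Suc.IH Ck_SucD(2)[OF Suc.prems(1)] Ck_SucD(2)[OF Suc.prems(2)])
qed

lemma Ck_mult: "Ck k f \<Longrightarrow> Ck k g \<Longrightarrow> Ck k (\<lambda>x. f x * g x)"
proof (induction k arbitrary: f g)
  case 0
  then show ?case by (simp add: continuous_on_add continuous_on_mult)
next
  case (Suc k)
  show ?case
    by (rule Ck_SucI[OF has_derivative_mult[OF Ck_SucD(1)[OF Suc.prems(1)] Ck_SucD(1)[OF Suc.prems(2)]]])
      (intro Ck_add Suc.IH Ck_SucD(2)[OF Suc.prems(1)] Ck_SucD(2)[OF Suc.prems(2)]
        Ck_Suc_imp[OF Suc.prems(1)] Ck_Suc_imp[OF Suc.prems(2)])
qed

lemma Ck_cmult: "Ck k f \<Longrightarrow> Ck k (\<lambda>x. c * f x)"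
  by (rule Ck_mult[OF Ck_const])

definition smooth :: "(real \<Rightarrow> real) \<Rightarrow> bool" where
  "smooth f \<longleftrightarrow> (\<forall>k. Ck k f)"

lemma smooth_deriv: "smooth f \<Longrightarrow> smooth (deriv f)"
  and smooth_DERIV: "smooth f \<Longrightarrow> (f has_real_derivative deriv f x) (at x)"
proof -
  assume f: "smooth f"
  have d: "(f has_derivative frechet_derivative f (at x)) (at x)" for x
    using f Ck_SucD(1)[of 0 f] by (auto simp: smooth_def)
  have D: "(f has_real_derivative frechet_derivative f (at x) 1) (at x)" for x
  proof -
    interpret F: bounded_linear "frechet_derivative f (at x)" using d by (rule has_derivative_bounded_linear)
    have "frechet_derivative f (at x) = (*) (frechet_derivative f (at x) 1)"
    proof
      fix h show "frechet_derivative f (at x) h = frechet_derivative f (at x) 1 * h"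
        using F.scale[of h 1] by (simp add: mult.commute)
    qed
    then show ?thesis using d[of x] unfolding has_field_derivative_def by metis
  qed
  then have e: "deriv f = (\<lambda>x. frechet_derivative f (at x) 1)"
    by (auto intro: DERIV_imp_deriv)
  show "(f has_real_derivative deriv f x) (at x)" using D e by simp
  show "smooth (deriv f)"
    unfolding smooth_def e
  proof
    fix k
    have "Ck (Suc k) f" using f by (simp add: smooth_def del: Ck.simps)
    then show "Ck k (\<lambda>x. frechet_derivative f (at x) 1)"
      by (rule Ck_SucD(2)) simp
  qed
qed

lemma Ck_Suc_real:
  assumes "\<And>x. (f has_real_derivative f' x) (at x)" "Ck k f'"
  shows "Ck (Suc k) f"
proof (rule Ck_SucI)
  show "(f has_derivative (\<lambda>h. h * f' x)) (at x)" for x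
    using assms(1)[of x] by (simp add: has_field_derivative_def mult_commute_abs)
  show "Ck k (\<lambda>x. b * f' x)" for b by (rule Ck_cmult[OF assms(2)])
qed

lemma smooth_continuous: "smooth f \<Longrightarrow> continuous_on S f"
  using smooth_def[of f] Ck.simps(1)[of f] by (auto intro: continuous_on_subset)

lemma smoothI_deriv:
  assumes "\<And>x. (f has_real_derivative f' x) (at x)" "smooth f'"
  shows "smooth f"
  unfolding smooth_def
proof
  fix k show "Ck k f"
    using Ck_Suc_real[OF assms(1)] assms(2) Ck_Suc_imp smooth_def by blast
qed

text \<open>If every member of \<open>S\<close> has a derivative in \<open>S\<close>, induction on
  the order differentiates indefinitely. A family closed under differentiation is easier to exhibit
  than formulas for all higher derivatives.\<close>

lemma smooth_coinduct:
  assumes "f \<in> S" and step: "\<And>f. f \<in> S \<Longrightarrow> \<exists>f'\<in>S. \<forall>x. (f has_real_derivative f' x) (at x)"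
  shows "smooth f"
proof -
  have "\<forall>f\<in>S. Ck k f" for k
  proof (induction k)
    case 0
    show ?case
    proof
      fix f assume "f \<in> S"
      then obtain f' where "\<forall>x. (f has_real_derivative f' x) (at x)" using step by blast
      then have "continuous_on UNIV f"
        using DERIV_isCont by (auto simp: continuous_on_eq_continuous_at)
      then show "Ck 0 f" by simp
    qed
  next
    case (Suc k)
    show ?case
    proof
      fix f assume "f \<in> S"
      then obtain f' where "f' \<in> S" "\<forall>x. (f has_real_derivative f' x) (at x)" using step by blast
      then show "Ck (Suc k) f" using Suc by (intro Ck_Suc_real[of f f']) auto
    qed
  qed
  then show ?thesis using assms(1) by (simp add: smooth_def)
qed

lemma smooth_const: "smooth (\<lambda>x. c)"
  by (simp add: smooth_def Ck_const)

lemma smooth_add: "smooth f \<Longrightarrow> smooth g \<Longrightarrow> smooth (\<lambda>x. f x + g x)"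
  by (simp add: smooth_def Ck_add)

lemma smooth_mult: "smooth f \<Longrightarrow> smooth g \<Longrightarrow> smooth (\<lambda>x. f x * g x)"
  by (simp add: smooth_def Ck_mult)

lemma smooth_cmult: "smooth f \<Longrightarrow> smooth (\<lambda>x. c * f x)"
  by (simp add: smooth_def Ck_cmult)

lemma smooth_diff: "smooth f \<Longrightarrow> smooth g \<Longrightarrow> smooth (\<lambda>x. f x - g x)"
  using smooth_add[of f "\<lambda>x. (- 1) * g x"] smooth_cmult[of g "- 1"] by simp

lemma smooth_sum: "(\<And>i. i \<in> I \<Longrightarrow> smooth (f i)) \<Longrightarrow> smooth (\<lambda>x. \<Sum>i\<in>I. f i x)"
  by (induction I rule: infinite_finite_induct) (auto intro: smooth_const smooth_add)

lemma smooth_id: "smooth (\<lambda>x. x)"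
  by (rule smoothI_deriv[of _ "\<lambda>_. 1"]) (auto intro: smooth_const)

lemma smooth_affine:
  assumes "smooth f"
  shows "smooth (\<lambda>x. f (c * x + d))"
proof (rule smooth_coinduct[of _ "{\<lambda>x. b * f (c * x + d) | b f. smooth f}"])
  show "(\<lambda>x. f (c * x + d)) \<in> {\<lambda>x. b * f (c * x + d) | b f. smooth f}"
    using assms by (intro CollectI exI[of _ 1] exI[of _ f]) auto
next
  fix g assume "g \<in> {\<lambda>x. b * f (c * x + d) | b f. smooth f}"
  then obtain b f where g: "g = (\<lambda>x. b * f (c * x + d))" and f: "smooth f" by blast
  have "(g has_real_derivative (b * c) * deriv f (c * x + d)) (at x)" for x
    unfolding g
    by (rule derivative_eq_intros DERIV_chain2[OF smooth_DERIV[OF f]] refl | simp)+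
  then show "\<exists>f'\<in>{\<lambda>x. b * f (c * x + d) | b f. smooth f}. \<forall>x. (g has_real_derivative f' x) (at x)"
    using smooth_deriv[OF f] by (intro bexI[of _ "\<lambda>x. (b * c) * deriv f (c * x + d)"]) auto
qed

lemma smooth_sin: "smooth sin" and smooth_cos: "smooth cos"
proof -
  let ?S = "{\<lambda>x::real. a * sin x + b * cos x | a b. True}"
  have step: "\<exists>f'\<in>?S. \<forall>x. (f has_real_derivative f' x) (at x)" if "f \<in> ?S" for f
  proof -
    from that obtain a b where f: "f = (\<lambda>x. a * sin x + b * cos x)" by blast
    have "(f has_real_derivative (- b) * sin x + a * cos x) (at x)" for x
      unfolding f by (auto intro!: derivative_eq_intros)
    then show ?thesis by (intro bexI[of _ "\<lambda>x. (- b) * sin x + a * cos x"]) blast+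
  qed
  show "smooth sin"
    by (rule smooth_coinduct[OF _ step]) (intro CollectI exI[of _ 1] exI[of _ 0], simp)
  show "smooth cos"
    by (rule smooth_coinduct[OF _ step]) (intro CollectI exI[of _ 0] exI[of _ 1], simp)
qed

section \<open>Bump functions\<close>

text \<open>The classical flat functions. The polynomial factor closes the family under
  differentiation: with \<open>t = 1 / x\<close>, the derivative replaces \<open>P t\<close> by
  \<open>t ^ 2 * (P t - P' t)\<close>.\<close>

definition flat :: "real poly \<Rightarrow> real \<Rightarrow> real" where
  "flat P x = (if x > 0 then poly P (1 / x) * exp (- (1 / x)) else 0)"

lemma poly_exp_tendsto_0: "((\<lambda>t. poly P t * exp (- t)) \<longlongrightarrow> (0::real)) at_top"
proof -
  have "((\<lambda>t. \<Sum>i\<le>degree P. coeff P i * (t ^ i / exp t)) \<longlongrightarrow> (\<Sum>i\<le>degree P. coeff P i * 0)) at_top"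
    by (intro tendsto_intros tendsto_power_div_exp_0)
  moreover have "(\<lambda>t. \<Sum>i\<le>degree P. coeff P i * (t ^ i / exp t)) = (\<lambda>t. poly P t * exp (- t))"
    by (simp add: fun_eq_iff poly_altdef sum_distrib_left exp_minus divide_inverse mult_ac)
  ultimately show ?thesis by simp
qed

lemma flat_deriv: "(flat P has_real_derivative flat (monom 1 2 * (P - pderiv P)) x) (at x)"
proof -
  consider "x > 0" | "x < 0" | "x = 0" by linarith
  then show ?thesis
  proof cases
    case 1
    have "((\<lambda>x. poly P (1 / x) * exp (- (1 / x))) has_real_derivative
       flat (monom 1 2 * (P - pderiv P)) x) (at x)"
      unfolding flat_def using 1
      by (auto intro!: derivative_eq_intros DERIV_chain2[OF poly_DERIV]
          simp: poly_monom field_simps power2_eq_square)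
    then show ?thesis
      by (rule has_field_derivative_transform_within_open[of _ _ _ "{0<..}"])
        (use 1 in \<open>auto simp: flat_def\<close>)
  next
    case 2
    have "((\<lambda>x. 0) has_real_derivative flat (monom 1 2 * (P - pderiv P)) x) (at x)"
      using 2 by (simp add: flat_def)
    then show ?thesis
      by (rule has_field_derivative_transform_within_open[of _ _ _ "{..<0}"])
        (use 2 in \<open>auto simp: flat_def\<close>)
  next
    case 3
    \<comment> \<open>From the right, the difference quotient at \<open>0\<close> is
      \<open>t * P t * exp (- t)\<close> with \<open>t = 1 / h\<close>, and exponential decay beats
      the polynomial.\<close>
    have lim: "((\<lambda>t. poly (monom 1 1 * P) t * exp (- t)) \<longlongrightarrow> 0) at_top"
      by (rule poly_exp_tendsto_0)
    have "((\<lambda>h. poly (monom 1 1 * P) (inverse h) * exp (- inverse h)) \<longlongrightarrow> 0) (at_right (0::real))"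
      by (rule filterlim_compose[OF lim filterlim_inverse_at_top_right])
    then have r: "((\<lambda>h. flat P h / h) \<longlongrightarrow> 0) (at_right 0)"
      by (rule Lim_transform_eventually)
        (auto simp: flat_def poly_monom divide_inverse mult_ac eventually_at_right_field intro!: exI[of _ 1])
    have l: "((\<lambda>h. flat P h / h) \<longlongrightarrow> 0) (at_left 0)"
      by (rule Lim_transform_eventually[OF tendsto_const])
        (auto simp: flat_def eventually_at_left_field intro!: exI[of _ "-1"])
    have "((\<lambda>h. flat P h / h) \<longlongrightarrow> 0) (at 0)"
      using r l by (simp add: filterlim_at_split)
    then show ?thesis
      using 3 by (simp add: DERIV_def flat_def)
  qed
qed

lemma smooth_flat: "smooth (flat P)"
  by (rule smooth_coinduct[of _ "range flat"]) (use flat_deriv in blast)+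

text \<open>For \<open>n > 0\<close> the shift by \<open>1\<close> keeps the support inside
  \<open>[a + 1 / n, b - 1 / n]\<close>, while the scaling by \<open>n\<close> lets the values
  inside the interval tend to \<open>1\<close>. Being bounded by \<open>1\<close>, the sequence is a
  smooth substitute for the indicator under dominated convergence. For \<open>n = 0\<close> the
  function is zero.\<close>

definition bump :: "nat \<Rightarrow> real \<Rightarrow> real \<Rightarrow> real \<Rightarrow> real" where
  "bump n a b x = flat 1 (real n * (x - a) - 1) * flat 1 (real n * (b - x) - 1)"

lemma smooth_bump: "smooth (bump n a b)"
proof -
  have 1: "smooth (\<lambda>x. flat 1 (real n * x + (- real n * a - 1)))"
    by (rule smooth_affine[OF smooth_flat])
  have 2: "smooth (\<lambda>x. flat 1 ((- real n) * x + (real n * b - 1)))"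
    by (rule smooth_affine[OF smooth_flat])
  have "bump n a b = (\<lambda>x. flat 1 (real n * x + (- real n * a - 1)) * flat 1 ((- real n) * x + (real n * b - 1)))"
    by (simp add: bump_def fun_eq_iff algebra_simps)
  then show ?thesis using smooth_mult[OF 1 2] by simp
qed

lemma flat_1_bounds: "0 \<le> flat 1 x" "flat 1 x \<le> 1"
  by (auto simp: flat_def)

lemma bump_nonneg: "0 \<le> bump n a b x" and bump_le_1: "bump n a b x \<le> 1"
  unfolding bump_def using flat_1_bounds by (auto intro: mult_nonneg_nonneg mult_le_one)

lemma bump_nonzeroD:
  assumes "bump n a b x \<noteq> 0"
  shows "a + 1 / real n < x \<and> x < b - 1 / real n"
proof -
  have "0 < real n * (x - a) - 1" "0 < real n * (b - x) - 1"
    using assms by (auto simp: bump_def flat_def split: if_splits)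
  moreover have "n > 0" using calculation by (cases n) auto
  ultimately show ?thesis by (simp add: field_simps)
qed

lemma flat_1_tendsto: "0 < c \<Longrightarrow> (\<lambda>n. flat 1 (real n * c - 1)) \<longlonglongrightarrow> 1"
proof -
  assume c: "0 < c"
  have lim: "filterlim (\<lambda>n. real n * c - 1) at_top sequentially"
    using c by real_asymp
  have "(\<lambda>n. exp (- inverse (real n * c - 1))) \<longlonglongrightarrow> 1"
    using c by real_asymp
  moreover have "\<forall>\<^sub>F n in sequentially. 0 < real n * c - 1"
    using filterlim_at_top_dense[THEN iffD1, OF lim] by blast
  then have "\<forall>\<^sub>F n in sequentially. exp (- inverse (real n * c - 1)) = flat 1 (real n * c - 1)"
    by eventually_elim (simp add: flat_def inverse_eq_divide)
  ultimately show ?thesis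
    by (rule Lim_transform_eventually)
qed

lemma bump_tendsto:
  shows "(\<lambda>n. bump n a b x) \<longlonglongrightarrow> indicator {a<..<b} x"
proof (cases "x \<in> {a<..<b}")
  case True
  then have "(\<lambda>n. flat 1 (real n * (x - a) - 1) * flat 1 (real n * (b - x) - 1)) \<longlonglongrightarrow> 1 * 1"
    by (intro tendsto_mult flat_1_tendsto) auto
  then show ?thesis using True by (simp add: bump_def)
next
  case False
  have "bump n a b x = 0" for n
  proof (rule ccontr)
    assume "bump n a b x \<noteq> 0"
    then have "a + 1 / real n < x \<and> x < b - 1 / real n" by (rule bump_nonzeroD)
    moreover have "0 \<le> 1 / real n" by simp
    ultimately have "a < x \<and> x < b" by linarith
    then show False using False by simp
  qed
  then show ?thesis using False by simp
qed

section \<open>Square integrable functions\<close>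

lemma borel_imp_lebesgue_on:
  "f \<in> borel_measurable borel \<Longrightarrow> f \<in> borel_measurable (lebesgue_on S)"
  for f :: "'a::euclidean_space \<Rightarrow> 'b::euclidean_space"
  by (intro measurable_restrict_space1 measurable_completion) simp

lemma bounded_integrable_on:
  fixes f :: "'a::euclidean_space \<Rightarrow> 'b::euclidean_space"
  assumes "f \<in> borel_measurable (lebesgue_on S)" "S \<in> lmeasurable" "\<And>x. x \<in> S \<Longrightarrow> norm (f x) \<le> C"
  shows "integrable (lebesgue_on S) f"
proof -
  interpret finite_measure "lebesgue_on S" using assms(2) by (rule finite_measure_lebesgue_on)
  show ?thesis using assms by (intro integrable_const_bound[of _ C]) auto
qed

lemma L2_bounded:
  fixes f :: "'a::euclidean_space \<Rightarrow> 'b::euclidean_space"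
  assumes "f \<in> borel_measurable (lebesgue_on S)" "S \<in> lmeasurable" "\<And>x. x \<in> S \<Longrightarrow> norm (f x) \<le> C"
  shows "f \<in> L2 S"
proof -
  have "norm ((norm (f x))\<^sup>2) \<le> C\<^sup>2" if "x \<in> S" for x
    using assms(3)[OF that] by (simp add: power_mono)
  then have "integrable (lebesgue_on S) (\<lambda>x. (norm (f x))\<^sup>2)"
    using assms by (intro bounded_integrable_on[of _ _ "C\<^sup>2"]) auto
  then show ?thesis using assms by (simp add: L2_def)
qed

lemma L2_measurable: "f \<in> L2 S \<Longrightarrow> f \<in> borel_measurable (lebesgue_on S)"
  by (simp add: L2_def)

lemma L2_inner_integrable:
  assumes f: "f \<in> L2 S" and g: "g \<in> L2 S"
  shows "integrable (lebesgue_on S) (\<lambda>x. f x \<bullet> g x)"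
proof (rule Bochner_Integration.integrable_bound)
  show "integrable (lebesgue_on S) (\<lambda>x. (norm (f x))\<^sup>2 + (norm (g x))\<^sup>2)"
    using f g by (auto simp: L2_def)
  show "(\<lambda>x. f x \<bullet> g x) \<in> borel_measurable (lebesgue_on S)"
    using L2_measurable[OF f] L2_measurable[OF g] by measurable
  have "\<bar>f x \<bullet> g x\<bar> \<le> (norm (f x))\<^sup>2 + (norm (g x))\<^sup>2" for x
  proof -
    have "\<bar>f x \<bullet> g x\<bar> \<le> norm (f x) * norm (g x)" by (rule Cauchy_Schwarz_ineq2)
    moreover have "2 * (norm (f x) * norm (g x)) \<le> (norm (f x))\<^sup>2 + (norm (g x))\<^sup>2"
      using sum_squares_bound[of "norm (f x)" "norm (g x)"] by simp
    moreover have "0 \<le> norm (f x) * norm (g x)" by simp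
    ultimately show ?thesis by linarith
  qed
  then show "AE x in lebesgue_on S. norm (f x \<bullet> g x) \<le> norm ((norm (f x))\<^sup>2 + (norm (g x))\<^sup>2)"
    by auto
qed

lemma L2_I:
  assumes "f \<in> borel_measurable (lebesgue_on S)" "integrable (lebesgue_on S) (\<lambda>x. f x \<bullet> f x)"
  shows "f \<in> L2 S"
  using assms by (simp add: L2_def power2_norm_eq_inner)

lemma L2_scale: "f \<in> L2 S \<Longrightarrow> (\<lambda>x. c *\<^sub>R f x) \<in> L2 S"
  by (rule L2_I) (use L2_measurable[of f S] L2_inner_integrable[of f S f] in auto)

lemma L2_add:
  assumes f: "f \<in> L2 S" and g: "g \<in> L2 S"
  shows "(\<lambda>x. f x + g x) \<in> L2 S"
proof (rule L2_I)
  show "(\<lambda>x. f x + g x) \<in> borel_measurable (lebesgue_on S)"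
    using L2_measurable[OF f] L2_measurable[OF g] by measurable
  have "integrable (lebesgue_on S) (\<lambda>x. f x \<bullet> f x + (g x \<bullet> f x + (f x \<bullet> g x + g x \<bullet> g x)))"
    by (intro Bochner_Integration.integrable_add L2_inner_integrable f g)
  then show "integrable (lebesgue_on S) (\<lambda>x. (f x + g x) \<bullet> (f x + g x))"
    by (simp add: inner_add_left inner_add_right add.assoc)
qed

lemma L2_diff: "f \<in> L2 S \<Longrightarrow> g \<in> L2 S \<Longrightarrow> (\<lambda>x. f x - g x) \<in> L2 S"
  using L2_add[of f S "\<lambda>x. (- 1) *\<^sub>R g x"] L2_scale[of g S "- 1"] by simp

lemma L2_subset:
  assumes f: "f \<in> L2 S" and T: "T \<subseteq> S" "T \<in> sets lebesgue" and S: "S \<in> sets lebesgue"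
  shows "f \<in> L2 T"
proof -
  have ST: "lebesgue_on T = restrict_space (lebesgue_on S) T"
    using T S by (simp add: restrict_restrict_space Int_absorb1)
  have Ts: "T \<inter> space (lebesgue_on S) \<in> sets (lebesgue_on S)"
    using T by (auto simp: sets_restrict_space Int_absorb2)
  show ?thesis
  proof (rule L2_I)
    show m: "f \<in> borel_measurable (lebesgue_on T)"
      unfolding ST by (rule measurable_restrict_space1[OF L2_measurable[OF f]])
    show "integrable (lebesgue_on T) (\<lambda>x. f x \<bullet> f x)"
      unfolding ST integrable_restrict_space[OF Ts]
      using integrable_mult_indicator[OF _ L2_inner_integrable[OF f f]] Ts T
      by (simp add: Int_absorb2)
  qed
qed

lemma L2_integrable:
  assumes f: "f \<in> L2 S" and S: "S \<in> lmeasurable"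
  shows "integrable (lebesgue_on S) f"
proof (rule Bochner_Integration.integrable_bound)
  have "integrable (lebesgue_on S) (\<lambda>x. 1 :: real)"
    using S by (intro bounded_integrable_on[of _ _ 1]) auto
  then show "integrable (lebesgue_on S) (\<lambda>x. 1 + f x \<bullet> f x)"
    by (intro Bochner_Integration.integrable_add L2_inner_integrable f)
  show "f \<in> borel_measurable (lebesgue_on S)" by (rule L2_measurable[OF f])
  have "norm (f x) \<le> 1 + f x \<bullet> f x" for x
  proof -
    have "2 * 1 * norm (f x) \<le> 1\<^sup>2 + (norm (f x))\<^sup>2" by (rule sum_squares_bound)
    then show ?thesis
      using norm_ge_zero[of "f x"] unfolding power2_norm_eq_inner[symmetric] one_power2 mult_1_right
      by linarith
  qed
  then show "AE x in lebesgue_on S. norm (f x) \<le> norm (1 + f x \<bullet> f x)"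
    by (auto intro: order.trans[OF _ abs_ge_self])
qed

lemma L2_inner_add: "f \<in> L2 S \<Longrightarrow> g \<in> L2 S \<Longrightarrow> h \<in> L2 S \<Longrightarrow>
    L2_inner S (\<lambda>x. f x + g x) h = L2_inner S f h + L2_inner S g h"
  unfolding L2_inner_def by (simp add: inner_add_left L2_inner_integrable)

lemma L2_inner_scale: "L2_inner S (\<lambda>x. c *\<^sub>R f x) h = c * L2_inner S f h"
  unfolding L2_inner_def by simp

lemma L2_inner_sym: "L2_inner S f g = L2_inner S g f"
  unfolding L2_inner_def by (simp add: inner_commute)

lemma L2_inner_nonneg: "0 \<le> L2_inner S f f"
  unfolding L2_inner_def by simp

lemma L2_inner_cong_AE:
  assumes "AE x in lebesgue_on S. f x = f' x" "AE x in lebesgue_on S. g x = g' x"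
    "f \<in> borel_measurable (lebesgue_on S)" "f' \<in> borel_measurable (lebesgue_on S)"
    "g \<in> borel_measurable (lebesgue_on S)" "g' \<in> borel_measurable (lebesgue_on S)"
  shows "L2_inner S f g = L2_inner S f' g'"
  unfolding L2_inner_def
proof (rule integral_cong_AE)
  show "AE x in lebesgue_on S. f x \<bullet> g x = f' x \<bullet> g' x"
    using assms(1,2) by eventually_elim simp
qed (use assms in measurable)

lemma AE_lebesgue_on_subset:
  assumes "AE x in lebesgue_on S. P x" "T \<subseteq> S" "S \<in> sets lebesgue" "T \<in> sets lebesgue"
  shows "AE x in lebesgue_on T. P x"
proof -
  have "AE x in lebesgue. x \<in> S \<longrightarrow> P x"
    using assms by (simp add: AE_restrict_space_iff)
  then have "AE x in lebesgue. x \<in> T \<longrightarrow> P x"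
    by eventually_elim (use assms(2) in blast)
  then show ?thesis using assms by (simp add: AE_restrict_space_iff)
qed

lemma L2_inner_subset_le:
  assumes f: "f \<in> L2 S" and T: "T \<subseteq> S" "T \<in> sets lebesgue" and S: "S \<in> sets lebesgue"
  shows "L2_inner T f f \<le> L2_inner S f f"
proof -
  have Ts: "T \<inter> space lebesgue \<in> sets lebesgue" "S \<inter> space lebesgue \<in> sets lebesgue" using T S by auto
  show ?thesis
    unfolding L2_inner_def integral_restrict_space[OF Ts(1), of "\<lambda>x. f x \<bullet> f x"]
      integral_restrict_space[OF Ts(2), of "\<lambda>x. f x \<bullet> f x"]
  proof (rule integral_mono)
    show "integrable lebesgue (\<lambda>x. indicator T x *\<^sub>R (f x \<bullet> f x))"
      by (rule integrable_restrict_space[OF Ts(1), THEN iffD1, OF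
          L2_inner_integrable[OF L2_subset[OF f T S] L2_subset[OF f T S]]])
    show "integrable lebesgue (\<lambda>x. indicator S x *\<^sub>R (f x \<bullet> f x))"
      by (rule integrable_restrict_space[OF Ts(2), THEN iffD1, OF L2_inner_integrable[OF f f]])
    show "indicator T x *\<^sub>R (f x \<bullet> f x) \<le> indicator S x *\<^sub>R (f x \<bullet> f x)" for x
      using T by (auto simp: indicator_def)
  qed
qed

section \<open>Integration over rectangles\<close>

lemma integral_lebesgue_on_lborel:
  fixes f :: "'a::euclidean_space \<Rightarrow> 'b::euclidean_space"
  assumes S: "S \<in> sets borel" and f: "f \<in> borel_measurable borel"
  shows "integral\<^sup>L (lebesgue_on S) f = integral\<^sup>L lborel (\<lambda>x. indicator S x *\<^sub>R f x)"
proof -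
  have "integral\<^sup>L (lebesgue_on S) f = integral\<^sup>L lebesgue (\<lambda>x. indicator S x *\<^sub>R f x)"
    using S by (intro integral_restrict_space) auto
  also have "\<dots> = integral\<^sup>L lborel (\<lambda>x. indicator S x *\<^sub>R f x)"
    using S f by (intro integral_completion) auto
  finally show ?thesis .
qed

text \<open>The bound on the rectangle supplies integrability. Both orders are kept because a
  partial derivative has to be integrated along its own variable first.\<close>

lemma rectangle_Fubini:
  fixes f :: "real \<times> real \<Rightarrow> real"
  assumes f: "f \<in> borel_measurable borel"
    and bd: "\<And>x y. x \<in> {a<..<b} \<Longrightarrow> y \<in> {c<..<d} \<Longrightarrow> \<bar>f (x, y)\<bar> \<le> C"
  shows "(LINT z|lebesgue_on ({a<..<b} \<times> {c<..<d}). f z)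
      = (LINT y|lebesgue_on {c<..<d}. LINT x|lebesgue_on {a<..<b}. f (x, y))" (is "?L = ?R1")
    and "(LINT z|lebesgue_on ({a<..<b} \<times> {c<..<d}). f z)
      = (LINT x|lebesgue_on {a<..<b}. LINT y|lebesgue_on {c<..<d}. f (x, y))" (is "_ = ?R2")
proof -
  define A where "A = {a<..<b}"
  define B where "B = {c<..<d}"
  define F where "F = (\<lambda>z. indicator (A \<times> B) z *\<^sub>R f z)"
  have AB: "A \<in> sets borel" "B \<in> sets borel" "A \<times> B \<in> sets borel"
    by (auto simp: A_def B_def open_Times)
  have m: "f \<in> borel_measurable (borel \<Otimes>\<^sub>M borel)" using f by (simp add: borel_prod)
  have mx: "(\<lambda>x. f (x, y)) \<in> borel_measurable borel" for y using m by measurable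
  have my: "(\<lambda>y. f (x, y)) \<in> borel_measurable borel" for x using m by measurable
  have L: "?L = integral\<^sup>L lborel F"
    unfolding A_def[symmetric] B_def[symmetric] F_def by (rule integral_lebesgue_on_lborel[OF AB(3) f])
  have lm: "A \<times> B \<in> lmeasurable"
    unfolding A_def B_def by (intro lmeasurable_open bounded_Times open_Times) auto
  have "integrable (lebesgue_on (A \<times> B)) f"
    by (rule bounded_integrable_on[OF borel_imp_lebesgue_on[OF f] lm, of C])
      (use bd in \<open>auto simp: A_def B_def\<close>)
  then have intF: "integrable lebesgue F"
    unfolding F_def using AB by (subst (asm) integrable_restrict_space) auto
  have int: "integrable (lborel \<Otimes>\<^sub>M lborel) (\<lambda>(x, y). F (x, y))"
  proof -
    have "integrable lborel F"
      using intF f AB unfolding F_def by (subst (asm) integrable_completion) auto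
    moreover have "(\<lambda>(x, y). F (x, y)) = F" by auto
    ultimately show ?thesis by (simp only: lborel_prod)
  qed
  have sel: "F (x, y) = indicator A x *\<^sub>R (indicator B y *\<^sub>R f (x, y))" for x y
    by (auto simp: F_def indicator_def)
  have "integral\<^sup>L lborel F = (\<integral>y. (\<integral>x. F (x, y) \<partial>lborel) \<partial>lborel)"
    using lborel_pair.integral_snd[OF int] by (simp add: lborel_prod)
  also have "\<dots> = (\<integral>y. indicator B y *\<^sub>R (LINT x|lebesgue_on A. f (x, y)) \<partial>lborel)"
    unfolding integral_lebesgue_on_lborel[OF AB(1) mx]
    by (intro Bochner_Integration.integral_cong refl) (auto simp: sel indicator_def)
  also have "\<dots> = (LINT y|lebesgue_on B. LINT x|lebesgue_on A. f (x, y))"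
  proof (rule integral_lebesgue_on_lborel[OF AB(2), symmetric])
    have "(\<lambda>y. \<integral>x. indicator A x *\<^sub>R f (x, y) \<partial>lborel) \<in> borel_measurable lborel"
      using m AB by measurable
    then show "(\<lambda>y. LINT x|lebesgue_on A. f (x, y)) \<in> borel_measurable borel"
      unfolding integral_lebesgue_on_lborel[OF AB(1) mx] by simp
  qed
  finally show "?L = ?R1" using L by (simp add: A_def B_def)
  have "integral\<^sup>L lborel F = (\<integral>x. (\<integral>y. F (x, y) \<partial>lborel) \<partial>lborel)"
    using lborel_pair.integral_fst[OF int] by (simp add: lborel_prod)
  also have "\<dots> = (\<integral>x. indicator A x *\<^sub>R (LINT y|lebesgue_on B. f (x, y)) \<partial>lborel)"
    unfolding integral_lebesgue_on_lborel[OF AB(2) my]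
    by (intro Bochner_Integration.integral_cong refl) (auto simp: sel indicator_def)
  also have "\<dots> = (LINT x|lebesgue_on A. LINT y|lebesgue_on B. f (x, y))"
  proof (rule integral_lebesgue_on_lborel[OF AB(1), symmetric])
    have "(\<lambda>x. \<integral>y. indicator B y *\<^sub>R f (x, y) \<partial>lborel) \<in> borel_measurable lborel"
      using m AB by measurable
    then show "(\<lambda>x. LINT y|lebesgue_on B. f (x, y)) \<in> borel_measurable borel"
      unfolding integral_lebesgue_on_lborel[OF AB(2) my] by simp
  qed
  finally show "?L = ?R2" using L by (simp add: A_def B_def)
qed

text \<open>The fundamental theorem of calculus computes gauge integrals, whereas the function
  spaces are built on Lebesgue integrals. For bounded Borel functions on an interval the two agree,
  and the end points are negligible.\<close>

lemma integral_interval_has_integral: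
  fixes g :: "real \<Rightarrow> real"
  assumes g: "g \<in> borel_measurable borel" and bd: "\<And>x. x \<in> {a<..<b} \<Longrightarrow> \<bar>g x\<bar> \<le> C"
    and I: "(g has_integral I) {a..b}"
  shows "(LINT x|lebesgue_on {a<..<b}. g x) = I"
proof -
  have "integrable (lebesgue_on {a<..<b}) g"
    using bd by (intro bounded_integrable_on[OF borel_imp_lebesgue_on[OF g], of _ C]) auto
  then have "(g has_integral (LINT x|lebesgue_on {a<..<b}. g x)) {a<..<b}"
    by (intro has_integral_integral_lebesgue_on) auto
  then have "(g has_integral (LINT x|lebesgue_on {a<..<b}. g x)) {a..b}"
    by (simp add: has_integral_Icc_iff_Ioo)
  then show ?thesis using I has_integral_unique by blast
qed

lemma rectangle_integral_product:
  fixes g h :: "real \<Rightarrow> real"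
  assumes g: "g \<in> borel_measurable borel" and h: "h \<in> borel_measurable borel"
    and bg: "\<And>x. x \<in> {a<..<b} \<Longrightarrow> \<bar>g x\<bar> \<le> C" and bh: "\<And>x. x \<in> {c<..<d} \<Longrightarrow> \<bar>h x\<bar> \<le> C'"
    and I: "(g has_integral I) {a..b}" and J: "(h has_integral J) {c..d}"
  shows "(LINT z|lebesgue_on ({a<..<b} \<times> {c<..<d}). g (fst z) * h (snd z)) = I * J"
proof -
  have m: "(\<lambda>z. g (fst z) * h (snd z)) \<in> borel_measurable borel"
    unfolding borel_prod[symmetric] using g h by measurable
  have "(LINT z|lebesgue_on ({a<..<b} \<times> {c<..<d}). g (fst z) * h (snd z))
      = (LINT y|lebesgue_on {c<..<d}. LINT x|lebesgue_on {a<..<b}. g x * h y)"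
  proof (subst rectangle_Fubini(1)[OF m, where C = "\<bar>C\<bar> * \<bar>C'\<bar>"])
    fix x y assume "x \<in> {a<..<b}" "y \<in> {c<..<d}"
    then show "\<bar>g (fst (x, y)) * h (snd (x, y))\<bar> \<le> \<bar>C\<bar> * \<bar>C'\<bar>"
      using bg[of x] bh[of y] by (simp add: abs_mult) (intro mult_mono, auto)
  qed simp
  also have "\<dots> = (LINT y|lebesgue_on {c<..<d}. I * h y)"
    using integral_interval_has_integral[OF g bg I] by simp
  also have "\<dots> = I * J"
    using integral_interval_has_integral[OF h bh J] by simp
  finally show ?thesis .
qed

section \<open>Test functions in the plane\<close>

lemma test_functionsI:
  assumes "\<And>k. Ck k \<phi>" "compact K" "K \<subseteq> S" "\<And>x. x \<notin> K \<Longrightarrow> \<phi> x = 0"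
  shows "\<phi> \<in> test_functions S"
proof -
  have sub: "closure {x. \<phi> x \<noteq> 0} \<subseteq> K"
    using assms by (intro closure_minimal compact_imp_closed) auto
  then have "compact (closure {x. \<phi> x \<noteq> 0})"
    using compact_Int_closed[OF assms(2) closed_closure] by (metis Int_absorb1)
  then show ?thesis using assms sub by (auto simp: test_functions_def)
qed

lemma test_functionsE:
  assumes "\<phi> \<in> test_functions S"
  obtains K where "\<forall>k. Ck k \<phi>" "compact K" "K \<subseteq> S" "\<forall>x. x \<notin> K \<longrightarrow> \<phi> x = 0"
proof
  show "\<forall>x. x \<notin> closure {x. \<phi> x \<noteq> 0} \<longrightarrow> \<phi> x = 0"
    using closure_subset[of "{x. \<phi> x \<noteq> 0}"] by auto
qed (use assms in \<open>auto simp: test_functions_def\<close>)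

lemma test_functions_Ck: "\<phi> \<in> test_functions S \<Longrightarrow> Ck k \<phi>"
  by (simp add: test_functions_def)

lemma test_functions_outside: "\<phi> \<in> test_functions S \<Longrightarrow> x \<notin> S \<Longrightarrow> \<phi> x = 0"
  by (erule test_functionsE) auto

lemma test_functions_add:
  assumes "\<phi> \<in> test_functions S" "\<psi> \<in> test_functions S"
  shows "(\<lambda>x. \<phi> x + \<psi> x) \<in> test_functions S"
proof -
  obtain K where K: "\<forall>k. Ck k \<phi>" "compact K" "K \<subseteq> S" "\<forall>x. x \<notin> K \<longrightarrow> \<phi> x = 0"
    using test_functionsE[OF assms(1)] by blast
  obtain L where L: "\<forall>k. Ck k \<psi>" "compact L" "L \<subseteq> S" "\<forall>x. x \<notin> L \<longrightarrow> \<psi> x = 0"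
    using test_functionsE[OF assms(2)] by blast
  show ?thesis
    by (rule test_functionsI[of _ "K \<union> L"]) (use K L in \<open>auto intro!: Ck_add simp del: Ck.simps\<close>)
qed

lemma test_functions_scale:
  assumes "\<phi> \<in> test_functions S"
  shows "(\<lambda>x. c * \<phi> x) \<in> test_functions S"
proof -
  obtain K where K: "\<forall>k. Ck k \<phi>" "compact K" "K \<subseteq> S" "\<forall>x. x \<notin> K \<longrightarrow> \<phi> x = 0"
    using test_functionsE[OF assms(1)] by blast
  show ?thesis
    by (rule test_functionsI[of _ K]) (use K in \<open>auto intro!: Ck_cmult simp del: Ck.simps\<close>)
qed

definition pd1 :: "(real \<times> real \<Rightarrow> real) \<Rightarrow> real \<times> real \<Rightarrow> real" where
  "pd1 \<phi> z = frechet_derivative \<phi> (at z) (1, 0)"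

definition pd2 :: "(real \<times> real \<Rightarrow> real) \<Rightarrow> real \<times> real \<Rightarrow> real" where
  "pd2 \<phi> z = frechet_derivative \<phi> (at z) (0, 1)"

lemma Basis_plane: "(Basis :: (real \<times> real) set) = {(1, 0), (0, 1)}"
  by (auto simp: Basis_prod_def)

lemma gradient_plane: "gradient \<phi> z = (pd1 \<phi> z, pd2 \<phi> z)"
  by (simp add: gradient_def Basis_plane pd1_def pd2_def)

lemma Ck_pd: "Ck (Suc k) \<phi> \<Longrightarrow> Ck k (pd1 \<phi>)" "Ck (Suc k) \<phi> \<Longrightarrow> Ck k (pd2 \<phi>)"
  by (auto simp: Basis_plane pd1_def[abs_def] pd2_def[abs_def])

lemma pd1_deriv:
  assumes "\<forall>k. Ck k \<phi>"
  shows "((\<lambda>x. \<phi> (x, y)) has_real_derivative pd1 \<phi> (x, y)) (at x)"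
proof -
  have D: "(\<phi> has_derivative frechet_derivative \<phi> (at (x, y))) (at (x, y))"
    using assms Ck_SucD(1)[of 0 \<phi>] by blast
  interpret F: bounded_linear "frechet_derivative \<phi> (at (x, y))"
    using D by (rule has_derivative_bounded_linear)
  have "((\<lambda>x. (x, y)) has_derivative (\<lambda>h. (h, 0))) (at x)"
    by (auto intro!: derivative_eq_intros)
  from has_derivative_compose[OF this D]
  have "((\<lambda>x. \<phi> (x, y)) has_derivative (\<lambda>h. frechet_derivative \<phi> (at (x, y)) (h, 0))) (at x)" .
  moreover have "(\<lambda>h. frechet_derivative \<phi> (at (x, y)) (h, 0)) = (*) (pd1 \<phi> (x, y))"
  proof
    fix h show "frechet_derivative \<phi> (at (x, y)) (h, 0) = pd1 \<phi> (x, y) * h"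
      using F.scale[of h "(1, 0)"] by (simp add: pd1_def mult.commute[of h])
  qed
  ultimately show ?thesis by (simp add: has_field_derivative_def)
qed

lemma pd2_deriv:
  assumes "\<forall>k. Ck k \<phi>"
  shows "((\<lambda>y. \<phi> (x, y)) has_real_derivative pd2 \<phi> (x, y)) (at y)"
proof -
  have D: "(\<phi> has_derivative frechet_derivative \<phi> (at (x, y))) (at (x, y))"
    using assms Ck_SucD(1)[of 0 \<phi>] by blast
  interpret F: bounded_linear "frechet_derivative \<phi> (at (x, y))"
    using D by (rule has_derivative_bounded_linear)
  have "((\<lambda>y. (x, y)) has_derivative (\<lambda>h. (0, h))) (at y)"
    by (auto intro!: derivative_eq_intros)
  from has_derivative_compose[OF this D]
  have "((\<lambda>y. \<phi> (x, y)) has_derivative (\<lambda>h. frechet_derivative \<phi> (at (x, y)) (0, h))) (at y)" .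
  moreover have "(\<lambda>h. frechet_derivative \<phi> (at (x, y)) (0, h)) = (*) (pd2 \<phi> (x, y))"
  proof
    fix h show "frechet_derivative \<phi> (at (x, y)) (0, h) = pd2 \<phi> (x, y) * h"
      using F.scale[of h "(0, 1)"] by (simp add: pd2_def mult.commute[of h])
  qed
  ultimately show ?thesis by (simp add: has_field_derivative_def)
qed

lemma Ck_continuous: "Ck k \<phi> \<Longrightarrow> continuous_on S \<phi>"
proof -
  assume "Ck k \<phi>"
  then have "Ck 0 \<phi>" by (induction k) (auto dest: Ck_Suc_imp simp del: Ck.simps)
  then show ?thesis by (auto intro: continuous_on_subset)
qed

lemma Ck_borel: "Ck k \<phi> \<Longrightarrow> \<phi> \<in> borel_measurable borel"
  by (intro borel_measurable_continuous_onI Ck_continuous)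

text \<open>A partial derivative of a tensor product is a tensor product with one factor
  differentiated, so the induction has to keep both factors arbitrary.\<close>

lemma Ck_tensor: "smooth \<alpha> \<Longrightarrow> smooth \<beta> \<Longrightarrow> Ck k (\<lambda>z. \<alpha> (fst z) * \<beta> (snd z))"
proof (induction k arbitrary: \<alpha> \<beta>)
  case 0
  then show ?case
    by (simp, intro continuous_on_mult continuous_on_compose2[OF smooth_continuous[of \<alpha> UNIV]]
        continuous_on_compose2[OF smooth_continuous[of \<beta> UNIV]] continuous_on_fst continuous_on_snd continuous_on_id)
      auto
next
  case (Suc k)
  have a: "(\<alpha> has_derivative (*) (deriv \<alpha> x)) (at x)" and b: "(\<beta> has_derivative (*) (deriv \<beta> x)) (at x)" for x
    using smooth_DERIV[OF Suc.prems(1)] smooth_DERIV[OF Suc.prems(2)] by (simp_all add: has_field_derivative_def)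
  show ?case
  proof (rule Ck_SucI)
    fix z :: "real \<times> real"
    show "((\<lambda>z. \<alpha> (fst z) * \<beta> (snd z)) has_derivative
        (\<lambda>h. \<alpha> (fst z) * (deriv \<beta> (snd z) * snd h) + (deriv \<alpha> (fst z) * fst h) * \<beta> (snd z))) (at z)"
      by (rule has_derivative_mult has_derivative_compose[OF _ a] has_derivative_compose[OF _ b]
          has_derivative_fst has_derivative_snd has_derivative_ident)+
  next
    fix b :: "real \<times> real" assume "b \<in> Basis"
    have "Ck k (\<lambda>z. snd b * (\<alpha> (fst z) * deriv \<beta> (snd z)) + fst b * (deriv \<alpha> (fst z) * \<beta> (snd z)))"
      by (intro Ck_add Ck_cmult Suc.IH Suc.prems smooth_deriv)
    then show "Ck k (\<lambda>x. \<alpha> (fst x) * (deriv \<beta> (snd x) * snd b) + deriv \<alpha> (fst x) * fst b * \<beta> (snd x))"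
      by (simp add: mult_ac)
  qed
qed

lemma test_functions_tensor:
  assumes "smooth \<alpha>" "smooth \<beta>"
    and "a < a'" "b' < b" "\<And>x. \<not> (a' \<le> x \<and> x \<le> b') \<Longrightarrow> \<alpha> x = 0"
    and "c < c'" "d' < d" "\<And>x. \<not> (c' \<le> x \<and> x \<le> d') \<Longrightarrow> \<beta> x = 0"
  shows "(\<lambda>z. \<alpha> (fst z) * \<beta> (snd z)) \<in> test_functions ({a<..<b} \<times> {c<..<d})"
proof (rule test_functionsI)
  show "Ck k (\<lambda>z. \<alpha> (fst z) * \<beta> (snd z))" for k by (rule Ck_tensor[OF assms(1,2)])
  show "compact ({a'..b'} \<times> {c'..d'})" by (intro compact_Times compact_Icc)
  show "{a'..b'} \<times> {c'..d'} \<subseteq> {a<..<b} \<times> {c<..<d}" using assms by auto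
  show "\<alpha> (fst z) * \<beta> (snd z) = 0" if "z \<notin> {a'..b'} \<times> {c'..d'}" for z
    using that assms(5)[of "fst z"] assms(8)[of "snd z"] by (cases z) auto
qed

section \<open>Weak gradients of piecewise differentiable functions\<close>

definition pw_diff :: "real \<Rightarrow> real \<Rightarrow> (real \<Rightarrow> real) \<Rightarrow> (real \<Rightarrow> real) \<Rightarrow> bool" where
  "pw_diff a b g g' \<longleftrightarrow> continuous_on {a..b} g \<and>
     (\<exists>S. finite S \<and> (\<forall>x\<in>{a<..<b} - S. (g has_real_derivative g' x) (at x)))"

text \<open>Regularity is required along horizontal and vertical lines only, which is what Fubini
  and partial integration see. The common bound gives integrability of every product with a test
  function.\<close>

definition pw_gradient ::
    "real \<Rightarrow> real \<Rightarrow> real \<Rightarrow> real \<Rightarrow> (real \<times> real \<Rightarrow> real) \<Rightarrow> (real \<times> real \<Rightarrow> real \<times> real) \<Rightarrow> bool" where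
  "pw_gradient a b c d v w \<longleftrightarrow> v \<in> borel_measurable borel \<and> w \<in> borel_measurable borel \<and>
     (\<exists>C. \<forall>z\<in>{a<..<b} \<times> {c<..<d}. \<bar>v z\<bar> \<le> C \<and> norm (w z) \<le> C) \<and>
     (\<forall>y\<in>{c<..<d}. pw_diff a b (\<lambda>x. v (x, y)) (\<lambda>x. fst (w (x, y)))) \<and>
     (\<forall>x\<in>{a<..<b}. pw_diff c d (\<lambda>y. v (x, y)) (\<lambda>y. snd (w (x, y))))"

lemma pw_diff_by_parts:
  assumes "pw_diff a b g g'" "a \<le> b" "\<And>x. (h has_real_derivative h' x) (at x)" "h a = 0" "h b = 0"
  shows "((\<lambda>x. g x * h' x + h x * g' x) has_integral 0) {a..b}"
proof -
  obtain S where S: "finite S" "\<And>x. x \<in> {a<..<b} - S \<Longrightarrow> (g has_real_derivative g' x) (at x)"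
    and g: "continuous_on {a..b} g"
    using assms(1) by (auto simp: pw_diff_def)
  have "((\<lambda>x. g x * h' x + h x * g' x) has_integral (g b * h b - g a * h a)) {a..b}"
  proof (rule fundamental_theorem_of_calculus_interior_strong[OF S(1) assms(2)])
    show "((\<lambda>x. g x * h x) has_vector_derivative g x * h' x + h x * g' x) (at x)" if "x \<in> {a<..<b} - S" for x
      using DERIV_mult[OF S(2)[OF that] assms(3)[of x]]
      by (simp add: has_real_derivative_iff_has_vector_derivative add.commute mult.commute)
    show "continuous_on {a..b} (\<lambda>x. g x * h x)"
      by (intro continuous_on_mult g DERIV_continuous_on[of _ h h'] has_field_derivative_at_within[OF assms(3)])
  qed
  then show ?thesis using assms(4,5) by simp
qed

lemma rectangle_measurable: "{a<..<b} \<times> {c<..<d} \<in> lmeasurable" for a b c d :: real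
  by (intro lmeasurable_open bounded_Times open_Times) auto

lemma Ck_bounded_rectangle:
  fixes \<phi> :: "real \<times> real \<Rightarrow> real"
  assumes "Ck k \<phi>"
  obtains C where "\<And>z. z \<in> {a<..<b} \<times> {c<..<d} \<Longrightarrow> \<bar>\<phi> z\<bar> \<le> C"
proof -
  have "bounded (\<phi> ` ({a..b} \<times> {c..d}))"
    using assms by (intro compact_imp_bounded compact_continuous_image Ck_continuous compact_Times compact_Icc)
  then obtain C where "\<forall>x\<in>\<phi> ` ({a..b} \<times> {c..d}). norm x \<le> C" unfolding bounded_iff by blast
  then have "\<bar>\<phi> z\<bar> \<le> C" if "z \<in> {a<..<b} \<times> {c<..<d}" for z using that by force
  then show ?thesis using that by blast
qed

lemma integral_pair:
  fixes f g :: "'a \<Rightarrow> real"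
  assumes "integrable M f" "integrable M g"
  shows "integral\<^sup>L M (\<lambda>x. (f x, g x)) = (integral\<^sup>L M f, integral\<^sup>L M g)"
proof -
  have int: "integrable M (\<lambda>x. (f x, g x))"
  proof (rule Bochner_Integration.integrable_bound[OF Bochner_Integration.integrable_add[OF
          integrable_norm[OF assms(1)] integrable_norm[OF assms(2)]]])
    show "(\<lambda>x. (f x, g x)) \<in> borel_measurable M"
      using assms by (auto intro: borel_measurable_Pair)
    show "AE x in M. norm (f x, g x) \<le> norm (norm (f x) + norm (g x))"
    proof (rule AE_I2)
      show "norm (f x, g x) \<le> norm (norm (f x) + norm (g x))" for x
        using norm_Pair_le[of "f x" "g x"] by simp
    qed
  qed
  show ?thesis
    using integral_bounded_linear[OF bounded_linear_fst int] integral_bounded_linear[OF bounded_linear_snd int]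
    by (simp add: prod_eq_iff)
qed

text \<open>Fubini reduces the claim to partial integration on single lines. The test function
  removes the boundary terms, and continuity of \<open>v\<close> along the line excludes jump terms
  at the kinks.\<close>

lemma pw_gradient_weak:
  assumes w: "pw_gradient a b c d v w" and ab: "a \<le> b" "c \<le> d"
  shows "v \<in> L2 ({a<..<b} \<times> {c<..<d})" "w \<in> L2 ({a<..<b} \<times> {c<..<d})"
    "has_weak_gradient ({a<..<b} \<times> {c<..<d}) v w"
proof -
  let ?R = "{a<..<b} \<times> {c<..<d}"
  obtain C where C: "\<And>z. z \<in> ?R \<Longrightarrow> \<bar>v z\<bar> \<le> C" "\<And>z. z \<in> ?R \<Longrightarrow> norm (w z) \<le> C"
    using w unfolding pw_gradient_def by blast
  have vm: "v \<in> borel_measurable borel" and wm: "w \<in> borel_measurable borel"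
    using w by (auto simp: pw_gradient_def)
  have wm1: "(\<lambda>z. fst (w z)) \<in> borel_measurable borel" "(\<lambda>z. snd (w z)) \<in> borel_measurable borel"
    using wm by (auto simp: borel_prod[symmetric])
  have C1: "\<bar>fst (w z)\<bar> \<le> C" "\<bar>snd (w z)\<bar> \<le> C" if "z \<in> ?R" for z
    using C(2)[OF that] norm_fst_le[of "fst (w z)" "snd (w z)"] norm_snd_le[of "snd (w z)" "fst (w z)"] by auto
  show "v \<in> L2 ?R"
    by (rule L2_bounded[OF borel_imp_lebesgue_on[OF vm] rectangle_measurable, where C = C]) (simp add: C(1))
  show "w \<in> L2 ?R"
    by (rule L2_bounded[OF borel_imp_lebesgue_on[OF wm] rectangle_measurable C(2)])
  show "has_weak_gradient ?R v w"
    unfolding has_weak_gradient_def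
  proof
    fix \<phi> assume \<phi>: "\<phi> \<in> test_functions ?R"
    have Ck: "\<forall>k. Ck k \<phi>" using test_functions_Ck[OF \<phi>] by blast
    have Ck1: "Ck 0 (pd1 \<phi>)" "Ck 0 (pd2 \<phi>)" using Ck Ck_pd[of 0 \<phi>] by blast+
    obtain K where K: "\<And>z. z \<in> ?R \<Longrightarrow> \<bar>\<phi> z\<bar> \<le> K"
      using Ck_bounded_rectangle[of 0 \<phi>] Ck by blast
    obtain K1 where K1: "\<And>z. z \<in> ?R \<Longrightarrow> \<bar>pd1 \<phi> z\<bar> \<le> K1"
      using Ck_bounded_rectangle[OF Ck1(1)] by blast
    obtain K2 where K2: "\<And>z. z \<in> ?R \<Longrightarrow> \<bar>pd2 \<phi> z\<bar> \<le> K2"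
      using Ck_bounded_rectangle[OF Ck1(2)] by blast
    have meas: "\<phi> \<in> borel_measurable borel" "pd1 \<phi> \<in> borel_measurable borel" "pd2 \<phi> \<in> borel_measurable borel"
      using Ck Ck1 Ck_borel by blast+
    have prod: "integrable (lebesgue_on ?R) (\<lambda>z. f z * g z)"
      if fg: "f \<in> borel_measurable borel" "g \<in> borel_measurable borel"
        "\<And>z. z \<in> ?R \<Longrightarrow> \<bar>f z\<bar> \<le> B" "\<And>z. z \<in> ?R \<Longrightarrow> \<bar>g z\<bar> \<le> B'" for f g :: "real \<times> real \<Rightarrow> real" and B B' :: real
    proof -
      have m: "(\<lambda>z. f z * g z) \<in> borel_measurable borel" using fg(1,2) by measurable
      have "norm (f z * g z) \<le> \<bar>B\<bar> * \<bar>B'\<bar>" if z: "z \<in> ?R" for z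
        using fg(3)[OF z] fg(4)[OF z] unfolding real_norm_def abs_mult by (intro mult_mono) auto
      then show ?thesis by (rule bounded_integrable_on[OF borel_imp_lebesgue_on[OF m] rectangle_measurable])
    qed
    note int = prod[OF vm meas(2) C(1) K1] prod[OF vm meas(3) C(1) K2]
      prod[OF meas(1) wm1(1) K C1(1)] prod[OF meas(1) wm1(2) K C1(2)]
    have bnd: "\<bar>f * g + h * k\<bar> \<le> \<bar>B1\<bar> * \<bar>B2\<bar> + \<bar>B3\<bar> * \<bar>B4\<bar>"
      if "\<bar>f\<bar> \<le> B1" "\<bar>g\<bar> \<le> B2" "\<bar>h\<bar> \<le> B3" "\<bar>k\<bar> \<le> B4" for f g h k B1 B2 B3 B4 :: real
    proof (rule order.trans[OF abs_triangle_ineq])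
      show "\<bar>f * g\<bar> + \<bar>h * k\<bar> \<le> \<bar>B1\<bar> * \<bar>B2\<bar> + \<bar>B3\<bar> * \<bar>B4\<bar>"
        using that unfolding abs_mult by (intro add_mono mult_mono) auto
    qed
    have zero: "((\<lambda>x. 0) has_integral (0::real)) S" for S :: "real set" by simp
    have out: "\<phi> z = 0" if "z \<notin> ?R" for z using test_functions_outside[OF \<phi> that] .
    have "(LINT z|lebesgue_on ?R. v z * pd1 \<phi> z + \<phi> z * fst (w z))
        = (LINT y|lebesgue_on {c<..<d}. LINT x|lebesgue_on {a<..<b}. v (x, y) * pd1 \<phi> (x, y) + \<phi> (x, y) * fst (w (x, y)))"
    proof (rule rectangle_Fubini(1))
      show "(\<lambda>z. v z * pd1 \<phi> z + \<phi> z * fst (w z)) \<in> borel_measurable borel"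
        using vm meas wm1 by measurable
      show "\<bar>v (x, y) * pd1 \<phi> (x, y) + \<phi> (x, y) * fst (w (x, y))\<bar> \<le> \<bar>C\<bar> * \<bar>K1\<bar> + \<bar>K\<bar> * \<bar>C\<bar>"
        if "x \<in> {a<..<b}" "y \<in> {c<..<d}" for x y
        using that by (intro bnd C K1 K C1) auto
    qed
    also have "\<dots> = (LINT y|lebesgue_on {c<..<d}. 0)"
    proof (rule Bochner_Integration.integral_cong[OF refl])
      fix y assume y: "y \<in> space (lebesgue_on {c<..<d})"
      have m: "(\<lambda>x. v (x, y) * pd1 \<phi> (x, y) + \<phi> (x, y) * fst (w (x, y))) \<in> borel_measurable borel"
        using vm meas wm1 unfolding borel_prod[symmetric] by measurable
      have "((\<lambda>x. v (x, y) * pd1 \<phi> (x, y) + \<phi> (x, y) * fst (w (x, y))) has_integral 0) {a..b}"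
      proof (rule pw_diff_by_parts)
        show "pw_diff a b (\<lambda>x. v (x, y)) (\<lambda>x. fst (w (x, y)))"
          using w y by (auto simp: pw_gradient_def)
      qed (use ab pd1_deriv[OF Ck] out in auto)
      then show "(LINT x|lebesgue_on {a<..<b}. v (x, y) * pd1 \<phi> (x, y) + \<phi> (x, y) * fst (w (x, y))) = 0"
      proof (rule integral_interval_has_integral[OF m, rotated])
        show "\<bar>v (x, y) * pd1 \<phi> (x, y) + \<phi> (x, y) * fst (w (x, y))\<bar> \<le> \<bar>C\<bar> * \<bar>K1\<bar> + \<bar>K\<bar> * \<bar>C\<bar>"
          if "x \<in> {a<..<b}" for x
          using that y by (intro bnd C K1 K C1) auto
      qed
    qed
    finally have 1: "(LINT z|lebesgue_on ?R. v z * pd1 \<phi> z) = - (LINT z|lebesgue_on ?R. \<phi> z * fst (w z))"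
      using int by simp
    have "(LINT z|lebesgue_on ?R. v z * pd2 \<phi> z + \<phi> z * snd (w z))
        = (LINT x|lebesgue_on {a<..<b}. LINT y|lebesgue_on {c<..<d}. v (x, y) * pd2 \<phi> (x, y) + \<phi> (x, y) * snd (w (x, y)))"
    proof (rule rectangle_Fubini(2))
      show "(\<lambda>z. v z * pd2 \<phi> z + \<phi> z * snd (w z)) \<in> borel_measurable borel"
        using vm meas wm1 by measurable
      show "\<bar>v (x, y) * pd2 \<phi> (x, y) + \<phi> (x, y) * snd (w (x, y))\<bar> \<le> \<bar>C\<bar> * \<bar>K2\<bar> + \<bar>K\<bar> * \<bar>C\<bar>"
        if "x \<in> {a<..<b}" "y \<in> {c<..<d}" for x y
        using that by (intro bnd C K2 K C1) auto
    qed
    also have "\<dots> = (LINT x|lebesgue_on {a<..<b}. 0)"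
    proof (rule Bochner_Integration.integral_cong[OF refl])
      fix x assume x: "x \<in> space (lebesgue_on {a<..<b})"
      have m: "(\<lambda>y. v (x, y) * pd2 \<phi> (x, y) + \<phi> (x, y) * snd (w (x, y))) \<in> borel_measurable borel"
        using vm meas wm1 unfolding borel_prod[symmetric] by measurable
      have "((\<lambda>y. v (x, y) * pd2 \<phi> (x, y) + \<phi> (x, y) * snd (w (x, y))) has_integral 0) {c..d}"
      proof (rule pw_diff_by_parts)
        show "pw_diff c d (\<lambda>y. v (x, y)) (\<lambda>y. snd (w (x, y)))"
          using w x by (auto simp: pw_gradient_def)
      qed (use ab pd2_deriv[OF Ck] out in auto)
      then show "(LINT y|lebesgue_on {c<..<d}. v (x, y) * pd2 \<phi> (x, y) + \<phi> (x, y) * snd (w (x, y))) = 0"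
      proof (rule integral_interval_has_integral[OF m, rotated])
        show "\<bar>v (x, y) * pd2 \<phi> (x, y) + \<phi> (x, y) * snd (w (x, y))\<bar> \<le> \<bar>C\<bar> * \<bar>K2\<bar> + \<bar>K\<bar> * \<bar>C\<bar>"
          if "y \<in> {c<..<d}" for y
          using that x by (intro bnd C K2 K C1) auto
      qed
    qed
    finally have 2: "(LINT z|lebesgue_on ?R. v z * pd2 \<phi> z) = - (LINT z|lebesgue_on ?R. \<phi> z * snd (w z))"
      using int by simp
    have "(LINT z|lebesgue_on ?R. v z *\<^sub>R gradient \<phi> z)
        = (LINT z|lebesgue_on ?R. (v z * pd1 \<phi> z, v z * pd2 \<phi> z))"
      by (simp add: gradient_plane)
    also have "\<dots> = - (LINT z|lebesgue_on ?R. (\<phi> z * fst (w z), \<phi> z * snd (w z)))"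
      using 1 2 int by (simp add: integral_pair)
    also have "(\<lambda>z. (\<phi> z * fst (w z), \<phi> z * snd (w z))) = (\<lambda>z. \<phi> z *\<^sub>R w z)"
      by (simp add: fun_eq_iff prod_eq_iff)
    finally show "(LINT z|lebesgue_on ?R. v z *\<^sub>R gradient \<phi> z) = - (LINT z|lebesgue_on ?R. \<phi> z *\<^sub>R w z)" .
  qed
qed

lemma pw_gradient_test_function:
  assumes \<phi>: "\<And>k. Ck k \<phi>"
  shows "pw_gradient a b c d \<phi> (gradient \<phi>)"
proof -
  have g: "gradient \<phi> = (\<lambda>z. (pd1 \<phi> z, pd2 \<phi> z))" by (simp add: fun_eq_iff gradient_plane)
  have Ck1: "Ck 0 (pd1 \<phi>)" "Ck 0 (pd2 \<phi>)" using \<phi> Ck_pd[of 0 \<phi>] by blast+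
  obtain K where K: "\<And>z. z \<in> {a<..<b} \<times> {c<..<d} \<Longrightarrow> \<bar>\<phi> z\<bar> \<le> K"
    using Ck_bounded_rectangle[OF \<phi>] by blast
  obtain K1 where K1: "\<And>z. z \<in> {a<..<b} \<times> {c<..<d} \<Longrightarrow> \<bar>pd1 \<phi> z\<bar> \<le> K1"
    using Ck_bounded_rectangle[OF Ck1(1)] by blast
  obtain K2 where K2: "\<And>z. z \<in> {a<..<b} \<times> {c<..<d} \<Longrightarrow> \<bar>pd2 \<phi> z\<bar> \<le> K2"
    using Ck_bounded_rectangle[OF Ck1(2)] by blast
  have "\<bar>\<phi> z\<bar> \<le> \<bar>K\<bar> + (\<bar>K1\<bar> + \<bar>K2\<bar>) \<and> norm (gradient \<phi> z) \<le> \<bar>K\<bar> + (\<bar>K1\<bar> + \<bar>K2\<bar>)"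
    if "z \<in> {a<..<b} \<times> {c<..<d}" for z
    using K[OF that] K1[OF that] K2[OF that] norm_Pair_le[of "pd1 \<phi> z" "pd2 \<phi> z"] by (auto simp: g)
  moreover have "pw_diff a b (\<lambda>x. \<phi> (x, y)) (\<lambda>x. pd1 \<phi> (x, y))" for y
    unfolding pw_diff_def using pd1_deriv \<phi>
    by (auto intro!: exI[of _ "{}"] DERIV_continuous_on intro: has_field_derivative_at_within)
  moreover have "pw_diff c d (\<lambda>y. \<phi> (x, y)) (\<lambda>y. pd2 \<phi> (x, y))" for x
    unfolding pw_diff_def using pd2_deriv \<phi>
    by (auto intro!: exI[of _ "{}"] DERIV_continuous_on intro: has_field_derivative_at_within)
  ultimately show ?thesis
    unfolding pw_gradient_def g using Ck_borel[OF \<phi>] Ck_borel[OF Ck1(1)] Ck_borel[OF Ck1(2)]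
    by (auto intro: borel_measurable_Pair)
qed

section \<open>Uniqueness of weak gradients\<close>

lemma test_functions_mono: "\<phi> \<in> test_functions S \<Longrightarrow> S \<subseteq> T \<Longrightarrow> \<phi> \<in> test_functions T"
  by (auto simp: test_functions_def)

lemma test_functions_bump:
  assumes "n > 0"
  shows "(\<lambda>z. bump n a b (fst z) * bump n c d (snd z)) \<in> test_functions ({a<..<b} \<times> {c<..<d})"
proof (rule test_functions_tensor)
  show "a < a + 1 / real n" "b - 1 / real n < b" "c < c + 1 / real n" "d - 1 / real n < d"
    using assms by auto
  show "bump n a b x = 0" if "\<not> (a + 1 / real n \<le> x \<and> x \<le> b - 1 / real n)" for x
    using that bump_nonzeroD[of n a b x] by force
  show "bump n c d x = 0" if "\<not> (c + 1 / real n \<le> x \<and> x \<le> d - 1 / real n)" for x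
    using that bump_nonzeroD[of n c d x] by force
qed (rule smooth_bump)+

lemma box_plane: "box (a, c) (b, d) = {a<..<b} \<times> {c<..<d}" for a b c d :: real
  by (auto simp: box_def Basis_plane)

text \<open>Products of bumps converge boundedly to indicators of boxes, so \<open>g\<close> has
  integral zero over every closed box inside \<open>R\<close>. Lebesgue differentiation over
  shrinking boxes then gives \<open>g = 0\<close> almost everywhere.\<close>

lemma fundamental_lemma:
  fixes g :: "real \<times> real \<Rightarrow> real"
  assumes g: "integrable (lebesgue_on R) g" and R: "open R"
    and zero: "\<And>\<phi>. \<phi> \<in> test_functions R \<Longrightarrow> (LINT z|lebesgue_on R. \<phi> z * g z) = 0"
  shows "AE z in lebesgue_on R. g z = 0"
proof -
  have Rs: "R \<in> sets lebesgue" using R by auto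
  have box: "(g has_integral 0) (cbox (a, c) (b, d))" if sub: "cbox (a, c) (b, d) \<subseteq> R" for a b c d
  proof -
    define s where "s n z = bump (Suc n) a b (fst z) * bump (Suc n) c d (snd z)" for n and z :: "real \<times> real"
    define f where "f z = (if z \<in> box (a, c) (b, d) then g z else 0)" for z
    have boxR: "box (a, c) (b, d) \<subseteq> R" using sub box_subset_cbox by blast
    have st: "s n \<in> test_functions R" for n
      unfolding s_def
      by (rule test_functions_mono[OF test_functions_bump]) (use boxR in \<open>auto simp: box_plane\<close>)
    have sm: "s n \<in> borel_measurable (lebesgue_on R)" for n
      by (intro borel_imp_lebesgue_on Ck_borel[OF test_functions_Ck[OF st]])
    have gm: "g \<in> borel_measurable (lebesgue_on R)" using g by auto
    have lim: "(\<lambda>n. s n z * g z) \<longlonglongrightarrow> f z" for z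
    proof -
      have "(\<lambda>n. s n z) \<longlonglongrightarrow> indicator {a<..<b} (fst z) * indicator {c<..<d} (snd z)"
        unfolding s_def by (intro tendsto_mult LIMSEQ_Suc[OF bump_tendsto])
      then have "(\<lambda>n. s n z * g z) \<longlonglongrightarrow> indicator {a<..<b} (fst z) * indicator {c<..<d} (snd z) * g z"
        by (intro tendsto_mult tendsto_const)
      moreover have "indicator {a<..<b} (fst z) * indicator {c<..<d} (snd z) * g z = f z"
        by (cases z) (auto simp: f_def box_plane indicator_def)
      ultimately show ?thesis by simp
    qed
    have fm: "f \<in> borel_measurable (lebesgue_on R)"
      by (rule borel_measurable_LIMSEQ_real[OF lim]) (use sm gm in measurable)
    have bd: "norm (s n z * g z) \<le> norm (g z)" for n z
    proof -
      have "\<bar>s n z\<bar> \<le> 1"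
        unfolding s_def using bump_nonneg bump_le_1 by (simp add: abs_mult mult_le_one)
      then show ?thesis by (simp add: abs_mult mult_left_le_one_le)
    qed
    have dom: "integrable (lebesgue_on R) f" "(\<lambda>n. LINT z|lebesgue_on R. s n z * g z) \<longlonglongrightarrow> (LINT z|lebesgue_on R. f z)"
      using integral_dominated_convergence[of f "lebesgue_on R" "\<lambda>n z. s n z * g z" "\<lambda>z. norm (g z)"]
        integrable_dominated_convergence[of f "lebesgue_on R" "\<lambda>n z. s n z * g z" "\<lambda>z. norm (g z)"]
        fm sm gm g lim bd by auto
    have "(LINT z|lebesgue_on R. f z) = 0"
      using LIMSEQ_unique[OF dom(2)] zero[OF st] by simp
    then have "(f has_integral 0) R"
      using has_integral_integral_lebesgue_on[OF dom(1) Rs] by simp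
    then have "(g has_integral 0) (box (a, c) (b, d))"
      unfolding f_def has_integral_restrict[OF boxR] .
    then show ?thesis by (simp add: has_integral_open_interval)
  qed
  \<comment> \<open>The differentiation theorem asks for integrability over every box, including
    those that leave \<open>R\<close>. The zero extension provides it and agrees with
    \<open>g\<close> on small boxes at points of \<open>R\<close>.\<close>
  define G where "G z = (if z \<in> R then g z else 0)" for z
  have Gint: "G integrable_on cbox x y" for x y
  proof -
    have "G absolutely_integrable_on UNIV"
      unfolding absolutely_integrable_restrict_UNIV G_def
      using g Rs by (simp add: integrable_restrict_space set_integrable_def)
    then have "G integrable_on UNIV" using absolutely_integrable_on_def by blast
    then show ?thesis by (rule integrable_on_subcbox) auto
  qed
  obtain N where N: "negligible N" and Nd: "\<And>x e. \<lbrakk>x \<notin> N; 0 < e\<rbrakk> \<Longrightarrow>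
      \<exists>d>0. \<forall>h. 0 < h \<and> h < d \<longrightarrow>
        norm (integral (cbox x (x + h *\<^sub>R One)) G /\<^sub>R h ^ DIM(real \<times> real) - G x) < e"
    using integrable_ccontinuous_explicit[OF Gint] by blast
  have z0: "g x = 0" if xR: "x \<in> R" and xN: "x \<notin> N" for x
  proof (rule ccontr)
    assume "g x \<noteq> 0"
    then obtain d where d: "d > 0" "\<And>h. 0 < h \<and> h < d \<Longrightarrow>
        norm (integral (cbox x (x + h *\<^sub>R One)) G /\<^sub>R h ^ DIM(real \<times> real) - G x) < \<bar>g x\<bar>"
      using Nd[OF xN, of "\<bar>g x\<bar>"] by auto
    obtain e where e: "e > 0" "cball x e \<subseteq> R"
      using R xR open_contains_cball by blast
    define h where "h = min (d / 2) (e / 4)"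
    have h: "0 < h" "h < d" "h \<le> e / 4" using d e by (auto simp: h_def)
    have One: "(One :: real \<times> real) = (1, 1)" by (simp add: Basis_plane)
    have cb: "cbox x (x + h *\<^sub>R One) \<subseteq> cball x e"
    proof
      fix y assume "y \<in> cbox x (x + h *\<^sub>R One)"
      then have "fst x \<le> fst y" "fst y \<le> fst x + h" "snd x \<le> snd y" "snd y \<le> snd x + h"
        unfolding One by (auto simp: mem_box Basis_plane inner_prod_def)
      then have "\<bar>fst (y - x)\<bar> \<le> h" "\<bar>snd (y - x)\<bar> \<le> h" by auto
      moreover have "norm (y - x) \<le> \<bar>fst (y - x)\<bar> + \<bar>snd (y - x)\<bar>"
        using norm_Pair_le[of "fst (y - x)" "snd (y - x)"] unfolding prod.collapse by simp
      ultimately have "norm (y - x) \<le> e" using h by linarith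
      then show "y \<in> cball x e" by (simp add: dist_norm norm_minus_commute)
    qed
    then have sub: "cbox x (x + h *\<^sub>R One) \<subseteq> R" using e by blast
    have "x + h *\<^sub>R One = (fst x + h, snd x + h)" unfolding One by (simp add: prod_eq_iff)
    then have "(g has_integral 0) (cbox x (x + h *\<^sub>R One))"
      using box[of "fst x" "snd x" "fst x + h" "snd x + h"] sub by simp
    then have "(G has_integral 0) (cbox x (x + h *\<^sub>R One))"
      by (rule has_integral_eq[rotated]) (use sub in \<open>auto simp: G_def\<close>)
    then have "integral (cbox x (x + h *\<^sub>R One)) G = 0" by (rule integral_unique)
    then show False using d(2)[of h] h xR by (simp add: G_def)
  qed
  have "AE z in lebesgue. z \<notin> N"
    using N by (intro AE_not_in) (simp add: negligible_iff_null_sets)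
  then have "AE z in lebesgue. z \<in> R \<longrightarrow> g z = 0"
    by eventually_elim (use z0 in blast)
  then show ?thesis using Rs by (simp add: AE_restrict_space_iff)
qed

lemma L2_scaleR_integrable:
  fixes f :: "'a::euclidean_space \<Rightarrow> real" and g :: "'a \<Rightarrow> 'b::euclidean_space"
  assumes f: "f \<in> L2 S" and g: "g \<in> L2 S"
  shows "integrable (lebesgue_on S) (\<lambda>x. f x *\<^sub>R g x)"
proof (rule Bochner_Integration.integrable_bound)
  show "integrable (lebesgue_on S) (\<lambda>x. (norm (f x))\<^sup>2 + (norm (g x))\<^sup>2)"
    using f g by (auto simp: L2_def)
  show "(\<lambda>x. f x *\<^sub>R g x) \<in> borel_measurable (lebesgue_on S)"
    using L2_measurable[OF f] L2_measurable[OF g] by measurable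
  have "norm (f x *\<^sub>R g x) \<le> norm ((norm (f x))\<^sup>2 + (norm (g x))\<^sup>2)" for x
  proof -
    have "2 * (norm (f x) * norm (g x)) \<le> (norm (f x))\<^sup>2 + (norm (g x))\<^sup>2"
      using sum_squares_bound[of "norm (f x)" "norm (g x)"] by simp
    moreover have "0 \<le> norm (f x) * norm (g x)" by simp
    ultimately have "norm (f x) * norm (g x) \<le> (norm (f x))\<^sup>2 + (norm (g x))\<^sup>2" by linarith
    then show ?thesis by simp
  qed
  then show "AE x in lebesgue_on S. norm (f x *\<^sub>R g x) \<le> norm ((norm (f x))\<^sup>2 + (norm (g x))\<^sup>2)"
    by auto
qed

section \<open>Weak gradients and Sobolev forms on a rectangle\<close>

locale rectangle =
  fixes a b c d :: real
  assumes ab: "a < b" and cd: "c < d"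
begin

abbreviation R :: "(real \<times> real) set" where "R \<equiv> {a<..<b} \<times> {c<..<d}"

lemma R_open: "open R" by (intro open_Times) auto
lemma R_sets: "R \<in> sets lebesgue" using R_open by auto
lemma R_lmeasurable: "R \<in> lmeasurable" by (rule rectangle_measurable)

lemma test_function_L2:
  assumes "\<phi> \<in> test_functions R"
  shows "\<phi> \<in> L2 R" "gradient \<phi> \<in> L2 R" "has_weak_gradient R \<phi> (gradient \<phi>)"
  using pw_gradient_weak[OF pw_gradient_test_function[OF test_functions_Ck[OF assms]]] ab cd by auto

text \<open>The difference of two weak gradients annihilates all test functions. The fundamental
  lemma is scalar and is applied to each component.\<close>

lemma weak_gradient_unique:
  assumes g: "g \<in> L2 R" "has_weak_gradient R v g" and h: "h \<in> L2 R" "has_weak_gradient R v h"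
  shows "AE z in lebesgue_on R. g z = h z"
proof -
  have gh: "(\<lambda>z. g z - h z) \<in> L2 R" by (rule L2_diff[OF g(1) h(1)])
  have int: "integrable (lebesgue_on R) (\<lambda>z. g z - h z)" by (rule L2_integrable[OF gh R_lmeasurable])
  have zero: "(LINT z|lebesgue_on R. \<phi> z *\<^sub>R (g z - h z)) = 0" if \<phi>: "\<phi> \<in> test_functions R" for \<phi>
  proof -
    note int = L2_scaleR_integrable[OF test_function_L2(1)[OF \<phi>] g(1)]
      L2_scaleR_integrable[OF test_function_L2(1)[OF \<phi>] h(1)]
    have "(LINT z|lebesgue_on R. \<phi> z *\<^sub>R g z) = (LINT z|lebesgue_on R. \<phi> z *\<^sub>R h z)"
      using bspec[OF g(2)[unfolded has_weak_gradient_def] \<phi>] bspec[OF h(2)[unfolded has_weak_gradient_def] \<phi>]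
      by simp
    then show ?thesis
      unfolding scaleR_diff_right using Bochner_Integration.integral_diff[OF int] by simp
  qed
  have "AE z in lebesgue_on R. fst (g z - h z) = 0"
  proof (rule fundamental_lemma[OF integrable_bounded_linear[OF bounded_linear_fst int] R_open])
    fix \<phi> assume \<phi>: "\<phi> \<in> test_functions R"
    show "(LINT z|lebesgue_on R. \<phi> z * fst (g z - h z)) = 0"
      using integral_bounded_linear[OF bounded_linear_fst L2_scaleR_integrable[OF test_function_L2(1)[OF \<phi>] gh]] zero[OF \<phi>]
      by simp
  qed
  moreover have "AE z in lebesgue_on R. snd (g z - h z) = 0"
  proof (rule fundamental_lemma[OF integrable_bounded_linear[OF bounded_linear_snd int] R_open])
    fix \<phi> assume \<phi>: "\<phi> \<in> test_functions R"
    show "(LINT z|lebesgue_on R. \<phi> z * snd (g z - h z)) = 0"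
      using integral_bounded_linear[OF bounded_linear_snd L2_scaleR_integrable[OF test_function_L2(1)[OF \<phi>] gh]] zero[OF \<phi>]
      by simp
  qed
  ultimately show ?thesis by eventually_elim (simp add: prod_eq_iff)
qed

text \<open>This is how the arbitrary choice in \<open>weak_gradient\<close> becomes computable:
  exhibiting any weak gradient determines the chosen one almost everywhere.\<close>

lemma weak_gradient_AE:
  assumes "w \<in> L2 R" "has_weak_gradient R v w"
  shows "weak_gradient R v \<in> L2 R" "has_weak_gradient R v (weak_gradient R v)"
    "AE z in lebesgue_on R. weak_gradient R v z = w z"
proof -
  have "weak_gradient R v \<in> L2 R \<and> has_weak_gradient R v (weak_gradient R v)"
    unfolding weak_gradient_def by (rule someI[of _ w]) (use assms in simp)
  then show "weak_gradient R v \<in> L2 R" "has_weak_gradient R v (weak_gradient R v)"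
    "AE z in lebesgue_on R. weak_gradient R v z = w z"
    using weak_gradient_unique assms by auto
qed

lemma H1_I: "v \<in> L2 R \<Longrightarrow> w \<in> L2 R \<Longrightarrow> has_weak_gradient R v w \<Longrightarrow> v \<in> H1 R"
  by (auto simp: H1_def)

lemma H1_D:
  assumes "v \<in> H1 R"
  shows "v \<in> L2 R" "weak_gradient R v \<in> L2 R" "has_weak_gradient R v (weak_gradient R v)"
  using assms weak_gradient_AE by (auto simp: H1_def)

lemma has_weak_gradient_add:
  assumes v: "v \<in> L2 R" "g \<in> L2 R" "has_weak_gradient R v g" and w: "w \<in> L2 R" "h \<in> L2 R" "has_weak_gradient R w h"
  shows "has_weak_gradient R (\<lambda>z. v z + w z) (\<lambda>z. g z + h z)"
  unfolding has_weak_gradient_def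
proof
  fix \<phi> assume \<phi>: "\<phi> \<in> test_functions R"
  note t = test_function_L2[OF \<phi>]
  show "(LINT z|lebesgue_on R. (v z + w z) *\<^sub>R gradient \<phi> z) = - (LINT z|lebesgue_on R. \<phi> z *\<^sub>R (g z + h z))"
    using v(3) w(3) \<phi> L2_scaleR_integrable[OF v(1) t(2)] L2_scaleR_integrable[OF w(1) t(2)]
      L2_scaleR_integrable[OF t(1) v(2)] L2_scaleR_integrable[OF t(1) w(2)]
    by (simp add: has_weak_gradient_def scaleR_add_left scaleR_add_right)
qed

lemma has_weak_gradient_scale:
  assumes v: "has_weak_gradient R v g"
  shows "has_weak_gradient R (\<lambda>z. k * v z) (\<lambda>z. k *\<^sub>R g z)"
  unfolding has_weak_gradient_def
proof
  fix \<phi> assume \<phi>: "\<phi> \<in> test_functions R"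
  have "(LINT z|lebesgue_on R. (k * v z) *\<^sub>R gradient \<phi> z) = k *\<^sub>R (LINT z|lebesgue_on R. v z *\<^sub>R gradient \<phi> z)"
    by (simp flip: scaleR_scaleR)
  also have "\<dots> = - (k *\<^sub>R (LINT z|lebesgue_on R. \<phi> z *\<^sub>R g z))"
    using v \<phi> by (simp add: has_weak_gradient_def)
  also have "k *\<^sub>R (LINT z|lebesgue_on R. \<phi> z *\<^sub>R g z) = (LINT z|lebesgue_on R. k *\<^sub>R (\<phi> z *\<^sub>R g z))"
    by (rule integral_scaleR_right[symmetric])
  finally show "(LINT z|lebesgue_on R. (k * v z) *\<^sub>R gradient \<phi> z) = - (LINT z|lebesgue_on R. \<phi> z *\<^sub>R (k *\<^sub>R g z))"
    by (simp only: scaleR_left_commute[of k])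
qed

lemma H1_add:
  assumes "v \<in> H1 R" "w \<in> H1 R"
  shows "v + w \<in> H1 R"
    "AE z in lebesgue_on R. weak_gradient R (v + w) z = weak_gradient R v z + weak_gradient R w z"
proof -
  note v = H1_D[OF assms(1)] and w = H1_D[OF assms(2)]
  have vw: "v + w = (\<lambda>z. v z + w z)" by (simp add: plus_fun_def)
  note s = L2_add[OF v(2) w(2)] has_weak_gradient_add[OF v w]
  show "v + w \<in> H1 R" unfolding vw by (rule H1_I[OF L2_add[OF v(1) w(1)] s])
  show "AE z in lebesgue_on R. weak_gradient R (v + w) z = weak_gradient R v z + weak_gradient R w z"
    unfolding vw by (rule weak_gradient_AE(3)[OF s])
qed

lemma H1_scale:
  assumes "v \<in> H1 R"
  shows "k *\<^sub>R v \<in> H1 R"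
    "AE z in lebesgue_on R. weak_gradient R (k *\<^sub>R v) z = k *\<^sub>R weak_gradient R v z"
proof -
  note v = H1_D[OF assms]
  have kv: "k *\<^sub>R v = (\<lambda>z. k * v z)" by (simp add: scaleR_fun_def)
  note s = L2_scale[OF v(2)] has_weak_gradient_scale[OF v(3)]
  have "(\<lambda>z. k * v z) \<in> L2 R" using L2_scale[OF v(1), of k] by simp
  then show "k *\<^sub>R v \<in> H1 R" unfolding kv by (rule H1_I[OF _ s])
  show "AE z in lebesgue_on R. weak_gradient R (k *\<^sub>R v) z = k *\<^sub>R weak_gradient R v z"
    unfolding kv by (rule weak_gradient_AE(3)[OF s])
qed

lemma test_function_H1:
  assumes "\<phi> \<in> test_functions R"
  shows "\<phi> \<in> H1 R" "AE z in lebesgue_on R. weak_gradient R \<phi> z = gradient \<phi> z"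
  using test_function_L2[OF assms] H1_I weak_gradient_AE by blast+

lemma H1_subspace: "subspace (H1 R)"
proof (rule subspaceI)
  have "(0 :: real \<times> real \<Rightarrow> real) = (\<lambda>z. 0)" by (simp add: zero_fun_def)
  moreover have "(\<lambda>z::real \<times> real. 0 :: real) \<in> test_functions R"
    by (rule test_functionsI[of _ "{}"]) (auto intro: Ck_const)
  ultimately show "0 \<in> H1 R" using test_function_H1(1) by simp
qed (auto intro: H1_add H1_scale)

text \<open>As in \<open>energy_inner\<close>, the weak gradient is taken on the whole rectangle and
  only the integration is restricted to \<open>T\<close>. The chosen gradients are additive and
  homogeneous only almost everywhere, which is enough for the form to be bilinear.\<close>

definition grad_form :: "(real \<times> real) set \<Rightarrow> (real \<times> real \<Rightarrow> real) \<Rightarrow> (real \<times> real \<Rightarrow> real) \<Rightarrow> real" where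
  "grad_form T v w = L2_inner T (weak_gradient R v) (weak_gradient R w)"

lemma grad_form_psd:
  assumes T: "T \<subseteq> R" "T \<in> sets lebesgue"
  shows "psd_form (H1 R) (grad_form T)"
proof
  show "subspace (H1 R)" by (rule H1_subspace)
  fix v w z k assume v: "v \<in> H1 R" and w: "w \<in> H1 R" and z: "z \<in> H1 R"
  note sub = L2_subset[OF _ T R_sets]
  note AET = AE_lebesgue_on_subset[OF _ T(1) R_sets T(2)]
  have m: "f \<in> H1 R \<Longrightarrow> weak_gradient R f \<in> borel_measurable (lebesgue_on T)" for f
    by (rule L2_measurable[OF sub[OF H1_D(2)]])
  show "grad_form T v w = grad_form T w v" unfolding grad_form_def by (rule L2_inner_sym)
  show "0 \<le> grad_form T v v" unfolding grad_form_def by (rule L2_inner_nonneg)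
  have "grad_form T (v + w) z = L2_inner T (\<lambda>x. weak_gradient R v x + weak_gradient R w x) (weak_gradient R z)"
    unfolding grad_form_def
    by (rule L2_inner_cong_AE[OF AET[OF H1_add(2)[OF v w]]])
      (use m v w z H1_add(1)[OF v w] in \<open>auto intro!: borel_measurable_add\<close>)
  then show "grad_form T (v + w) z = grad_form T v z + grad_form T w z"
    unfolding grad_form_def using v w z by (simp add: L2_inner_add sub H1_D)
  have "grad_form T (k *\<^sub>R v) z = L2_inner T (\<lambda>x. k *\<^sub>R weak_gradient R v x) (weak_gradient R z)"
    unfolding grad_form_def
    by (rule L2_inner_cong_AE[OF AET[OF H1_scale(2)[OF v]]])
      (use m v z H1_scale(1)[OF v] in \<open>auto intro!: borel_measurable_scaleR\<close>)
  then show "grad_form T (k *\<^sub>R v) z = k * grad_form T v z"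
    unfolding grad_form_def by (simp add: L2_inner_scale)
qed

definition H1_form :: "(real \<times> real \<Rightarrow> real) \<Rightarrow> (real \<times> real \<Rightarrow> real) \<Rightarrow> real" where
  "H1_form v w = L2_inner R v w + grad_form R v w"

lemma H1_form_psd: "psd_form (H1 R) H1_form"
proof -
  interpret G: psd_form "H1 R" "grad_form R" by (rule grad_form_psd) (use R_sets in auto)
  show ?thesis
  proof
    show "subspace (H1 R)" by (rule H1_subspace)
    fix v w z k assume v: "v \<in> H1 R" and w: "w \<in> H1 R" and z: "z \<in> H1 R"
    show "H1_form v w = H1_form w v" unfolding H1_form_def using G.sym[OF v w] by (simp add: L2_inner_sym)
    show "0 \<le> H1_form v v" unfolding H1_form_def using G.psd[OF v] L2_inner_nonneg[of R v] by simp
    show "H1_form (v + w) z = H1_form v z + H1_form w z"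
      unfolding H1_form_def using G.add[OF v w z] L2_inner_add[of v R w z] v w z H1_D
      by (simp add: plus_fun_def)
    show "H1_form (k *\<^sub>R v) z = k * H1_form v z"
      unfolding H1_form_def using G.scale[OF v z] L2_inner_scale[of R k v z]
      by (simp add: scaleR_fun_def algebra_simps)
  qed
qed

sublocale H1: psd_form "H1 R" H1_form by (rule H1_form_psd)

lemma H1_norm_eq: "H1_norm R v = H1.nrm v"
  by (simp add: H1_norm_def H1.nrm_def H1_form_def grad_form_def)

lemma minus_fun_eq: "(\<lambda>x. v x - w x) = v - w" for v w :: "real \<times> real \<Rightarrow> real"
  by (simp add: fun_diff_def)

lemma H10_iff:
  "v \<in> H10 R \<longleftrightarrow> v \<in> H1 R \<and> (\<forall>\<epsilon>>0. \<exists>\<phi>\<in>test_functions R. H1.nrm (v - \<phi>) < \<epsilon>)"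
  unfolding H10_def by (simp add: minus_fun_eq H1_norm_eq)

lemma H10_H1: "v \<in> H10 R \<Longrightarrow> v \<in> H1 R"
  by (simp add: H10_iff)

lemma test_function_H10: "\<phi> \<in> test_functions R \<Longrightarrow> \<phi> \<in> H10 R"
  unfolding H10_iff using test_function_H1(1) by (auto intro!: bexI[of _ \<phi>])

lemma H10_subspace: "subspace (H10 R)"
proof (rule subspaceI)
  have "(\<lambda>z::real \<times> real. 0 :: real) \<in> test_functions R"
    by (rule test_functionsI[of _ "{}"]) (auto intro: Ck_const)
  then show "0 \<in> H10 R" using test_function_H10 by (simp add: zero_fun_def)
next
  fix v w assume v: "v \<in> H10 R" and w: "w \<in> H10 R"
  show "v + w \<in> H10 R"
    unfolding H10_iff
  proof (intro conjI allI impI)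
    show "v + w \<in> H1 R" using v w H10_H1 H1_add by blast
    fix \<epsilon> :: real assume "0 < \<epsilon>"
    then have e: "0 < \<epsilon> / 2" by simp
    obtain \<phi> where \<phi>: "\<phi> \<in> test_functions R" "H1.nrm (v - \<phi>) < \<epsilon> / 2" using v e unfolding H10_iff by blast
    obtain \<psi> where \<psi>: "\<psi> \<in> test_functions R" "H1.nrm (w - \<psi>) < \<epsilon> / 2" using w e unfolding H10_iff by blast
    have "\<phi> + \<psi> \<in> test_functions R" using test_functions_add[OF \<phi>(1) \<psi>(1)] by (simp add: plus_fun_def)
    moreover have eq: "v + w - (\<phi> + \<psi>) = (v - \<phi>) + (w - \<psi>)" by simp
    have "H1.nrm (v + w - (\<phi> + \<psi>)) \<le> H1.nrm (v - \<phi>) + H1.nrm (w - \<psi>)"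
      unfolding eq using H1.nrm_triangle[of "v - \<phi>" "w - \<psi>"] H10_H1[OF v] H10_H1[OF w]
        test_function_H1(1)[OF \<phi>(1)] test_function_H1(1)[OF \<psi>(1)] by simp
    ultimately show "\<exists>\<phi>\<in>test_functions R. H1.nrm (v + w - \<phi>) < \<epsilon>" using \<phi> \<psi> by force
  qed
next
  fix k :: real and v assume v: "v \<in> H10 R"
  show "k *\<^sub>R v \<in> H10 R"
    unfolding H10_iff
  proof (intro conjI allI impI)
    show "k *\<^sub>R v \<in> H1 R" using v H10_H1 H1_scale by blast
    fix \<epsilon> :: real assume "0 < \<epsilon>"
    then have e: "0 < \<epsilon> / (\<bar>k\<bar> + 1)" by simp
    obtain \<phi> where \<phi>: "\<phi> \<in> test_functions R" "H1.nrm (v - \<phi>) < \<epsilon> / (\<bar>k\<bar> + 1)" using v e unfolding H10_iff by blast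
    have t: "k *\<^sub>R \<phi> \<in> test_functions R" using test_functions_scale[OF \<phi>(1)] by (simp add: scaleR_fun_def)
    have m: "v - \<phi> \<in> H1 R" using H10_H1[OF v] test_function_H1(1)[OF \<phi>(1)] by simp
    have "k *\<^sub>R v - k *\<^sub>R \<phi> = k *\<^sub>R (v - \<phi>)" by (simp add: scaleR_diff_right)
    then have "H1.nrm (k *\<^sub>R v - k *\<^sub>R \<phi>) = \<bar>k\<bar> * H1.nrm (v - \<phi>)"
      using m by (simp add: H1.nrm_def H1.scale H1.scale_right real_sqrt_mult)
    also have "\<dots> \<le> (\<bar>k\<bar> + 1) * H1.nrm (v - \<phi>)" using m by (intro mult_right_mono) auto
    also have "\<dots> < \<epsilon>" using \<phi>(2) by (simp add: field_simps)
    finally show "\<exists>\<phi>\<in>test_functions R. H1.nrm (k *\<^sub>R v - \<phi>) < \<epsilon>" using t by blast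
  qed
qed

lemma grad_form_psd_H10:
  assumes "T \<subseteq> R" "T \<in> sets lebesgue"
  shows "psd_form (H10 R) (grad_form T)"
proof -
  interpret G: psd_form "H1 R" "grad_form T" by (rule grad_form_psd[OF assms])
  show ?thesis
  proof
    fix v w z k assume "v \<in> H10 R" "w \<in> H10 R" "z \<in> H10 R"
    then have "v \<in> H1 R" "w \<in> H1 R" "z \<in> H1 R" by (auto intro: H10_H1)
    then show "grad_form T v w = grad_form T w v" "grad_form T (v + w) z = grad_form T v z + grad_form T w z"
      "grad_form T (k *\<^sub>R v) z = k * grad_form T v z" "0 \<le> grad_form T v v"
      using G.sym G.add G.scale G.psd by blast+
  qed (rule H10_subspace)
qed

lemma grad_form_le_H1:
  assumes "v \<in> H1 R" "T \<subseteq> R" "T \<in> sets lebesgue"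
  shows "grad_form T v v \<le> (H1.nrm v)\<^sup>2"
proof -
  have "grad_form T v v \<le> grad_form R v v"
    unfolding grad_form_def by (rule L2_inner_subset_le[OF H1_D(2)[OF assms(1)] assms(2,3) R_sets])
  also have "\<dots> \<le> H1_form v v" by (simp add: H1_form_def L2_inner_nonneg)
  finally show ?thesis using H1.nrm_squared[OF assms(1)] by simp
qed

end

section \<open>Approximation by test functions\<close>

text \<open>Dominated convergence when the limit is known only in the interior and off a finite set:
  at the remaining points both sides are set to zero, which changes no integral.\<close>

lemma integral_tendsto_pw:
  fixes \<psi> :: "nat \<Rightarrow> real \<Rightarrow> real"
  assumes S: "finite S" and cont: "\<And>k. continuous_on {a..x} (\<psi> k)"
    and bd: "\<And>k t. t \<in> {a..x} \<Longrightarrow> \<bar>\<psi> k t\<bar> \<le> B"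
    and lim: "\<And>t. t \<in> {a<..<x} - S \<Longrightarrow> (\<lambda>k. \<psi> k t) \<longlonglongrightarrow> g' t"
    and I: "(g' has_integral I) {a..x}"
  shows "(\<lambda>k. integral {a..x} (\<psi> k)) \<longlonglongrightarrow> I"
proof -
  define S' where "S' = S \<union> {a, x}"
  have S': "finite S'" using S by (simp add: S'_def)
  define f where "f k t = (if t \<in> S' then 0 else \<psi> k t)" for k t
  define h where "h t = (if t \<in> S' then 0 else g' t)" for t
  have f: "(f k has_integral integral {a..x} (\<psi> k)) {a..x}" for k
    using integrable_integral[OF integrable_continuous_real[OF cont]]
    by (rule has_integral_spike_finite[OF S', rotated]) (auto simp: f_def)
  have h: "(h has_integral I) {a..x}"
    by (rule has_integral_spike_finite[OF S' _ I]) (auto simp: h_def)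
  have "(\<lambda>k. integral {a..x} (f k)) \<longlonglongrightarrow> integral {a..x} h"
  proof (rule dominated_convergence(2)[where h = "\<lambda>_. \<bar>B\<bar>"])
    show "f k integrable_on {a..x}" for k using f by blast
    show "(\<lambda>_. \<bar>B\<bar>) integrable_on {a..x}" by (intro integrable_continuous_real continuous_on_const)
    show "norm (f k t) \<le> \<bar>B\<bar>" if "t \<in> {a..x}" for k t using bd[OF that, of k] by (auto simp: f_def)
    show "(\<lambda>k. f k t) \<longlonglongrightarrow> h t" if "t \<in> {a..x}" for t
      using that lim[of t] by (cases "t \<in> S'") (auto simp: f_def h_def S'_def)
  qed
  then show ?thesis
    unfolding integral_unique[OF f] integral_unique[OF h] .
qed

lemma smooth_antiderivative:
  assumes "smooth f"
  obtains F where "smooth F" "\<And>x. (F has_real_derivative f x) (at x)"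
proof -
  have "\<exists>F. \<forall>x::real. - \<infinity> < ereal x \<longrightarrow> ereal x < \<infinity> \<longrightarrow> (F has_vector_derivative f x) (at x)"
    by (rule einterval_antiderivative) (use DERIV_isCont[OF smooth_DERIV[OF assms]] in auto)
  then obtain F where F: "\<And>x. (F has_real_derivative f x) (at x)"
    by (auto simp: has_real_derivative_iff_has_vector_derivative)
  then show ?thesis using that smoothI_deriv[OF F assms] by blast
qed

lemma bump_integral_pos:
  assumes "a < b"
  obtains n where "n > 0" "0 < integral {a..b} (bump n a b)"
proof -
  have "(\<lambda>n. integral {a..b} (bump n a b)) \<longlonglongrightarrow> b - a"
  proof (rule integral_tendsto_pw[where S = "{}" and g' = "\<lambda>_. 1" and B = 1])
    show "((\<lambda>_. 1) has_integral b - a) {a..b}"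
      using has_integral_const_real[of "1::real" a b] assms by simp
    show "(\<lambda>k. bump k a b t) \<longlonglongrightarrow> 1" if "t \<in> {a<..<b} - {}" for t
      using bump_tendsto[of a b t] that by simp
  qed (auto intro!: smooth_continuous smooth_bump simp: bump_nonneg bump_le_1)
  then have "\<forall>\<^sub>F n in sequentially. 0 < integral {a..b} (bump n a b)"
    using assms by (intro order_tendstoD(1)) auto
  then obtain m where "\<forall>n\<ge>m. 0 < integral {a..b} (bump n a b)" by (auto simp: eventually_sequentially)
  then show ?thesis using that[of "Suc m"] by simp
qed

lemma zero_derivative_constant:
  fixes F :: "real \<Rightarrow> real"
  assumes "\<And>t. (F has_real_derivative f t) (at t)" "\<And>t. t \<in> {x..y} \<Longrightarrow> f t = 0" "x \<le> y"
  shows "F x = F y"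
proof -
  have "(f has_integral (F y - F x)) {x..y}"
    using assms(1,3) by (intro fundamental_theorem_of_calculus)
      (auto simp: has_real_derivative_iff_has_vector_derivative intro: has_vector_derivative_at_within)
  moreover have "(f has_integral 0) {x..y}"
    using assms(2) by (intro has_integral_is_0) auto
  ultimately have "F y - F x = 0" by (rule has_integral_unique)
  then show ?thesis by simp
qed

definition compact_in :: "real \<Rightarrow> real \<Rightarrow> (real \<Rightarrow> real) \<Rightarrow> bool" where
  "compact_in a b \<alpha> \<longleftrightarrow> (\<exists>a' b'. a < a' \<and> b' < b \<and> (\<forall>x. \<not> (a' \<le> x \<and> x \<le> b') \<longrightarrow> \<alpha> x = 0))"

text \<open>Uniform bounds are recorded in place of convergence in a norm, because products of two
  such sequences in different variables have to be dominated again.\<close>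

definition approximable :: "real \<Rightarrow> real \<Rightarrow> (real \<Rightarrow> real) \<Rightarrow> (real \<Rightarrow> real) \<Rightarrow> bool" where
  "approximable a b g g' \<longleftrightarrow> (\<exists>\<alpha> B S. (\<forall>n. smooth (\<alpha> n) \<and> compact_in a b (\<alpha> n)) \<and> finite S \<and>
     (\<forall>n. \<forall>x\<in>{a<..<b}. \<bar>\<alpha> n x\<bar> \<le> B \<and> \<bar>deriv (\<alpha> n) x\<bar> \<le> B) \<and>
     (\<forall>x\<in>{a<..<b}. (\<lambda>n. \<alpha> n x) \<longlonglongrightarrow> g x) \<and>
     (\<forall>x\<in>{a<..<b} - S. (\<lambda>n. deriv (\<alpha> n) x) \<longlonglongrightarrow> g' x))"

text \<open>The derivative is approximated first; subtracting a multiple of a fixed bump restores mean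
  zero, so that the antiderivatives keep compact support.\<close>

lemma approximable_of_derivative:
  assumes ab: "a < b" and \<psi>: "\<And>n::nat. smooth (\<psi> n)" "\<And>n. compact_in a b (\<psi> n)"
    and bd: "\<And>n x. \<bar>\<psi> n x\<bar> \<le> B" and S: "finite S"
    and lim: "\<And>x. x \<in> {a<..<b} - S \<Longrightarrow> (\<lambda>n. \<psi> n x) \<longlonglongrightarrow> g' x"
    and g: "pw_diff a b g g'" "g a = 0" "g b = 0"
  shows "approximable a b g g'"
proof -
  obtain n0 where n0: "n0 > 0" "0 < integral {a..b} (bump n0 a b)"
    using bump_integral_pos[OF ab] .
  define \<theta> where "\<theta> = bump n0 a b"
  define c where "c = integral {a..b} \<theta>"
  \<comment> \<open>This \<open>m n\<close> gives \<open>\<beta> n\<close> mean zero. It tends to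
    zero, because the integrals of \<open>\<psi> n\<close> over the interval tend to
    \<open>g b = 0\<close>; the correction therefore does not disturb the limits.\<close>
  define m where "m n = integral {a..b} (\<psi> n) / c" for n
  define \<beta> where "\<beta> n x = \<psi> n x - m n * \<theta> x" for n x
  have c: "0 < c" using n0 by (simp add: c_def \<theta>_def)
  have \<theta>: "smooth \<theta>" "\<And>x. \<bar>\<theta> x\<bar> \<le> 1"
    unfolding \<theta>_def by (auto simp: smooth_bump bump_nonneg bump_le_1)
  have \<beta>: "smooth (\<beta> n)" for n
    unfolding \<beta>_def[abs_def] by (intro smooth_diff \<psi> smooth_cmult \<theta>)
  have intg: "(f has_integral integral S f) S" if "f integrable_on S" for f :: "real \<Rightarrow> real" and S
    using that by (rule integrable_integral)
  have gI: "(g' has_integral g x) {a..x}" if "x \<in> {a..b}" for x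
  proof -
    obtain T where T: "finite T" "\<And>x. x \<in> {a<..<b} - T \<Longrightarrow> (g has_real_derivative g' x) (at x)"
      and cg: "continuous_on {a..b} g" using g(1) by (auto simp: pw_diff_def)
    have "(g' has_integral (g x - g a)) {a..x}"
      using that T cg
      by (intro fundamental_theorem_of_calculus_interior_strong[OF T(1)])
        (auto simp: has_real_derivative_iff_has_vector_derivative intro: continuous_on_subset)
    then show ?thesis using g(2) by simp
  qed
  have \<psi>I: "(\<lambda>n. integral {a..x} (\<psi> n)) \<longlonglongrightarrow> g x" if "x \<in> {a..b}" for x
    by (rule integral_tendsto_pw[OF S _ bd _ gI[OF that]])
      (use that lim in \<open>auto intro!: smooth_continuous \<psi>\<close>)
  have m0: "m \<longlonglongrightarrow> 0"
    unfolding m_def using tendsto_divide[OF \<psi>I[of b] tendsto_const[of c]] ab g(3) c by simp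
  then have "Bseq m" by (intro convergent_imp_Bseq convergentI)
  then obtain Bm where "\<forall>n. \<bar>m n\<bar> \<le> Bm" by (auto simp: Bseq_def)
  then have Bm: "\<bar>m n\<bar> \<le> Bm" for n by blast
  have \<beta>bd: "\<bar>\<beta> n x\<bar> \<le> B + Bm" for n x
  proof -
    have "\<bar>m n * \<theta> x\<bar> \<le> Bm * 1"
      unfolding abs_mult using Bm[of n] \<theta>(2)[of x] by (intro mult_mono) auto
    then show ?thesis unfolding \<beta>_def using bd[of n x] by linarith
  qed
  have "\<exists>F. \<forall>x. (F has_real_derivative \<beta> n x) (at x)" for n
    using smooth_antiderivative[OF \<beta>[of n]] by metis
  then obtain F where F: "\<And>n x. (F n has_real_derivative \<beta> n x) (at x)"
    by metis
  define \<alpha> where "\<alpha> n x = F n x - F n a" for n x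
  have \<alpha>D: "(\<alpha> n has_real_derivative \<beta> n x) (at x)" for n x
    unfolding \<alpha>_def[abs_def] using F by (auto intro!: derivative_eq_intros)
  have \<alpha>d: "deriv (\<alpha> n) = \<beta> n" for n using DERIV_imp_deriv[OF \<alpha>D] by auto
  have \<alpha>s: "smooth (\<alpha> n)" for n by (rule smoothI_deriv[OF \<alpha>D \<beta>])
  have \<alpha>I: "\<alpha> n x = integral {a..x} (\<beta> n)" if "a \<le> x" for n x
  proof -
    have "(\<beta> n has_integral (\<alpha> n x - \<alpha> n a)) {a..x}"
      using that \<alpha>D by (intro fundamental_theorem_of_calculus)
        (auto simp: has_real_derivative_iff_has_vector_derivative intro: has_vector_derivative_at_within)
    then show ?thesis by (simp add: integral_unique \<alpha>_def)
  qed
  have int: "f integrable_on {a..x}" if "smooth f" for f x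
    by (intro integrable_continuous_real smooth_continuous that)
  have \<beta>I: "integral {a..x} (\<beta> n) = integral {a..x} (\<psi> n) - m n * integral {a..x} \<theta>" for n x
    unfolding \<beta>_def[abs_def] using int[OF \<psi>(1)] int[OF \<theta>(1)] int[OF smooth_cmult[OF \<theta>(1)]]
    by (subst integral_diff) auto
  have comp: "compact_in a b (\<alpha> n)" for n
  proof -
    obtain a1 b1 where 1: "a < a1" "b1 < b" "\<And>x. \<not> (a1 \<le> x \<and> x \<le> b1) \<Longrightarrow> \<psi> n x = 0"
      using \<psi>(2)[of n] unfolding compact_in_def by blast
    define a' where "a' = min a1 (a + 1 / real n0)"
    define b' where "b' = max b1 (b - 1 / real n0)"
    have a'b': "a < a'" "b' < b" using 1 n0 by (auto simp: a'_def b'_def)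
    have z: "\<beta> n x = 0" if "\<not> (a' \<le> x \<and> x \<le> b')" for x
    proof -
      have "\<psi> n x = 0" using that by (intro 1(3)) (auto simp: a'_def b'_def)
      moreover have "\<theta> x = 0"
        unfolding \<theta>_def using that bump_nonzeroD[of n0 a b x] by (force simp: a'_def b'_def)
      ultimately show ?thesis by (simp add: \<beta>_def)
    qed
    define a2 where "a2 = (a + a') / 2"
    define b2 where "b2 = (b + b') / 2"
    have ab2: "a < a2" "a2 < a'" "b' < b2" "b2 < b" using a'b' by (auto simp: a2_def b2_def)
    \<comment> \<open>Mean zero of \<open>\<beta> n\<close> makes its antiderivative vanish at the
      right end as well. Outside \<open>[a', b']\<close> the antiderivative is constant on either
      side, so it vanishes there.\<close>
    have "\<alpha> n b = integral {a..b} (\<psi> n) - m n * c"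
      using \<alpha>I[of b n] \<beta>I[of b n] ab by (simp add: c_def)
    then have \<alpha>b: "\<alpha> n b = 0" using c by (simp add: m_def)
    have "\<alpha> n x = 0" if x: "\<not> (a2 \<le> x \<and> x \<le> b2)" for x
    proof (cases "x < a2")
      case True
      have "\<alpha> n (min x a) = \<alpha> n x" "\<alpha> n (min x a) = \<alpha> n a"
        by (rule zero_derivative_constant[OF \<alpha>D]; use True ab2 z in force)+
      then show ?thesis by (simp add: \<alpha>_def)
    next
      case False
      then have "b2 < x" using x by simp
      have "\<alpha> n x = \<alpha> n (max x b)" "\<alpha> n b = \<alpha> n (max x b)"
        by (rule zero_derivative_constant[OF \<alpha>D]; use \<open>b2 < x\<close> ab2 z in force)+
      then show ?thesis using \<alpha>b by simp
    qed
    then show ?thesis unfolding compact_in_def using ab2 by blast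
  qed
  have \<alpha>bd: "\<bar>\<alpha> n x\<bar> \<le> (B + Bm) * (b - a)" if "x \<in> {a<..<b}" for n x
  proof -
    have BB: "0 \<le> B + Bm" using \<beta>bd[of 0 0] by linarith
    have "norm (integral {a..x} (\<beta> n)) \<le> (B + Bm) * (x - a)"
      using that \<beta>bd by (intro integral_bound smooth_continuous \<beta>) auto
    also have "\<dots> \<le> (B + Bm) * (b - a)" using that BB by (intro mult_left_mono) auto
    finally show ?thesis using \<alpha>I[of x n] that by simp
  qed
  have \<alpha>lim: "(\<lambda>n. \<alpha> n x) \<longlonglongrightarrow> g x" if "x \<in> {a<..<b}" for x
  proof -
    have "(\<lambda>n. integral {a..x} (\<psi> n) - m n * integral {a..x} \<theta>) \<longlonglongrightarrow> g x - 0 * integral {a..x} \<theta>"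
      using that by (intro tendsto_intros \<psi>I m0) auto
    then show ?thesis using \<alpha>I[of x] \<beta>I[of x] that by simp
  qed
  have \<beta>lim: "(\<lambda>n. \<beta> n x) \<longlonglongrightarrow> g' x" if "x \<in> {a<..<b} - S" for x
  proof -
    have "(\<lambda>n. \<psi> n x - m n * \<theta> x) \<longlonglongrightarrow> g' x - 0 * \<theta> x"
      by (intro tendsto_intros lim[OF that] m0)
    then show ?thesis by (simp add: \<beta>_def)
  qed
  show ?thesis
    unfolding approximable_def
  proof (intro exI[of _ \<alpha>] exI[of _ "max ((B + Bm) * (b - a)) (B + Bm)"] exI[of _ S] conjI allI ballI)
    show "\<bar>\<alpha> n x\<bar> \<le> max ((B + Bm) * (b - a)) (B + Bm)" if "x \<in> {a<..<b}" for n x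
      using \<alpha>bd[OF that, of n] by simp
    show "\<bar>deriv (\<alpha> n) x\<bar> \<le> max ((B + Bm) * (b - a)) (B + Bm)" for n x
      using \<beta>bd[of n x] by (simp add: \<alpha>d)
  qed (use \<alpha>s comp S \<alpha>lim \<beta>lim \<alpha>d in auto)
qed

section \<open>Membership in the closure of the test functions\<close>

context rectangle
begin

lemma H1_diff:
  assumes "v \<in> H1 R" "w \<in> H1 R"
  shows "AE z in lebesgue_on R. weak_gradient R (v - w) z = weak_gradient R v z - weak_gradient R w z"
proof -
  define k :: real where "k = - 1"
  have eq: "v - w = v + k *\<^sub>R w" by (simp add: k_def)
  show ?thesis
    unfolding eq using H1_add(2)[OF assms(1) H1_scale(1)[OF assms(2), of k]] H1_scale(2)[OF assms(2), of k]
  proof eventually_elim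
    case (elim z)
    then show ?case by (simp only:) (simp add: k_def)
  qed
qed

text \<open>The rectangle has finite measure, so bounded convergence almost everywhere of values and
  gradients gives convergence in the \<open>H1\<close> norm. The limit may be merely piecewise
  smooth.\<close>

lemma H10_limit:
  assumes v: "pw_gradient a b c d v w" and t: "\<And>n. \<phi> n \<in> test_functions R"
    and B: "\<And>n z. z \<in> R \<Longrightarrow> \<bar>\<phi> n z\<bar> \<le> B \<and> norm (gradient (\<phi> n) z) \<le> B"
    and lim: "AE z in lebesgue_on R. (\<lambda>n. \<phi> n z) \<longlonglongrightarrow> v z"
      "AE z in lebesgue_on R. (\<lambda>n. gradient (\<phi> n) z) \<longlonglongrightarrow> w z"
  shows "v \<in> H10 R"
proof -
  note W = pw_gradient_weak[OF v less_imp_le[OF ab] less_imp_le[OF cd]]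
  have vH: "v \<in> H1 R" by (rule H1_I[OF W])
  have wg: "AE z in lebesgue_on R. weak_gradient R v z = w z" by (rule weak_gradient_AE(3)[OF W(2,3)])
  obtain C where C: "\<And>z. z \<in> R \<Longrightarrow> \<bar>v z\<bar> \<le> C" "\<And>z. z \<in> R \<Longrightarrow> norm (w z) \<le> C"
    using v unfolding pw_gradient_def by blast
  note tH = test_function_H1[OF t] and tL = test_function_L2[OF t]
  have form: "H1_form (v - \<phi> n) (v - \<phi> n)
      = (LINT z|lebesgue_on R. (v z - \<phi> n z)\<^sup>2 + (norm (w z - gradient (\<phi> n) z))\<^sup>2)" for n
  proof -
    have vp: "v - \<phi> n = (\<lambda>z. v z - \<phi> n z)" by (simp add: fun_diff_def)
    have d: "v - \<phi> n \<in> H1 R" using vH tH(1) by simp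
    have "AE z in lebesgue_on R. weak_gradient R (v - \<phi> n) z = w z - gradient (\<phi> n) z"
      using H1_diff[OF vH tH(1)[of n]] wg tH(2)[of n] by eventually_elim simp
    then have "grad_form R (v - \<phi> n) (v - \<phi> n) = L2_inner R (\<lambda>z. w z - gradient (\<phi> n) z) (\<lambda>z. w z - gradient (\<phi> n) z)"
      unfolding grad_form_def
      using L2_measurable[OF H1_D(2)[OF d]] L2_measurable[OF L2_diff[OF W(2) tL(2)[of n]]]
      by (intro L2_inner_cong_AE) auto
    then have "H1_form (v - \<phi> n) (v - \<phi> n) = (LINT z|lebesgue_on R. (v z - \<phi> n z) * (v z - \<phi> n z))
        + (LINT z|lebesgue_on R. (w z - gradient (\<phi> n) z) \<bullet> (w z - gradient (\<phi> n) z))"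
      by (simp add: H1_form_def L2_inner_def vp)
    also have "\<dots> = (LINT z|lebesgue_on R. (v z - \<phi> n z) * (v z - \<phi> n z) + (w z - gradient (\<phi> n) z) \<bullet> (w z - gradient (\<phi> n) z))"
      using L2_inner_integrable[OF L2_diff[OF W(1) tL(1)[of n]] L2_diff[OF W(1) tL(1)[of n]]]
        L2_inner_integrable[OF L2_diff[OF W(2) tL(2)[of n]] L2_diff[OF W(2) tL(2)[of n]]]
      by (intro Bochner_Integration.integral_add[symmetric]) auto
    finally show ?thesis by (simp add: power2_eq_square power2_norm_eq_inner[symmetric])
  qed
  have conv: "(\<lambda>n. LINT z|lebesgue_on R. (v z - \<phi> n z)\<^sup>2 + (norm (w z - gradient (\<phi> n) z))\<^sup>2) \<longlonglongrightarrow> (LINT z|lebesgue_on R. 0)"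
  proof (rule integral_dominated_convergence[where w = "\<lambda>_. (C + B)\<^sup>2 + (C + B)\<^sup>2"])
    show "(\<lambda>z. (v z - \<phi> n z)\<^sup>2 + (norm (w z - gradient (\<phi> n) z))\<^sup>2) \<in> borel_measurable (lebesgue_on R)" for n
      using L2_measurable[OF W(1)] L2_measurable[OF W(2)] L2_measurable[OF tL(1)[of n]] L2_measurable[OF tL(2)[of n]]
      by measurable
    show "integrable (lebesgue_on R) (\<lambda>_. (C + B)\<^sup>2 + (C + B)\<^sup>2)"
      by (rule bounded_integrable_on[OF _ R_lmeasurable order.refl]) simp
    show "AE z in lebesgue_on R. norm ((v z - \<phi> n z)\<^sup>2 + (norm (w z - gradient (\<phi> n) z))\<^sup>2) \<le> (C + B)\<^sup>2 + (C + B)\<^sup>2" for n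
    proof (rule AE_I2)
      fix z assume "z \<in> space (lebesgue_on R)"
      then have z: "z \<in> R" by simp
      have "\<bar>v z - \<phi> n z\<bar> \<le> C + B" using C(1)[OF z] B[OF z, of n] by linarith
      then have "(v z - \<phi> n z)\<^sup>2 \<le> (C + B)\<^sup>2" by (simp add: abs_le_square_iff[symmetric])
      moreover have "norm (w z - gradient (\<phi> n) z) \<le> C + B"
        using norm_triangle_ineq4[of "w z" "gradient (\<phi> n) z"] C(2)[OF z] B[OF z, of n] by linarith
      then have "(norm (w z - gradient (\<phi> n) z))\<^sup>2 \<le> (C + B)\<^sup>2" by (intro power_mono) auto
      ultimately show "norm ((v z - \<phi> n z)\<^sup>2 + (norm (w z - gradient (\<phi> n) z))\<^sup>2) \<le> (C + B)\<^sup>2 + (C + B)\<^sup>2" by simp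
    qed
    show "AE z in lebesgue_on R. (\<lambda>n. (v z - \<phi> n z)\<^sup>2 + (norm (w z - gradient (\<phi> n) z))\<^sup>2) \<longlonglongrightarrow> 0"
      using lim
    proof eventually_elim
      fix z assume l: "(\<lambda>n. \<phi> n z) \<longlonglongrightarrow> v z" "(\<lambda>n. gradient (\<phi> n) z) \<longlonglongrightarrow> w z"
      have "(\<lambda>n. (v z - \<phi> n z)\<^sup>2 + (norm (w z - gradient (\<phi> n) z))\<^sup>2) \<longlonglongrightarrow> (v z - v z)\<^sup>2 + (norm (w z - w z))\<^sup>2"
        by (intro tendsto_intros l)
      then show "(\<lambda>n. (v z - \<phi> n z)\<^sup>2 + (norm (w z - gradient (\<phi> n) z))\<^sup>2) \<longlonglongrightarrow> 0" by simp
    qed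
  qed simp
  have "(\<lambda>n. H1.nrm (v - \<phi> n)) \<longlonglongrightarrow> sqrt 0"
    unfolding H1.nrm_def form using conv by (intro tendsto_real_sqrt) simp
  then have l: "(\<lambda>n. H1.nrm (v - \<phi> n)) \<longlonglongrightarrow> 0" by simp
  show ?thesis
    unfolding H10_iff
  proof (intro conjI vH allI impI)
    fix \<epsilon> :: real assume "0 < \<epsilon>"
    then have "\<forall>\<^sub>F n in sequentially. H1.nrm (v - \<phi> n) < \<epsilon>" using l by (intro order_tendstoD(2))
    then obtain n where "H1.nrm (v - \<phi> n) < \<epsilon>" by (auto simp: eventually_sequentially)
    then show "\<exists>\<phi>\<in>test_functions R. H1.nrm (v - \<phi>) < \<epsilon>" using t by blast
  qed
qed

lemma gradient_tensor:
  assumes "smooth \<alpha>" "smooth \<beta>"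
  shows "gradient (\<lambda>z. \<alpha> (fst z) * \<beta> (snd z)) z = (deriv \<alpha> (fst z) * \<beta> (snd z), \<alpha> (fst z) * deriv \<beta> (snd z))"
proof -
  have Ck: "\<forall>k. Ck k (\<lambda>z. \<alpha> (fst z) * \<beta> (snd z))" using Ck_tensor[OF assms] by blast
  have "((\<lambda>x. \<alpha> x * \<beta> (snd z)) has_real_derivative deriv \<alpha> (fst z) * \<beta> (snd z)) (at (fst z))"
    by (intro DERIV_cmult_right smooth_DERIV assms)
  then have 1: "pd1 (\<lambda>z. \<alpha> (fst z) * \<beta> (snd z)) z = deriv \<alpha> (fst z) * \<beta> (snd z)"
    using DERIV_unique[OF pd1_deriv[OF Ck, of "snd z" "fst z"]] by simp
  have "((\<lambda>y. \<alpha> (fst z) * \<beta> y) has_real_derivative \<alpha> (fst z) * deriv \<beta> (snd z)) (at (snd z))"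
    by (intro DERIV_cmult smooth_DERIV assms)
  then have 2: "pd2 (\<lambda>z. \<alpha> (fst z) * \<beta> (snd z)) z = \<alpha> (fst z) * deriv \<beta> (snd z)"
    using DERIV_unique[OF pd2_deriv[OF Ck, of "fst z" "snd z"]] by simp
  show ?thesis unfolding gradient_plane 1 2 ..
qed

text \<open>One-dimensional approximants are multiplied. The exceptional points of each factor
  become finitely many lines, a null set in the plane.\<close>

lemma H10_tensor:
  assumes g: "approximable a b g g'" and h: "approximable c d h h'"
    and pw: "pw_gradient a b c d (\<lambda>z. g (fst z) * h (snd z)) (\<lambda>z. (g' (fst z) * h (snd z), g (fst z) * h' (snd z)))"
  shows "(\<lambda>z. g (fst z) * h (snd z)) \<in> H10 R"
proof -
  obtain \<alpha> B S where \<alpha>: "\<And>n. smooth (\<alpha> n)" "\<And>n. compact_in a b (\<alpha> n)" and S: "finite S"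
    and \<alpha>B: "\<And>n x. x \<in> {a<..<b} \<Longrightarrow> \<bar>\<alpha> n x\<bar> \<le> B" "\<And>n x. x \<in> {a<..<b} \<Longrightarrow> \<bar>deriv (\<alpha> n) x\<bar> \<le> B"
    and \<alpha>l: "\<And>x. x \<in> {a<..<b} \<Longrightarrow> (\<lambda>n. \<alpha> n x) \<longlonglongrightarrow> g x"
      "\<And>x. x \<in> {a<..<b} - S \<Longrightarrow> (\<lambda>n. deriv (\<alpha> n) x) \<longlonglongrightarrow> g' x"
    using g unfolding approximable_def by blast
  obtain \<beta> B' S' where \<beta>: "\<And>n. smooth (\<beta> n)" "\<And>n. compact_in c d (\<beta> n)" and S': "finite S'"
    and \<beta>B: "\<And>n x. x \<in> {c<..<d} \<Longrightarrow> \<bar>\<beta> n x\<bar> \<le> B'" "\<And>n x. x \<in> {c<..<d} \<Longrightarrow> \<bar>deriv (\<beta> n) x\<bar> \<le> B'"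
    and \<beta>l: "\<And>x. x \<in> {c<..<d} \<Longrightarrow> (\<lambda>n. \<beta> n x) \<longlonglongrightarrow> h x"
      "\<And>x. x \<in> {c<..<d} - S' \<Longrightarrow> (\<lambda>n. deriv (\<beta> n) x) \<longlonglongrightarrow> h' x"
    using h unfolding approximable_def by blast
  have N: "negligible ({z. fst z \<in> S} \<union> {z. snd z \<in> S'})"
  proof -
    have "negligible {z::real \<times> real. fst z = t}" for t
      using negligible_standard_hyperplane[of "(1, 0) :: real \<times> real" t] by (simp add: Basis_plane inner_prod_def)
    moreover have "negligible {z::real \<times> real. snd z = t}" for t
      using negligible_standard_hyperplane[of "(0, 1) :: real \<times> real" t] by (simp add: Basis_plane inner_prod_def)
    moreover have "{z. fst z \<in> S} = (\<Union>t\<in>S. {z::real \<times> real. fst z = t})" "{z. snd z \<in> S'} = (\<Union>t\<in>S'. {z::real \<times> real. snd z = t})"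
      by auto
    ultimately show ?thesis using S S' by (auto intro!: negligible_Un negligible_Union)
  qed
  define \<phi> where "\<phi> n z = \<alpha> n (fst z) * \<beta> n (snd z)" for n and z :: "real \<times> real"
  have grad: "gradient (\<phi> n) z = (deriv (\<alpha> n) (fst z) * \<beta> n (snd z), \<alpha> n (fst z) * deriv (\<beta> n) (snd z))" for n z
    unfolding \<phi>_def[abs_def] by (rule gradient_tensor[OF \<alpha>(1) \<beta>(1)])
  have m: "\<bar>x * y\<bar> \<le> \<bar>B\<bar> * \<bar>B'\<bar>" if "\<bar>x\<bar> \<le> B" "\<bar>y\<bar> \<le> B'" for x y :: real
    unfolding abs_mult using that by (intro mult_mono) auto
  show ?thesis
  proof (rule H10_limit[OF pw, of \<phi> "\<bar>B\<bar> * \<bar>B'\<bar> + \<bar>B\<bar> * \<bar>B'\<bar>"])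
    show "\<phi> n \<in> test_functions R" for n
    proof -
      obtain a1 b1 where "a < a1" "b1 < b" "\<And>x. \<not> (a1 \<le> x \<and> x \<le> b1) \<Longrightarrow> \<alpha> n x = 0"
        using \<alpha>(2)[of n] unfolding compact_in_def by blast
      moreover obtain c1 d1 where "c < c1" "d1 < d" "\<And>x. \<not> (c1 \<le> x \<and> x \<le> d1) \<Longrightarrow> \<beta> n x = 0"
        using \<beta>(2)[of n] unfolding compact_in_def by blast
      ultimately show ?thesis
        unfolding \<phi>_def[abs_def] by (intro test_functions_tensor[OF \<alpha>(1) \<beta>(1)])
    qed
    show "\<bar>\<phi> n z\<bar> \<le> \<bar>B\<bar> * \<bar>B'\<bar> + \<bar>B\<bar> * \<bar>B'\<bar> \<and> norm (gradient (\<phi> n) z) \<le> \<bar>B\<bar> * \<bar>B'\<bar> + \<bar>B\<bar> * \<bar>B'\<bar>"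
      if "z \<in> R" for n z
    proof
      have z: "fst z \<in> {a<..<b}" "snd z \<in> {c<..<d}" using that by auto
      have "0 \<le> \<bar>B\<bar> * \<bar>B'\<bar>" by simp
      then show "\<bar>\<phi> n z\<bar> \<le> \<bar>B\<bar> * \<bar>B'\<bar> + \<bar>B\<bar> * \<bar>B'\<bar>"
        unfolding \<phi>_def using m[OF \<alpha>B(1)[OF z(1)] \<beta>B(1)[OF z(2)], of n n] by linarith
      show "norm (gradient (\<phi> n) z) \<le> \<bar>B\<bar> * \<bar>B'\<bar> + \<bar>B\<bar> * \<bar>B'\<bar>"
        unfolding grad
        using m[OF \<alpha>B(2)[OF z(1)] \<beta>B(1)[OF z(2)], of n n] m[OF \<alpha>B(1)[OF z(1)] \<beta>B(2)[OF z(2)], of n n]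
        by (intro order.trans[OF norm_Pair_le]) (unfold real_norm_def, linarith)
    qed
    show "AE z in lebesgue_on R. (\<lambda>n. \<phi> n z) \<longlonglongrightarrow> g (fst z) * h (snd z)"
      unfolding \<phi>_def by (intro AE_I2 tendsto_mult \<alpha>l \<beta>l) auto
    have "AE z in lebesgue. z \<notin> {z. fst z \<in> S} \<union> {z. snd z \<in> S'}"
      using N by (intro AE_not_in) (simp add: negligible_iff_null_sets)
    then have "AE z in lebesgue. z \<in> R \<longrightarrow> (\<lambda>n. gradient (\<phi> n) z) \<longlonglongrightarrow> (g' (fst z) * h (snd z), g (fst z) * h' (snd z))"
      by eventually_elim (auto simp: grad intro!: tendsto_Pair tendsto_mult \<alpha>l \<beta>l)
    then show "AE z in lebesgue_on R. (\<lambda>n. gradient (\<phi> n) z) \<longlonglongrightarrow> (g' (fst z) * h (snd z), g (fst z) * h' (snd z))"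
      using R_sets by (simp add: AE_restrict_space_iff)
  qed
qed

end

section \<open>Piecewise smooth functions on the layers\<close>

text \<open>Piece \<open>i\<close> is used on \<open>(i - 1, i]\<close>, its index being the ceiling
  of the argument; \<open>max 1\<close> sends \<open>0\<close> and everything to its left to the
  first piece. Arguments beyond \<open>N\<close> select pieces with index above \<open>N\<close>,
  which matters for identities on the whole plane.\<close>

definition glue :: "(nat \<Rightarrow> real \<Rightarrow> real) \<Rightarrow> real \<Rightarrow> real" where
  "glue G x = G (max 1 (nat \<lceil>x\<rceil>)) x"

definition tens :: "(nat \<Rightarrow> real \<Rightarrow> real) \<Rightarrow> (real \<Rightarrow> real) \<Rightarrow> real \<times> real \<Rightarrow> real" where
  "tens G s z = glue G (fst z) * s (snd z)"

text \<open>Every piece is smooth on the whole line, so a one-sided derivative at an interface is an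
  ordinary derivative of a piece. The nodal conditions express continuity and zero boundary values
  of the glued function.\<close>

definition pieces :: "nat \<Rightarrow> (nat \<Rightarrow> real \<Rightarrow> real) set" where
  "pieces N = {G. (\<forall>i. smooth (G i)) \<and> (\<forall>i\<in>{1..<N}. G i (real i) = G (Suc i) (real i))
     \<and> G 1 0 = 0 \<and> G N (real N) = 0}"

lemma glue_Ioc:
  assumes "i \<ge> 1" "real i - 1 < x" "x \<le> real i"
  shows "glue G x = G i x"
proof -
  have "\<lceil>x\<rceil> = int i" using assms by (simp add: ceiling_eq_iff)
  then show ?thesis using assms by (simp add: glue_def max_def)
qed

lemma glue_Icc:
  assumes G: "G \<in> pieces N" and i: "i \<in> {1..N}" and x: "real i - 1 \<le> x" "x \<le> real i"
  shows "glue G x = G i x"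
proof (cases "x = real i - 1")
  case True
  show ?thesis
  proof (cases "i = 1")
    case True
    then show ?thesis using \<open>x = real i - 1\<close> by (simp add: glue_def)
  next
    case False
    then obtain l where l: "i = Suc l" "l \<ge> 1" using i by (cases i) auto
    then have "x = real l" using True by simp
    then have "glue G x = G l x" using l by (intro glue_Ioc) auto
    also have "\<dots> = G i x"
      using G l i \<open>x = real l\<close> unfolding pieces_def by auto
    finally show ?thesis .
  qed
next
  case False
  then show ?thesis using assms by (intro glue_Ioc) auto
qed

lemma glue_borel:
  assumes "\<And>i. G i \<in> borel_measurable borel"
  shows "glue G \<in> borel_measurable borel"
proof -
  have "(\<lambda>x::real. max 1 (nat \<lceil>x\<rceil>)) \<in> measurable borel (count_space UNIV)"
    by measurable
  then have "(\<lambda>x. G (max 1 (nat \<lceil>x\<rceil>)) x) \<in> borel_measurable borel"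
    by (rule measurable_compose_countable[where f = G, OF assms])
  then show ?thesis by (simp add: glue_def[abs_def])
qed

lemma layer_cover: "x \<in> {0..real N} \<Longrightarrow> N \<ge> 1 \<Longrightarrow> \<exists>i\<in>{1..N}. real i - 1 \<le> x \<and> x \<le> real i"
proof -
  assume x: "x \<in> {0..real N}" and N: "N \<ge> 1"
  show ?thesis
  proof (cases "x = 0")
    case True
    then show ?thesis using N by (intro bexI[of _ 1]) auto
  next
    case False
    define i where "i = nat \<lceil>x\<rceil>"
    have "0 < \<lceil>x\<rceil>" using x False by simp
    then have "\<lceil>x\<rceil> \<ge> 1" by simp
    then have i: "real_of_int \<lceil>x\<rceil> = real i" by (simp add: i_def)
    have "\<lceil>x\<rceil> \<le> int N" using x by (simp add: ceiling_le_iff)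
    then have "1 \<le> i" "i \<le> N" using \<open>\<lceil>x\<rceil> \<ge> 1\<close> unfolding i_def by linarith+
    then have "i \<in> {1..N}" by simp
    moreover have "real i - 1 \<le> x" "x \<le> real i"
      using i ceiling_correct[of x] by linarith+
    ultimately show ?thesis by blast
  qed
qed

lemma layer_cover_interior:
  assumes x: "x \<in> {0<..<real N} - real ` {0..N}" and N: "N \<ge> 1"
  shows "\<exists>i\<in>{1..N}. real i - 1 < x \<and> x < real i"
proof -
  have "x \<in> {0..real N}" using x by simp
  then obtain i where i: "i \<in> {1..N}" "real i - 1 \<le> x" "x \<le> real i"
    using layer_cover[OF _ N] by blast
  have "i - 1 \<le> N" using i(1) by auto
  then have "real i \<in> real ` {0..N}" "real (i - 1) \<in> real ` {0..N}"
    using i(1) unfolding image_iff by (intro bexI[of _ i] bexI[of _ "i - 1"]; simp)+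
  then have "x \<noteq> real i" "x \<noteq> real (i - 1)" using x by blast+
  moreover have "real (i - 1) = real i - 1" using i(1) by simp
  ultimately show ?thesis using i by (intro bexI[of _ i]) auto
qed

lemma smooth_bounded_Icc:
  assumes "smooth f"
  obtains C where "\<And>x. x \<in> {a..b} \<Longrightarrow> \<bar>f x\<bar> \<le> C"
proof -
  have "bounded (f ` {a..b})"
    using assms by (intro compact_imp_bounded compact_continuous_image smooth_continuous) auto
  then obtain C where "\<forall>y\<in>f ` {a..b}. norm y \<le> C" unfolding bounded_iff by blast
  then show ?thesis using that[of C] by auto
qed

lemma smooth_family_bounded:
  fixes G :: "nat \<Rightarrow> real \<Rightarrow> real"
  assumes "\<And>i. smooth (G i)"
  shows "\<exists>C\<ge>0. \<forall>i\<in>{1..N}. \<forall>x\<in>{a..b}. \<bar>G i x\<bar> \<le> C"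
proof -
  have "\<exists>C. \<forall>x\<in>{a..b}. \<bar>G i x\<bar> \<le> C" for i
    using smooth_bounded_Icc[OF assms[of i], of a b] by metis
  then obtain C where C: "\<And>i x. x \<in> {a..b} \<Longrightarrow> \<bar>G i x\<bar> \<le> C i" by metis
  have "\<bar>G i x\<bar> \<le> (\<Sum>i\<in>{1..N}. \<bar>C i\<bar>)" if "i \<in> {1..N}" "x \<in> {a..b}" for i x
  proof -
    have "\<bar>G i x\<bar> \<le> \<bar>C i\<bar>" using C[OF that(2), of i] by linarith
    also have "\<dots> \<le> (\<Sum>i\<in>{1..N}. \<bar>C i\<bar>)" using that(1) by (intro member_le_sum) auto
    finally show ?thesis .
  qed
  then show ?thesis by (intro exI[of _ "\<Sum>i\<in>{1..N}. \<bar>C i\<bar>"]) (simp add: sum_nonneg)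
qed

lemma glue_bounded:
  assumes "\<And>i. smooth (G i)" "N \<ge> 1"
  shows "\<exists>C. \<forall>x\<in>{0<..<real N}. \<bar>glue G x\<bar> \<le> C"
proof -
  obtain C where C: "\<forall>i\<in>{1..N}. \<forall>x\<in>{0..real N}. \<bar>G i x\<bar> \<le> C"
    using smooth_family_bounded[of G, OF assms(1)] by blast
  have "\<bar>glue G x\<bar> \<le> C" if "x \<in> {0<..<real N}" for x
  proof -
    have "0 < \<lceil>x\<rceil>" "\<lceil>x\<rceil> \<le> int N" using that by (simp_all add: ceiling_le_iff)
    then have "nat \<lceil>x\<rceil> \<le> N" by linarith
    then have "max 1 (nat \<lceil>x\<rceil>) \<in> {1..N}"
      using assms(2) unfolding atLeastAtMost_iff max.bounded_iff by (intro conjI max.cobounded1)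
    moreover have "x \<in> {0..real N}" using that by simp
    ultimately show ?thesis unfolding glue_def using C by blast
  qed
  then show ?thesis by blast
qed

lemma pieces_smooth: "G \<in> pieces N \<Longrightarrow> smooth (G i)"
  by (simp add: pieces_def)

lemma glue_pw_diff:
  assumes G: "G \<in> pieces N" and N: "N \<ge> 1"
  shows "pw_diff 0 (real N) (glue G) (glue (\<lambda>i. deriv (G i)))"
    "glue G 0 = 0" "glue G (real N) = 0"
proof -
  have cov: "{0..real N} = (\<Union>i\<in>{1..N}. {real i - 1..real i})"
  proof
    show "{0..real N} \<subseteq> (\<Union>i\<in>{1..N}. {real i - 1..real i})"
      using layer_cover[OF _ N] by fastforce
    show "(\<Union>i\<in>{1..N}. {real i - 1..real i}) \<subseteq> {0..real N}"
    proof
      fix x assume "x \<in> (\<Union>i\<in>{1..N}. {real i - 1..real i})"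
      then obtain i where i: "i \<in> {1..N}" "real i - 1 \<le> x" "x \<le> real i" by auto
      then have "1 \<le> real i" "real i \<le> real N" by auto
      then show "x \<in> {0..real N}" using i by auto
    qed
  qed
  have "continuous_on (\<Union>i\<in>{1..N}. {real i - 1..real i}) (glue G)"
  proof (rule continuous_on_closed_Union)
    show "continuous_on {real i - 1..real i} (glue G)" if "i \<in> {1..N}" for i
    proof (rule continuous_on_eq)
      show "continuous_on {real i - 1..real i} (G i)"
        by (rule smooth_continuous[OF pieces_smooth[OF G]])
    qed (use glue_Icc[OF G that] in auto)
  qed auto
  moreover have "(glue G has_real_derivative glue (\<lambda>i. deriv (G i)) x) (at x)"
    if x: "x \<in> {0<..<real N} - real ` {0..N}" for x
  proof -
    obtain i where i: "i \<in> {1..N}" and xi: "x \<in> {real i - 1<..<real i}"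
      using layer_cover_interior[OF x N] by auto
    have "(G i has_real_derivative deriv (G i) x) (at x)"
      by (rule smooth_DERIV[OF pieces_smooth[OF G]])
    then have "(glue G has_real_derivative deriv (G i) x) (at x)"
      by (rule has_field_derivative_transform_within_open[OF _ open_greaterThanLessThan xi])
        (use i in \<open>auto simp: glue_Ioc\<close>)
    then show ?thesis using glue_Ioc[of i x "\<lambda>i. deriv (G i)"] i xi by auto
  qed
  ultimately show "pw_diff 0 (real N) (glue G) (glue (\<lambda>i. deriv (G i)))"
    unfolding pw_diff_def cov by (intro conjI exI[of _ "real ` {0..N}"]) (auto simp flip: cov)
  show "glue G 0 = 0" "glue G (real N) = 0"
    using G N glue_Icc[OF G, of N "real N"] by (auto simp: glue_def pieces_def)
qed

text \<open>The derivative jumps at the interfaces. Cutting it off by a bump in each layer makes it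
  smooth and compactly supported, and convergence is lost at the nodes only;
  \<open>approximable_of_derivative\<close> then treats the primitive.\<close>

lemma glue_approximable:
  assumes G: "G \<in> pieces N" and N: "N \<ge> 1"
  shows "approximable 0 (real N) (glue G) (glue (\<lambda>i. deriv (G i)))"
proof -
  define \<psi> where "\<psi> n x = (\<Sum>i\<in>{1..N}. bump n (real i - 1) (real i) x * deriv (G i) x)" for n x
  have sd: "smooth (deriv (G i))" for i by (rule smooth_deriv[OF pieces_smooth[OF G]])
  obtain C where "0 \<le> C" "\<forall>i\<in>{1..N}. \<forall>x\<in>{0..real N}. \<bar>deriv (G i) x\<bar> \<le> C"
    using smooth_family_bounded[of "\<lambda>i. deriv (G i)", OF sd] by blast
  then have C: "0 \<le> C" "\<And>i x. i \<in> {1..N} \<Longrightarrow> x \<in> {0..real N} \<Longrightarrow> \<bar>deriv (G i) x\<bar> \<le> C"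
    by auto
  show ?thesis
  proof (rule approximable_of_derivative[where S = "real ` {0..N}" and B = "real N * C"])
  show "smooth (\<psi> n)" for n
    unfolding \<psi>_def[abs_def]
    by (intro smooth_sum smooth_mult smooth_bump smooth_deriv pieces_smooth[OF G])
  have nz: "1 / real n + real i - 1 < x \<and> x < real i - 1 / real n" if "bump n (real i - 1) (real i) x \<noteq> 0" for n i x
    using bump_nonzeroD[OF that] by linarith
  have bump0: "bump 0 a b x = 0" for a b x by (simp add: bump_def flat_def)
  show "compact_in 0 (real N) (\<psi> n)" for n
  proof (cases "n = 0")
    case True
    then have "\<psi> n x = 0" for x by (simp add: \<psi>_def bump0)
    then show ?thesis unfolding compact_in_def
      using N by (intro exI[of _ "real N / 2"]) auto
  next
    case False
    have "\<psi> n x = 0" if x: "\<not> (1 / real n \<le> x \<and> x \<le> real N - 1 / real n)" for x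
      unfolding \<psi>_def
    proof (intro sum.neutral ballI)
      fix i assume "i \<in> {1..N}"
      then have i: "1 \<le> real i" "real i \<le> real N" by auto
      have "bump n (real i - 1) (real i) x = 0"
        using nz[of n i x] x i by (rule_tac ccontr) linarith
      then show "bump n (real i - 1) (real i) x * deriv (G i) x = 0" by simp
    qed
    then show ?thesis unfolding compact_in_def
      using False by (intro exI[of _ "1 / real n"] exI[of _ "real N - 1 / real n"]) auto
  qed
  show "\<bar>\<psi> n x\<bar> \<le> real N * C" for n x
  proof -
    have "\<bar>\<psi> n x\<bar> \<le> (\<Sum>i\<in>{1..N}. C)"
      unfolding \<psi>_def
    proof (intro order.trans[OF sum_abs] sum_mono)
      fix i assume i: "i \<in> {1..N}"
      show "\<bar>bump n (real i - 1) (real i) x * deriv (G i) x\<bar> \<le> C"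
      proof (cases "bump n (real i - 1) (real i) x = 0")
        case True
        then show ?thesis using C by simp
      next
        case False
        have "real i \<ge> 1" "real i \<le> real N" "0 \<le> 1 / real n" using i by auto
        then have "0 \<le> x" "x \<le> real N" using nz[OF False] by linarith+
        then have "x \<in> {0..real N}" by simp
        then have "\<bar>bump n (real i - 1) (real i) x\<bar> * \<bar>deriv (G i) x\<bar> \<le> 1 * C"
          using C(2)[OF i] by (intro mult_mono) (auto simp: bump_nonneg bump_le_1)
        then show ?thesis by (simp add: abs_mult)
      qed
    qed
    then show ?thesis by simp
  qed
  show "finite (real ` {0..N})" by simp
  show "(\<lambda>n. \<psi> n x) \<longlonglongrightarrow> glue (\<lambda>i. deriv (G i)) x" if x: "x \<in> {0<..<real N} - real ` {0..N}" for x
  proof -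
    obtain i where i: "i \<in> {1..N}" and xi: "real i - 1 < x" "x < real i"
      using layer_cover_interior[OF x N] by blast
    have "(\<lambda>n. \<psi> n x) \<longlonglongrightarrow> (\<Sum>l\<in>{1..N}. indicator {real l - 1<..<real l} x * deriv (G l) x)"
      unfolding \<psi>_def by (intro tendsto_sum tendsto_mult tendsto_const bump_tendsto)
    also have "(\<Sum>l\<in>{1..N}. indicator {real l - 1<..<real l} x * deriv (G l) x)
        = (\<Sum>l\<in>{1..N}. if l = i then deriv (G i) x else 0)"
    proof (intro sum.cong refl)
      fix l assume "l \<in> {1..N}"
      have "x \<notin> {real l - 1<..<real l}" if "l \<noteq> i"
      proof (cases "l < i")
        case True
        then have "real l + 1 \<le> real i" by linarith
        then show ?thesis using xi by auto
      next
        case False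
        then have "real i + 1 \<le> real l" using that by linarith
        then show ?thesis using xi by auto
      qed
      then show "indicator {real l - 1<..<real l} x * deriv (G l) x = (if l = i then deriv (G i) x else 0)"
        using xi by auto
    qed
    also have "\<dots> = glue (\<lambda>i. deriv (G i)) x"
      using i xi glue_Ioc[of i x "\<lambda>i. deriv (G i)"] by simp
    finally show ?thesis .
  qed
  show "pw_diff 0 (real N) (glue G) (glue (\<lambda>i. deriv (G i)))" "glue G 0 = 0" "glue G (real N) = 0"
    by (rule glue_pw_diff[OF G N])+
  qed (use N in simp)
qed

lemma smooth_approximable:
  assumes pq: "p < q" and s: "smooth s" "s p = 0" "s q = 0"
  shows "approximable p q s (deriv s)"
proof -
  define \<psi> where "\<psi> n x = bump n p q x * deriv s x" for n x
  obtain C where C: "\<And>x. x \<in> {p..q} \<Longrightarrow> \<bar>deriv s x\<bar> \<le> C"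
    using smooth_bounded_Icc[OF smooth_deriv[OF s(1)], of p q] by blast
  have C0: "0 \<le> C" using C[of p] pq by auto
  show ?thesis
  proof (rule approximable_of_derivative[where S = "{}" and B = C, OF pq])
  show "smooth (\<psi> n)" for n
    unfolding \<psi>_def[abs_def] by (intro smooth_mult smooth_bump smooth_deriv s)
  have bump0: "bump 0 a b x = 0" for a b x by (simp add: bump_def flat_def)
  show "compact_in p q (\<psi> n)" for n
  proof (cases "n = 0")
    case True
    then have "\<psi> n x = 0" for x by (simp add: \<psi>_def bump0)
    then show ?thesis unfolding compact_in_def
      using pq by (intro exI[of _ "(p + q) / 2"]) auto
  next
    case False
    have "\<psi> n x = 0" if "\<not> (p + 1 / real n \<le> x \<and> x \<le> q - 1 / real n)" for x
      using bump_nonzeroD[of n p q x] that by (force simp: \<psi>_def)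
    then show ?thesis unfolding compact_in_def
      using False by (intro exI[of _ "p + 1 / real n"] exI[of _ "q - 1 / real n"]) auto
  qed
  show "\<bar>\<psi> n x\<bar> \<le> C" for n x
  proof (cases "bump n p q x = 0")
    case True
    then show ?thesis using C0 by (simp add: \<psi>_def)
  next
    case False
    have "0 \<le> 1 / real n" by simp
    then have "p \<le> x" "x \<le> q" using bump_nonzeroD[OF False] by linarith+
    then have "x \<in> {p..q}" by simp
    then have "\<bar>bump n p q x\<bar> * \<bar>deriv s x\<bar> \<le> 1 * C"
      using C by (intro mult_mono) (auto simp: bump_nonneg bump_le_1)
    then show ?thesis by (simp add: abs_mult \<psi>_def)
  qed
  show "(\<lambda>n. \<psi> n x) \<longlonglongrightarrow> deriv s x" if "x \<in> {p<..<q} - {}" for x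
    using tendsto_mult[OF bump_tendsto[of p q x] tendsto_const[of "deriv s x"]] that by (simp add: \<psi>_def)
  show "pw_diff p q s (deriv s)"
    unfolding pw_diff_def using smooth_continuous[OF s(1)] smooth_DERIV[OF s(1)] by blast
  qed (use s in auto)
qed

section \<open>Separated functions on the layered domain\<close>

locale layers =
  fixes N :: nat and p q :: real
  assumes N: "N \<ge> 1" and pq: "p < q"
begin

sublocale rectangle 0 "real N" p q
  by unfold_locales (use N pq in auto)

lemma R_eq: "layered_domain N p q = R"
  using layered_domain_eq[OF N pq] .

lemma tens_grad:
  assumes G: "G \<in> pieces N" and s: "smooth s"
  shows "pw_gradient 0 (real N) p q (tens G s)
     (\<lambda>z. (glue (\<lambda>i. deriv (G i)) (fst z) * s (snd z), glue G (fst z) * deriv s (snd z)))"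
proof -
  let ?D = "glue (\<lambda>i. deriv (G i))"
  have sm: "\<And>i. smooth (G i)" "\<And>i. smooth (deriv (G i))"
    using pieces_smooth[OF G] smooth_deriv by auto
  have bm: "smooth f \<Longrightarrow> f \<in> borel_measurable borel" for f
    by (intro borel_measurable_continuous_onI smooth_continuous)
  have m[measurable]: "glue G \<in> borel_measurable borel" "?D \<in> borel_measurable borel"
    "s \<in> borel_measurable borel" "deriv s \<in> borel_measurable borel"
    by (rule glue_borel bm sm s smooth_deriv)+
  obtain C1 where C1: "\<forall>x\<in>{0<..<real N}. \<bar>glue G x\<bar> \<le> C1"
    using glue_bounded[of G, OF sm(1) N] by blast
  obtain C2 where C2: "\<forall>x\<in>{0<..<real N}. \<bar>?D x\<bar> \<le> C2"
    using glue_bounded[of "\<lambda>i. deriv (G i)", OF sm(2) N] by blast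
  obtain C3 where C3: "\<And>x. x \<in> {p..q} \<Longrightarrow> \<bar>s x\<bar> \<le> C3" using smooth_bounded_Icc[OF s, of p q] by blast
  obtain C4 where C4: "\<And>x. x \<in> {p..q} \<Longrightarrow> \<bar>deriv s x\<bar> \<le> C4" using smooth_bounded_Icc[OF smooth_deriv[OF s], of p q] by blast
  define C where "C = \<bar>C1\<bar> * \<bar>C3\<bar> + (\<bar>C2\<bar> * \<bar>C3\<bar> + \<bar>C1\<bar> * \<bar>C4\<bar>)"
  have bd: "\<bar>tens G s z\<bar> \<le> C \<and> norm (?D (fst z) * s (snd z), glue G (fst z) * deriv s (snd z)) \<le> C" if "z \<in> R" for z
  proof -
    have z: "fst z \<in> {0<..<real N}" "snd z \<in> {p..q}" using that by auto
    have mm: "\<bar>x * y\<bar> \<le> \<bar>A\<bar> * \<bar>B\<bar>" if "\<bar>x\<bar> \<le> A" "\<bar>y\<bar> \<le> B" for x y A B :: real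
      unfolding abs_mult using that by (intro mult_mono) auto
    have nn: "0 \<le> \<bar>C1\<bar> * \<bar>C3\<bar>" "0 \<le> \<bar>C2\<bar> * \<bar>C3\<bar>" "0 \<le> \<bar>C1\<bar> * \<bar>C4\<bar>" by auto
    have b: "\<bar>glue G (fst z) * s (snd z)\<bar> \<le> \<bar>C1\<bar> * \<bar>C3\<bar>"
       "\<bar>?D (fst z) * s (snd z)\<bar> \<le> \<bar>C2\<bar> * \<bar>C3\<bar>" "\<bar>glue G (fst z) * deriv s (snd z)\<bar> \<le> \<bar>C1\<bar> * \<bar>C4\<bar>"
      by (intro mm bspec[OF C1 z(1)] bspec[OF C2 z(1)] C3[OF z(2)] C4[OF z(2)])+
    have "norm (?D (fst z) * s (snd z), glue G (fst z) * deriv s (snd z))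
       \<le> \<bar>?D (fst z) * s (snd z)\<bar> + \<bar>glue G (fst z) * deriv s (snd z)\<bar>"
      using norm_Pair_le[of "?D (fst z) * s (snd z)" "glue G (fst z) * deriv s (snd z)"] unfolding real_norm_def .
    then show ?thesis unfolding tens_def C_def using b nn by linarith
  qed
  have pw1: "pw_diff 0 (real N) (\<lambda>x. glue G x * s y) (\<lambda>x. ?D x * s y)" for y
  proof -
    obtain S where S: "finite S" "\<And>x. x \<in> {0<..<real N} - S \<Longrightarrow> (glue G has_real_derivative ?D x) (at x)"
      and c: "continuous_on {0..real N} (glue G)"
      using glue_pw_diff(1)[OF G N] unfolding pw_diff_def by blast
    show ?thesis unfolding pw_diff_def
      using S by (intro conjI exI[of _ S] ballI continuous_on_mult c continuous_on_const DERIV_cmult_right) auto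
  qed
  have pw2: "pw_diff p q (\<lambda>y. g * s y) (\<lambda>y. g * deriv s y)" for g
    unfolding pw_diff_def using s
    by (intro conjI exI[of _ "{}"] ballI continuous_on_mult continuous_on_const smooth_continuous DERIV_cmult smooth_DERIV) auto
  have m1: "tens G s \<in> borel_measurable borel"
    unfolding tens_def[abs_def] borel_prod[symmetric] by measurable
  have m2: "(\<lambda>z. (?D (fst z) * s (snd z), glue G (fst z) * deriv s (snd z))) \<in> borel_measurable borel"
    unfolding borel_prod[symmetric] by measurable
  show ?thesis
    unfolding pw_gradient_def
    by (intro conjI exI[of _ C] ballI m1 m2) (use bd pw1 pw2 in \<open>auto simp: tens_def\<close>)
qed

lemma tens_H10:
  assumes G: "G \<in> pieces N" and s: "smooth s" "s p = 0" "s q = 0"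
  shows "tens G s \<in> H10 R"
  using H10_tensor[OF glue_approximable[OF G N] smooth_approximable[OF pq s]] tens_grad[OF G s(1)]
  unfolding tens_def[abs_def] by blast

lemma tens_weak_gradient:
  assumes G: "G \<in> pieces N" and s: "smooth s"
  shows "AE z in lebesgue_on R. weak_gradient R (tens G s) z =
     (glue (\<lambda>i. deriv (G i)) (fst z) * s (snd z), glue G (fst z) * deriv s (snd z))"
  using weak_gradient_AE(3)[OF pw_gradient_weak(2,3)[OF tens_grad[OF assms]]] N pq by simp

lemma layer_subset: "i \<in> {1..N} \<Longrightarrow> layer p q i \<subseteq> R"
  by (auto simp: layer_def)

lemma layer_sets: "layer p q i \<in> sets lebesgue"
  unfolding layer_def by (intro lmeasurable_open[THEN fmeasurableD] bounded_Times open_Times) auto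

lemma tens_weak_gradient_layer:
  assumes G: "G \<in> pieces N" and s: "smooth s" and i: "i \<in> {1..N}"
  shows "AE z in lebesgue_on (layer p q i). weak_gradient R (tens G s) z =
     (deriv (G i) (fst z) * s (snd z), G i (fst z) * deriv s (snd z))"
proof -
  have 1: "AE z in lebesgue_on (layer p q i). weak_gradient R (tens G s) z =
     (glue (\<lambda>i. deriv (G i)) (fst z) * s (snd z), glue G (fst z) * deriv s (snd z))"
    by (rule AE_lebesgue_on_subset[OF tens_weak_gradient[OF G s] layer_subset[OF i] R_sets layer_sets])
  have 2: "AE z in lebesgue_on (layer p q i). z \<in> layer p q i"
    by (rule AE_I2) simp
  from 1 2 show ?thesis
  proof eventually_elim
    case (elim z)
    then have z: "real i - 1 < fst z" "fst z \<le> real i" by (auto simp: layer_def)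
    show ?case using elim(1) i by (simp add: glue_Ioc[OF _ z])
  qed
qed

end

section \<open>Energies of separated functions\<close>

lemma tensor_integral:
  assumes f: "smooth f" and g: "smooth g"
  shows "integrable (lebesgue_on ({a<..<b} \<times> {c<..<d})) (\<lambda>z. f (fst z) * g (snd z))"
    "(LINT z|lebesgue_on ({a<..<b} \<times> {c<..<d}). f (fst z) * g (snd z)) = integral {a..b} f * integral {c..d} g"
proof -
  have bm: "smooth h \<Longrightarrow> h \<in> borel_measurable borel" for h
    by (intro borel_measurable_continuous_onI smooth_continuous)
  have hi: "smooth h \<Longrightarrow> (h has_integral integral {x..y} h) {x..y}" for h x y
    by (intro integrable_integral integrable_continuous_real smooth_continuous)
  obtain C where C: "\<And>x. x \<in> {a..b} \<Longrightarrow> \<bar>f x\<bar> \<le> C" using smooth_bounded_Icc[OF f, of a b] by blast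
  obtain C' where C': "\<And>x. x \<in> {c..d} \<Longrightarrow> \<bar>g x\<bar> \<le> C'" using smooth_bounded_Icc[OF g, of c d] by blast
  have m: "(\<lambda>z. f (fst z) * g (snd z)) \<in> borel_measurable borel"
    unfolding borel_prod[symmetric] using bm[OF f] bm[OF g] by measurable
  have "norm (f (fst z) * g (snd z)) \<le> \<bar>C\<bar> * \<bar>C'\<bar>" if "z \<in> {a<..<b} \<times> {c<..<d}" for z
  proof -
    have "fst z \<in> {a..b}" "snd z \<in> {c..d}" using that by auto
    then have "\<bar>f (fst z)\<bar> \<le> \<bar>C\<bar>" "\<bar>g (snd z)\<bar> \<le> \<bar>C'\<bar>" using C C' by fastforce+
    then show ?thesis unfolding real_norm_def abs_mult by (intro mult_mono) auto
  qed
  then show "integrable (lebesgue_on ({a<..<b} \<times> {c<..<d})) (\<lambda>z. f (fst z) * g (snd z))"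
    by (rule bounded_integrable_on[OF borel_imp_lebesgue_on[OF m] rectangle_measurable])
  show "(LINT z|lebesgue_on ({a<..<b} \<times> {c<..<d}). f (fst z) * g (snd z)) = integral {a..b} f * integral {c..d} g"
    by (rule rectangle_integral_product[OF bm[OF f] bm[OF g] C C' hi[OF f] hi[OF g]]) auto
qed

lemma integral_eq_of_antiderivative:
  fixes F :: "real \<Rightarrow> real"
  assumes "\<And>x. (F has_real_derivative f x) (at x)" "a \<le> b"
  shows "integral {a..b} f = F b - F a"
proof -
  have "(f has_integral (F b - F a)) {a..b}"
    using assms by (intro fundamental_theorem_of_calculus)
      (auto simp: has_real_derivative_iff_has_vector_derivative intro: has_vector_derivative_at_within)
  then show ?thesis by (rule integral_unique)
qed

context layers
begin

definition mode :: "nat \<Rightarrow> real" where "mode k = real k * (pi / (q - p))"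

definition sine :: "nat \<Rightarrow> real \<Rightarrow> real" where "sine k y = sin (mode k * (y - p))"

definition cosine :: "nat \<Rightarrow> real \<Rightarrow> real" where "cosine k y = cos (mode k * (y - p))"

lemma mode_pos: "k \<ge> 1 \<Longrightarrow> 0 < mode k"
  using pq by (simp add: mode_def)

lemma sine_deriv: "(sine k has_real_derivative mode k * cosine k y) (at y)"
  unfolding sine_def[abs_def] cosine_def by (auto intro!: derivative_eq_intros)

lemma cosine_deriv: "(cosine k has_real_derivative - mode k * sine k y) (at y)"
  unfolding cosine_def[abs_def] sine_def by (auto intro!: derivative_eq_intros)

lemma deriv_sine: "deriv (sine k) = (\<lambda>y. mode k * cosine k y)"
  using DERIV_imp_deriv[OF sine_deriv] by auto

lemma sine_smooth: "smooth (sine k)"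
proof -
  have "sine k = (\<lambda>y. sin (mode k * y + (- mode k * p)))" by (simp add: sine_def fun_eq_iff algebra_simps)
  then show ?thesis using smooth_affine[OF smooth_sin, of "mode k" "- mode k * p"] by simp
qed

lemma cosine_smooth: "smooth (cosine k)"
proof -
  have "cosine k = (\<lambda>y. cos (mode k * y + (- mode k * p)))" by (simp add: cosine_def fun_eq_iff algebra_simps)
  then show ?thesis using smooth_affine[OF smooth_cos, of "mode k" "- mode k * p"] by simp
qed

lemma sine_boundary: "sine k p = 0" "sine k q = 0"
proof -
  have "mode k * (q - p) = real k * pi" using pq by (simp add: mode_def)
  then show "sine k p = 0" "sine k q = 0" by (simp_all add: sine_def)
qed

text \<open>Explicit antiderivatives, whose sine factors vanish at \<open>p\<close> and
  \<open>q\<close>. The identity for the derivatives follows from the other one by partial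
  integration.\<close>

lemma sine_orthogonal:
  assumes k: "k \<ge> 1" and l: "l \<ge> 1"
  shows "integral {p..q} (\<lambda>y. sine k y * sine l y) = (if k = l then (q - p) / 2 else 0)"
    "integral {p..q} (\<lambda>y. deriv (sine k) y * deriv (sine l) y) = (if k = l then (mode k)\<^sup>2 * ((q - p) / 2) else 0)"
proof -
  have pq': "p \<le> q" using pq by simp
  have mk: "mode k \<noteq> 0" using mode_pos[OF k] by simp
  have d: "(mode k)\<^sup>2 - (mode l)\<^sup>2 \<noteq> 0" if "k \<noteq> l"
  proof -
    have "mode k \<noteq> mode l" using that pq by (simp add: mode_def)
    then show ?thesis using mode_pos[OF k] mode_pos[OF l] by (simp add: power2_eq_iff_nonneg)
  qed
  show 1: "integral {p..q} (\<lambda>y. sine k y * sine l y) = (if k = l then (q - p) / 2 else 0)"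
  proof (cases "k = l")
    case True
    have "((\<lambda>y. y / 2 - sine k y * cosine k y / (2 * mode k)) has_real_derivative sine k y * sine k y) (at y)" for y
    proof -
      have "(cosine k y)\<^sup>2 = 1 - (sine k y)\<^sup>2" by (simp add: cosine_def sine_def cos_squared_eq)
      then have e: "1 / 2 - (mode k * cosine k y * cosine k y + sine k y * (- mode k * sine k y)) / (2 * mode k)
          = sine k y * sine k y"
      proof -
        have "(mode k * cosine k y * cosine k y + sine k y * (- mode k * sine k y)) / (2 * mode k)
            = ((cosine k y)\<^sup>2 - (sine k y)\<^sup>2) / 2"
          using mk by (simp add: field_simps power2_eq_square)
        then show ?thesis
          unfolding \<open>(cosine k y)\<^sup>2 = 1 - (sine k y)\<^sup>2\<close> by (simp add: power2_eq_square field_simps)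
      qed
      have "((\<lambda>y. y / 2 - sine k y * cosine k y / (2 * mode k)) has_real_derivative
          1 / 2 - (mode k * cosine k y * cosine k y + (- mode k * sine k y) * sine k y) / (2 * mode k)) (at y)"
        by (intro DERIV_diff DERIV_cdivide DERIV_ident DERIV_mult sine_deriv cosine_deriv)
      then show ?thesis using e by (simp add: mult.commute)
    qed
    from integral_eq_of_antiderivative[OF this pq'] show ?thesis
      using True by (simp add: sine_boundary diff_divide_distrib)
  next
    case False
    \<comment> \<open>Mode \<open>k\<close> satisfies \<open>s'' = - (mode k)\<^sup>2 * s\<close>,
      so the derivative of the Wronskian of two modes is \<open>?d\<close> times their
      product.\<close>
    let ?d = "(mode k)\<^sup>2 - (mode l)\<^sup>2"
    have "((\<lambda>y. (sine k y * (mode l * cosine l y) - mode k * cosine k y * sine l y) / ?d)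
       has_real_derivative sine k y * sine l y) (at y)" for y
    proof -
      have "((\<lambda>y. (sine k y * (mode l * cosine l y) - mode k * cosine k y * sine l y) / ?d) has_real_derivative
          ((mode k * cosine k y * (mode l * cosine l y) + mode l * (- mode l * sine l y) * sine k y)
          - (mode k * (- mode k * sine k y) * sine l y + mode l * cosine l y * (mode k * cosine k y))) / ?d) (at y)"
        by (intro DERIV_diff DERIV_cdivide DERIV_cmult DERIV_mult sine_deriv cosine_deriv)
      also have "((mode k * cosine k y * (mode l * cosine l y) + mode l * (- mode l * sine l y) * sine k y)
          - (mode k * (- mode k * sine k y) * sine l y + mode l * cosine l y * (mode k * cosine k y))) / ?d
          = sine k y * sine l y"
        using d[OF False] by (simp add: divide_eq_eq) (simp add: power2_eq_square algebra_simps)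
      finally show ?thesis .
    qed
    from integral_eq_of_antiderivative[OF this pq'] show ?thesis
      using False by (simp add: sine_boundary)
  qed
  have "((\<lambda>y. mode k * cosine k y * sine l y) has_real_derivative
      deriv (sine k) y * deriv (sine l) y - (mode k)\<^sup>2 * (sine k y * sine l y)) (at y)" for y
  proof -
    have "((\<lambda>y. mode k * cosine k y * sine l y) has_real_derivative
       mode k * (- mode k * sine k y) * sine l y + mode l * cosine l y * (mode k * cosine k y)) (at y)"
      by (intro DERIV_cmult DERIV_mult sine_deriv cosine_deriv)
    then show ?thesis by (simp add: deriv_sine power2_eq_square algebra_simps)
  qed
  from integral_eq_of_antiderivative[OF this pq']
  have z: "integral {p..q} (\<lambda>y. deriv (sine k) y * deriv (sine l) y - (mode k)\<^sup>2 * (sine k y * sine l y)) = 0"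
    by (simp add: sine_boundary)
  have int: "(\<lambda>y. deriv (sine k) y * deriv (sine l) y) integrable_on {p..q}"
    "(\<lambda>y. (mode k)\<^sup>2 * (sine k y * sine l y)) integrable_on {p..q}"
    by (intro integrable_continuous_real smooth_continuous smooth_mult smooth_cmult smooth_deriv sine_smooth)+
  have "integral {p..q} (\<lambda>y. deriv (sine k) y * deriv (sine l) y)
      = integral {p..q} (\<lambda>y. (mode k)\<^sup>2 * (sine k y * sine l y))"
    using z integral_diff[OF int] by simp
  then show "integral {p..q} (\<lambda>y. deriv (sine k) y * deriv (sine l) y) = (if k = l then (mode k)\<^sup>2 * ((q - p) / 2) else 0)"
    using 1 by simp
qed

text \<open>The sines and also their derivatives are orthogonal. A layer energy of separated
  functions is thus a one-dimensional energy with the constant potential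
  \<open>(mode k)\<^sup>2\<close>, and different modes do not interact.\<close>

lemma energy_tens:
  assumes G: "G \<in> pieces N" and W: "W \<in> pieces N" and j: "j \<in> {1..N}" and k: "k \<ge> 1" and l: "l \<ge> 1"
  shows "grad_form (layer p q j) (tens G (sine k)) (tens W (sine l)) = (if k = l then
    (q - p) / 2 * (integral {real j - 1..real j} (\<lambda>x. deriv (G j) x * deriv (W j) x)
      + (mode k)\<^sup>2 * integral {real j - 1..real j} (\<lambda>x. G j x * W j x)) else 0)"
proof -
  note s = sine_smooth smooth_deriv[OF sine_smooth]
  note sG = pieces_smooth[OF G] smooth_deriv[OF pieces_smooth[OF G]]
  note sW = pieces_smooth[OF W] smooth_deriv[OF pieces_smooth[OF W]]
  note t1 = tensor_integral[OF smooth_mult[OF sG(2)[of j] sW(2)[of j]] smooth_mult[OF s(1)[of k] s(1)[of l]],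
      of "real j - 1" "real j" p q, folded layer_def]
  note t2 = tensor_integral[OF smooth_mult[OF sG(1)[of j] sW(1)[of j]] smooth_mult[OF s(2)[of k] s(2)[of l]],
      of "real j - 1" "real j" p q, folded layer_def]
  have "grad_form (layer p q j) (tens G (sine k)) (tens W (sine l))
    = (LINT z|lebesgue_on (layer p q j). weak_gradient R (tens G (sine k)) z \<bullet> weak_gradient R (tens W (sine l)) z)"
    by (simp add: grad_form_def L2_inner_def)
  also have "\<dots> = (LINT z|lebesgue_on (layer p q j).
      deriv (G j) (fst z) * deriv (W j) (fst z) * (sine k (snd z) * sine l (snd z))
      + G j (fst z) * W j (fst z) * (deriv (sine k) (snd z) * deriv (sine l) (snd z)))"
  proof (rule integral_cong_AE)
    have H: "tens G (sine k) \<in> H1 R" "tens W (sine l) \<in> H1 R"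
      using tens_H10[OF G s(1) sine_boundary] tens_H10[OF W s(1) sine_boundary] H10_H1 by auto
    show "(\<lambda>z. weak_gradient R (tens G (sine k)) z \<bullet> weak_gradient R (tens W (sine l)) z)
        \<in> borel_measurable (lebesgue_on (layer p q j))"
      using L2_measurable[OF L2_subset[OF H1_D(2)[OF H(1)] layer_subset[OF j] layer_sets R_sets]]
        L2_measurable[OF L2_subset[OF H1_D(2)[OF H(2)] layer_subset[OF j] layer_sets R_sets]] by measurable
    show "(\<lambda>z. deriv (G j) (fst z) * deriv (W j) (fst z) * (sine k (snd z) * sine l (snd z))
      + G j (fst z) * W j (fst z) * (deriv (sine k) (snd z) * deriv (sine l) (snd z)))
        \<in> borel_measurable (lebesgue_on (layer p q j))"
      using borel_measurable_integrable[OF t1(1)] borel_measurable_integrable[OF t2(1)] by (rule borel_measurable_add)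
    show "AE z in lebesgue_on (layer p q j).
      weak_gradient R (tens G (sine k)) z \<bullet> weak_gradient R (tens W (sine l)) z
      = deriv (G j) (fst z) * deriv (W j) (fst z) * (sine k (snd z) * sine l (snd z))
      + G j (fst z) * W j (fst z) * (deriv (sine k) (snd z) * deriv (sine l) (snd z))"
      using tens_weak_gradient_layer[OF G s(1)[of k] j] tens_weak_gradient_layer[OF W s(1)[of l] j]
      by eventually_elim (simp add: inner_prod_def mult_ac)
  qed
  also have "\<dots> = integral {real j - 1..real j} (\<lambda>x. deriv (G j) x * deriv (W j) x) * integral {p..q} (\<lambda>y. sine k y * sine l y)
     + integral {real j - 1..real j} (\<lambda>x. G j x * W j x) * integral {p..q} (\<lambda>y. deriv (sine k) y * deriv (sine l) y)"
    using Bochner_Integration.integral_add[OF t1(1) t2(1)] t1(2) t2(2) by simp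
  finally show ?thesis
    unfolding sine_orthogonal[OF k l] by (simp add: algebra_simps)
qed

text \<open>Green's formula: if \<open>G j\<close> solves the reduced equation, the energy is a
  boundary term and sees \<open>W\<close> only through its values at the two interfaces. This is
  what decouples interface values from layer interiors.\<close>

lemma energy_harmonic:
  assumes G: "G \<in> pieces N" and W: "W \<in> pieces N" and j: "j \<in> {1..N}" and k: "k \<ge> 1" and l: "l \<ge> 1"
    and harm: "\<And>x. (deriv (G j) has_real_derivative (mode k)\<^sup>2 * G j x) (at x)"
  shows "grad_form (layer p q j) (tens G (sine k)) (tens W (sine l)) = (if k = l then
    (q - p) / 2 * (deriv (G j) (real j) * W j (real j) - deriv (G j) (real j - 1) * W j (real j - 1)) else 0)"
proof -
  note sG = pieces_smooth[OF G] smooth_deriv[OF pieces_smooth[OF G]]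
  note sW = pieces_smooth[OF W] smooth_deriv[OF pieces_smooth[OF W]]
  have int: "(\<lambda>x. deriv (G j) x * deriv (W j) x) integrable_on {a..b}"
    "(\<lambda>x. (mode k)\<^sup>2 * (G j x * W j x)) integrable_on {a..b}" for a b
    by (intro integrable_continuous_real smooth_continuous smooth_mult smooth_cmult sG sW)+
  have "((\<lambda>x. deriv (G j) x * W j x) has_real_derivative
      deriv (G j) x * deriv (W j) x + (mode k)\<^sup>2 * (G j x * W j x)) (at x)" for x
    using DERIV_mult[OF harm[of x] smooth_DERIV[OF sW(1), of j x]] by (simp add: algebra_simps)
  from integral_eq_of_antiderivative[OF this, of "real j - 1" "real j"]
  have "integral {real j - 1..real j} (\<lambda>x. deriv (G j) x * deriv (W j) x + (mode k)\<^sup>2 * (G j x * W j x))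
     = deriv (G j) (real j) * W j (real j) - deriv (G j) (real j - 1) * W j (real j - 1)" by simp
  then have e: "integral {real j - 1..real j} (\<lambda>x. deriv (G j) x * deriv (W j) x)
      + (mode k)\<^sup>2 * integral {real j - 1..real j} (\<lambda>x. G j x * W j x)
     = deriv (G j) (real j) * W j (real j) - deriv (G j) (real j - 1) * W j (real j - 1)"
    using integral_add[OF int, of "real j - 1" "real j"] by simp
  show ?thesis
    unfolding energy_tens[OF G W j k l] e ..
qed

section \<open>Harmonic hats and their energies\<close>

definition hatp :: "nat \<Rightarrow> (nat \<Rightarrow> real) \<Rightarrow> nat \<Rightarrow> real \<Rightarrow> real" where
  "hatp k x i t = (x (i - 1) * sinh (mode k * (real i - t)) + x i * sinh (mode k * (t - (real i - 1)))) / sinh (mode k)"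

definition hatp' :: "nat \<Rightarrow> (nat \<Rightarrow> real) \<Rightarrow> nat \<Rightarrow> real \<Rightarrow> real" where
  "hatp' k x i t = mode k * (x i * cosh (mode k * (t - (real i - 1))) - x (i - 1) * cosh (mode k * (real i - t))) / sinh (mode k)"

lemma hatp_deriv: "(hatp k x i has_real_derivative hatp' k x i t) (at t)"
proof -
  have "((\<lambda>t. x (i - 1) * sinh (mode k * (real i - t)) + x i * sinh (mode k * (t - (real i - 1))))
      has_real_derivative mode k * (x i * cosh (mode k * (t - (real i - 1))) - x (i - 1) * cosh (mode k * (real i - t)))) (at t)"
    by (auto intro!: derivative_eq_intros simp: algebra_simps)
  from DERIV_cdivide[OF this, of "sinh (mode k)"] show ?thesis
    unfolding hatp_def[abs_def] hatp'_def .
qed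

lemma hatp'_deriv: "(hatp' k x i has_real_derivative (mode k)\<^sup>2 * hatp k x i t) (at t)"
proof -
  have "((\<lambda>t. mode k * (x i * cosh (mode k * (t - (real i - 1))) - x (i - 1) * cosh (mode k * (real i - t))))
      has_real_derivative (mode k)\<^sup>2 * (x (i - 1) * sinh (mode k * (real i - t)) + x i * sinh (mode k * (t - (real i - 1))))) (at t)"
    by (auto intro!: derivative_eq_intros simp: power2_eq_square algebra_simps)
  from DERIV_cdivide[OF this, of "sinh (mode k)"] show ?thesis
    unfolding hatp_def hatp'_def[abs_def] by simp
qed

lemma deriv_hatp: "deriv (hatp k x i) = hatp' k x i"
  using DERIV_imp_deriv[OF hatp_deriv] by auto

lemma hatp_smooth: "smooth (hatp k x i)"
proof (rule smooth_coinduct[of _ "{\<lambda>t. a * hatp k x i t + b * hatp' k x i t | a b. True}"])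
  show "hatp k x i \<in> {\<lambda>t. a * hatp k x i t + b * hatp' k x i t | a b. True}"
    by (intro CollectI exI[of _ 1] exI[of _ 0]) simp
next
  fix f assume "f \<in> {\<lambda>t. a * hatp k x i t + b * hatp' k x i t | a b. True}"
  then obtain a b where f: "f = (\<lambda>t. a * hatp k x i t + b * hatp' k x i t)" by blast
  have "(f has_real_derivative (b * (mode k)\<^sup>2) * hatp k x i t + a * hatp' k x i t) (at t)" for t
    using DERIV_add[OF DERIV_cmult[OF hatp_deriv, of a k x i t] DERIV_cmult[OF hatp'_deriv, of b k x i t]]
    unfolding f by (simp add: algebra_simps)
  then show "\<exists>f'\<in>{\<lambda>t. a * hatp k x i t + b * hatp' k x i t | a b. True}. \<forall>x. (f has_real_derivative f' x) (at x)"
    by (intro bexI[of _ "\<lambda>t. (b * (mode k)\<^sup>2) * hatp k x i t + a * hatp' k x i t"]) blast+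
qed

lemma hatp_nodes:
  assumes "k \<ge> 1"
  shows "hatp k x i (real i) = x i" "hatp k x i (real i - 1) = x (i - 1)"
  using mode_pos[OF assms] by (simp_all add: hatp_def)

text \<open>In layer \<open>i\<close>, \<open>hatp\<close> is the solution of the reduced equation
  with the values \<open>x (i - 1)\<close> and \<open>x i\<close> at the ends. Neighbouring layers
  share a nodal value, hence continuity.\<close>

lemma hatp_pieces:
  assumes k: "k \<ge> 1" and x: "x 0 = 0" "x N = 0"
  shows "hatp k x \<in> pieces N"
  using hatp_smooth hatp_nodes[OF k, of x] x hatp_nodes(2)[OF k, of x "Suc i" for i] hatp_nodes(2)[OF k, of x 1]
  by (auto simp: pieces_def)

lemma energy_hatp:
  assumes k: "k \<ge> 1" and x: "x 0 = 0" "x N = 0" and W: "W \<in> pieces N" and j: "j \<in> {1..N}" and l: "l \<ge> 1"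
  shows "grad_form (layer p q j) (tens (hatp k x) (sine k)) (tens W (sine l)) = (if k = l then
    (q - p) / 2 * (hatp' k x j (real j) * W j (real j) - hatp' k x j (real j - 1) * W j (real j - 1)) else 0)"
  using energy_harmonic[OF hatp_pieces[OF k x] W j k l] hatp'_deriv by (simp add: deriv_hatp)

text \<open>The energy in one adjacent layer of the hat with nodal value \<open>1\<close>: a
  diagonal entry of the Dirichlet-to-Neumann map of a layer, with \<open>(q - p) / 2\<close> coming
  from the sine. Once it is factored out, \<open>\<sigma> k\<close> is the only trace of the
  mode.\<close>

definition \<alpha> :: "nat \<Rightarrow> real" where
  "\<alpha> k = (q - p) / 2 * (mode k * cosh (mode k) / sinh (mode k))"

definition \<sigma> :: "nat \<Rightarrow> real" where "\<sigma> k = 1 / cosh (mode k)"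

text \<open>Only the fluxes at the two ends enter, that is, the Dirichlet-to-Neumann map of the
  layer. The ratio of its off-diagonal to its diagonal entries has size
  \<open>1 / cosh (mode k)\<close>, which measures the decay of the mode across a layer of width
  one.\<close>

lemma energy_hatp_hatp:
  assumes k: "k \<ge> 1" and x: "x 0 = 0" "x N = 0" and v: "v 0 = 0" "v N = 0" and j: "j \<in> {1..N}"
  shows "grad_form (layer p q j) (tens (hatp k x) (sine k)) (tens (hatp k v) (sine k)) =
    \<alpha> k * (x (j - 1) * v (j - 1) + x j * v j - \<sigma> k * (x (j - 1) * v j + x j * v (j - 1)))"
proof -
  have pos: "0 < sinh (mode k)" "0 < cosh (mode k)" using mode_pos[OF k] by simp_all
  have e: "hatp' k x j (real j) = mode k * (x j * cosh (mode k) - x (j - 1)) / sinh (mode k)"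
    "hatp' k x j (real j - 1) = mode k * (x j - x (j - 1) * cosh (mode k)) / sinh (mode k)"
    by (simp_all add: hatp'_def)
  show ?thesis
    unfolding energy_hatp[OF k x hatp_pieces[OF k v] j k] hatp_nodes[OF k] e \<alpha>_def \<sigma>_def
    using pos by (simp add: field_simps)
qed

definition hat :: "nat \<Rightarrow> nat \<Rightarrow> real \<times> real \<Rightarrow> real" where
  "hat k l = tens (hatp k (\<lambda>i. if i = l then 1 else 0)) (sine k)"

text \<open>\<open>hatp\<close> is linear in the nodal values, and in a layer it involves the two
  adjacent ones only. Values at other than interior nodes are not represented by a hat and are
  replaced by zero.\<close>

lemma hat_sum:
  "(\<Sum>i\<in>{1..<N}. x i *\<^sub>R hat k i) = tens (hatp k (\<lambda>i. if i \<in> {1..<N} then x i else 0)) (sine k)"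
proof
  fix z :: "real \<times> real"
  define j where "j = max 1 (nat \<lceil>fst z\<rceil>)"
  define A where "A = sinh (mode k * (real j - fst z)) / sinh (mode k) * sine k (snd z)"
  define B where "B = sinh (mode k * (fst z - (real j - 1))) / sinh (mode k) * sine k (snd z)"
  have t: "tens (hatp k y) (sine k) z = y (j - 1) * A + y j * B" for y
  proof -
    have "tens (hatp k y) (sine k) z = hatp k y j (fst z) * sine k (snd z)"
      by (simp only: tens_def glue_def j_def)
    then show ?thesis by (simp add: hatp_def A_def B_def add_divide_distrib algebra_simps)
  qed
  have d: "(\<Sum>i\<in>{1..<N}. x i * (if l = i then 1 else 0)) = (if l \<in> {1..<N} then x l else 0)" for l
    by (simp add: sum.delta' if_distrib cong: if_cong)
  have "(\<Sum>i\<in>{1..<N}. x i *\<^sub>R hat k i) z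
      = (\<Sum>i\<in>{1..<N}. x i * (if j - 1 = i then 1 else 0)) * A + (\<Sum>i\<in>{1..<N}. x i * (if j = i then 1 else 0)) * B"
    unfolding sum_fun_apply hat_def scaleR_fun_apply t sum_distrib_right sum.distrib[symmetric]
    by (intro sum.cong refl) (simp add: algebra_simps)
  then show "(\<Sum>i\<in>{1..<N}. x i *\<^sub>R hat k i) z = tens (hatp k (\<lambda>i. if i \<in> {1..<N} then x i else 0)) (sine k) z"
    unfolding d t .
qed

lemma hat_H10: "k \<ge> 1 \<Longrightarrow> i \<in> {1..<N} \<Longrightarrow> hat k i \<in> H10 R"
  unfolding hat_def by (intro tens_H10 hatp_pieces sine_smooth sine_boundary) auto

section \<open>Bubbles\<close>

definition Bub :: "nat \<Rightarrow> (real \<times> real \<Rightarrow> real) set" where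
  "Bub i = {b \<in> H10 R. (\<forall>j\<in>{1..N}. j \<noteq> i \<longrightarrow> (\<forall>v\<in>H10 R. grad_form (layer p q j) b v = 0))
     \<and> (\<forall>j\<in>{1..N}. \<forall>k\<ge>1. \<forall>l\<in>{1..<N}. grad_form (layer p q j) (hat k l) b = 0)}"

lemma layer_form: "j \<in> {1..N} \<Longrightarrow> psd_form (H10 R) (grad_form (layer p q j))"
  by (intro grad_form_psd_H10 layer_subset layer_sets)

text \<open>Membership in \<open>Bub i\<close> is expressed by the energy relations that the
  abstract system asks for and not by supports. These conditions are linear, so sums of bubbles over
  many modes stay in \<open>Bub i\<close>.\<close>

lemma Bub_subspace: "subspace (Bub i)"
proof (rule subspaceI)
  show "0 \<in> Bub i"
    unfolding Bub_def using layer_form hat_H10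
    by (auto simp: subspace_0[OF H10_subspace] psd_form.zero[OF layer_form] psd_form.zero_right[OF layer_form])
  show "x + y \<in> Bub i" if "x \<in> Bub i" "y \<in> Bub i" for x y
    using that layer_form hat_H10 unfolding Bub_def
    by (auto simp: subspace_add[OF H10_subspace] psd_form.add[OF layer_form] psd_form.add_right[OF layer_form])
  show "c *\<^sub>R x \<in> Bub i" if "x \<in> Bub i" for c x
    using that layer_form hat_H10 unfolding Bub_def
    by (auto simp: subspace_scale[OF H10_subspace] psd_form.scale[OF layer_form] psd_form.scale_right[OF layer_form])
qed

definition nodal :: "(nat \<Rightarrow> real \<Rightarrow> real) \<Rightarrow> nat \<Rightarrow> real" where
  "nodal G i = (if i \<in> {1..<N} then G i (real i) else 0)"

text \<open>What remains in layer \<open>i\<close> after subtracting the harmonic function with the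
  same values at both interfaces.\<close>

definition bubble :: "nat \<Rightarrow> (nat \<Rightarrow> real \<Rightarrow> real) \<Rightarrow> nat \<Rightarrow> nat \<Rightarrow> real \<Rightarrow> real" where
  "bubble k G i j = (if j = i then \<lambda>t. G i t - hatp k (nodal G) i t else (\<lambda>t. 0))"

lemma bubble_nodes:
  assumes G: "G \<in> pieces N" and k: "k \<ge> 1" and i: "i \<in> {1..N}"
  shows "bubble k G i j (real j) = 0" "bubble k G i j (real j - 1) = 0"
proof -
  have "G i (real i) = nodal G i"
    using G i by (cases "i = N") (auto simp: nodal_def pieces_def)
  moreover have "G i (real i - 1) = nodal G (i - 1)"
  proof (cases "i = 1")
    case True
    then show ?thesis using G by (simp add: nodal_def pieces_def)
  next
    case False
    then obtain l where l: "i = Suc l" "l \<in> {1..<N}" using i by (cases i) auto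
    then have "G l (real l) = G (Suc l) (real l)" using G by (simp add: pieces_def)
    then show ?thesis using l by (simp add: nodal_def)
  qed
  ultimately show "bubble k G i j (real j) = 0" "bubble k G i j (real j - 1) = 0"
    using hatp_nodes[OF k] by (auto simp: bubble_def)
qed

lemma bubble_pieces:
  assumes G: "G \<in> pieces N" and k: "k \<ge> 1" and i: "i \<in> {1..N}"
  shows "bubble k G i \<in> pieces N"
proof -
  have "smooth (bubble k G i j)" for j
    unfolding bubble_def using smooth_diff[OF pieces_smooth[OF G] hatp_smooth] smooth_const by simp
  moreover have "bubble k G i l (real l) = bubble k G i (Suc l) (real l)" for l
    using bubble_nodes(1)[OF assms, of l] bubble_nodes(2)[OF assms, of "Suc l"] by simp
  ultimately show ?thesis
    using bubble_nodes(1)[OF assms, of N] bubble_nodes(2)[OF assms, of 1] by (simp add: pieces_def)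
qed

text \<open>In the other layers the gradient vanishes. Against a hat, Green's formula leaves only
  the values of the bubble at the interfaces, and these are zero.\<close>

lemma bubble_Bub:
  assumes G: "G \<in> pieces N" and k: "k \<ge> 1" and i: "i \<in> {1..N}"
  shows "tens (bubble k G i) (sine k) \<in> Bub i"
proof -
  note bp = bubble_pieces[OF assms]
  have bH: "tens (bubble k G i) (sine k) \<in> H10 R"
    by (rule tens_H10[OF bp sine_smooth sine_boundary])
  have 1: "grad_form (layer p q j) (tens (bubble k G i) (sine k)) v = 0"
    if j: "j \<in> {1..N}" and ji: "j \<noteq> i" and v: "v \<in> H10 R" for j v
  proof -
    have "AE z in lebesgue_on (layer p q j). weak_gradient R (tens (bubble k G i) (sine k)) z = 0"
      using tens_weak_gradient_layer[OF bp sine_smooth j, of k]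
      by eventually_elim (use ji in \<open>simp add: bubble_def zero_prod_def\<close>)
    then have "AE z in lebesgue_on (layer p q j).
        weak_gradient R (tens (bubble k G i) (sine k)) z \<bullet> weak_gradient R v z = 0"
      by eventually_elim simp
    then show ?thesis
      unfolding grad_form_def L2_inner_def by (rule integral_eq_zero_AE)
  qed
  have 2: "grad_form (layer p q j) (hat m l) (tens (bubble k G i) (sine k)) = 0"
    if "j \<in> {1..N}" "m \<ge> 1" "l \<in> {1..<N}" for j m l
    unfolding hat_def using that k bubble_nodes[OF assms, of j] by (subst energy_hatp[OF _ _ _ bp]) auto
  show ?thesis unfolding Bub_def using bH 1 2 by blast
qed

text \<open>This is an equality of functions on the whole plane. To the right of \<open>N\<close>,
  \<open>glue\<close> selects pieces with index above \<open>N\<close>; bubbles and hats vanish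
  there, so \<open>G\<close> has to vanish there too.\<close>

lemma tens_decomposition:
  assumes G: "\<And>i. i > N \<Longrightarrow> G i = (\<lambda>_. 0)"
  shows "tens G (sine k) = (\<Sum>i\<in>{1..N}. tens (bubble k G i) (sine k)) + (\<Sum>i\<in>{1..<N}. nodal G i *\<^sub>R hat k i)"
proof
  fix z :: "real \<times> real"
  define j where "j = max 1 (nat \<lceil>fst z\<rceil>)"
  have t: "tens F (sine k) z = F j (fst z) * sine k (snd z)" for F
    by (simp add: tens_def glue_def j_def)
  have n: "(\<lambda>i. if i \<in> {1..<N} then nodal G i else 0) = nodal G" by (auto simp: nodal_def)
  have "(\<Sum>i\<in>{1..N}. bubble k G i j (fst z)) = (\<Sum>i\<in>{1..N}. if i = j then G j (fst z) - hatp k (nodal G) j (fst z) else 0)"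
    by (intro sum.cong refl) (auto simp: bubble_def)
  also have "\<dots> = G j (fst z) - hatp k (nodal G) j (fst z)"
  proof (cases "j \<le> N")
    case True
    moreover have "1 \<le> j" by (simp add: j_def)
    ultimately show ?thesis by (simp add: sum.delta)
  next
    case False
    then have "nodal G (j - 1) = 0" "nodal G j = 0" by (auto simp: nodal_def)
    then have "hatp k (nodal G) j (fst z) = 0" by (simp add: hatp_def)
    then show ?thesis using False G[of j] by (simp add: sum.delta)
  qed
  finally have b: "(\<Sum>i\<in>{1..N}. bubble k G i j (fst z)) = G j (fst z) - hatp k (nodal G) j (fst z)" .
  show "tens G (sine k) z = ((\<Sum>i\<in>{1..N}. tens (bubble k G i) (sine k)) + (\<Sum>i\<in>{1..<N}. nodal G i *\<^sub>R hat k i)) z"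
    unfolding hat_sum n plus_fun_apply sum_fun_apply t sum_distrib_right[symmetric] b by (simp add: algebra_simps)
qed

section \<open>Density of separated functions\<close>

text \<open>Cosines in place of sines: they contain the constants as \<open>k = 0\<close>, and
  products of cosines are sums of cosines, which gives an algebra for Stone-Weierstrass. Integration
  in the second variable turns them into sines.\<close>

definition trig :: "(real \<times> real \<Rightarrow> real) \<Rightarrow> bool" where
  "trig f \<longleftrightarrow> (\<exists>K P. (\<forall>k. smooth (P k)) \<and> f = (\<lambda>z. \<Sum>k\<le>K. P k (fst z) * cosine k (snd z)))"

lemma trig_base:
  assumes "smooth G"
  shows "trig (\<lambda>z. G (fst z) * cosine k (snd z))"
  unfolding trig_def
proof (intro exI conjI allI)
  show "smooth (if l = k then G else (\<lambda>_. 0))" for l using assms smooth_const by simp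
  show "(\<lambda>z. G (fst z) * cosine k (snd z)) = (\<lambda>z. \<Sum>l\<le>k. (if l = k then G else (\<lambda>_. 0)) (fst z) * cosine l (snd z))"
    by (simp add: fun_eq_iff if_distribR if_distrib[of "\<lambda>x. x * _"] sum.delta cong: if_cong)
qed

lemma trig_add:
  assumes "trig f" "trig g"
  shows "trig (\<lambda>z. f z + g z)"
proof -
  obtain K P where P: "\<forall>k. smooth (P k)" "f = (\<lambda>z. \<Sum>k\<le>K. P k (fst z) * cosine k (snd z))"
    using assms(1) unfolding trig_def by blast
  obtain L Q where Q: "\<forall>k. smooth (Q k)" "g = (\<lambda>z. \<Sum>k\<le>L. Q k (fst z) * cosine k (snd z))"
    using assms(2) unfolding trig_def by blast
  define S where "S k x = (if k \<le> K then P k x else 0) + (if k \<le> L then Q k x else 0)" for k x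
  have "smooth (S k)" for k
  proof -
    have "smooth (\<lambda>x. if k \<le> K then P k x else 0)" using P(1) smooth_const[of 0] by (cases "k \<le> K") simp_all
    moreover have "smooth (\<lambda>x. if k \<le> L then Q k x else 0)" using Q(1) smooth_const[of 0] by (cases "k \<le> L") simp_all
    ultimately show ?thesis unfolding S_def[abs_def] by (rule smooth_add)
  qed
  moreover have "f z + g z = (\<Sum>k\<le>max K L. S k (fst z) * cosine k (snd z))" for z
  proof -
    have "f z = (\<Sum>k\<le>max K L. (if k \<le> K then P k (fst z) else 0) * cosine k (snd z))"
      unfolding P(2) by (rule sum.mono_neutral_cong_left) auto
    moreover have "g z = (\<Sum>k\<le>max K L. (if k \<le> L then Q k (fst z) else 0) * cosine k (snd z))"
      unfolding Q(2) by (rule sum.mono_neutral_cong_left) auto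
    ultimately show ?thesis by (simp add: S_def sum.distrib[symmetric] distrib_right)
  qed
  ultimately show ?thesis
    unfolding trig_def by (intro exI[of _ "max K L"] exI[of _ S]) (auto simp: fun_eq_iff)
qed

lemma trig_0: "trig (\<lambda>z. 0)"
  using trig_base[OF smooth_const[of 0]] by simp

lemma trig_sum: "finite I \<Longrightarrow> (\<And>i. i \<in> I \<Longrightarrow> trig (f i)) \<Longrightarrow> trig (\<lambda>z. \<Sum>i\<in>I. f i z)"
  by (induction I rule: finite_induct) (auto intro: trig_0 trig_add)

lemma cosine_product: "cosine k y * cosine l y = (cosine (k + l) y + cosine (if l \<le> k then k - l else l - k) y) / 2"
proof -
  have a: "mode (k + l) * (y - p) = mode k * (y - p) + mode l * (y - p)"
    by (simp add: mode_def algebra_simps add_divide_distrib)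
  have b: "cosine (if l \<le> k then k - l else l - k) y = cos (mode k * (y - p) - mode l * (y - p))"
  proof (cases "l \<le> k")
    case True
    have "mode (k - l) * (y - p) = mode k * (y - p) - mode l * (y - p)"
      using True by (simp add: mode_def of_nat_diff algebra_simps diff_divide_distrib)
    then show ?thesis using True by (simp add: cosine_def)
  next
    case False
    have "mode (l - k) * (y - p) = - (mode k * (y - p) - mode l * (y - p))"
      using False by (simp add: mode_def of_nat_diff algebra_simps diff_divide_distrib)
    then have "cosine (l - k) y = cos (- (mode k * (y - p) - mode l * (y - p)))"
      unfolding cosine_def by (rule arg_cong)
    then show ?thesis using False by (simp only: cos_minus) simp
  qed
  show ?thesis unfolding b unfolding cosine_def a by (simp add: cos_add cos_diff)
qed

lemma trig_mult:
  assumes "trig f" "trig g"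
  shows "trig (\<lambda>z. f z * g z)"
proof -
  obtain K P where P: "\<forall>k. smooth (P k)" "f = (\<lambda>z. \<Sum>k\<le>K. P k (fst z) * cosine k (snd z))"
    using assms(1) unfolding trig_def by blast
  obtain L Q where Q: "\<forall>k. smooth (Q k)" "g = (\<lambda>z. \<Sum>k\<le>L. Q k (fst z) * cosine k (snd z))"
    using assms(2) unfolding trig_def by blast
  have "trig (\<lambda>z. (P k (fst z) * cosine k (snd z)) * (Q l (fst z) * cosine l (snd z)))" for k l
  proof -
    have sm: "smooth (\<lambda>x. 1 / 2 * (P k x * Q l x))" using P Q by (intro smooth_cmult smooth_mult) auto
    have "(\<lambda>z. (P k (fst z) * cosine k (snd z)) * (Q l (fst z) * cosine l (snd z)))
      = (\<lambda>z. (1 / 2 * (P k (fst z) * Q l (fst z))) * cosine (k + l) (snd z)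
          + (1 / 2 * (P k (fst z) * Q l (fst z))) * cosine (if l \<le> k then k - l else l - k) (snd z))"
    proof
      fix z
      have "(P k (fst z) * cosine k (snd z)) * (Q l (fst z) * cosine l (snd z))
        = (P k (fst z) * Q l (fst z)) * (cosine k (snd z) * cosine l (snd z))" by (simp only: mult_ac)
      then show "(P k (fst z) * cosine k (snd z)) * (Q l (fst z) * cosine l (snd z))
        = (1 / 2 * (P k (fst z) * Q l (fst z))) * cosine (k + l) (snd z)
          + (1 / 2 * (P k (fst z) * Q l (fst z))) * cosine (if l \<le> k then k - l else l - k) (snd z)"
        unfolding cosine_product by (simp only:) (simp add: field_simps)
    qed
    moreover have "trig (\<lambda>z. (1 / 2 * (P k (fst z) * Q l (fst z))) * cosine (k + l) (snd z)
          + (1 / 2 * (P k (fst z) * Q l (fst z))) * cosine (if l \<le> k then k - l else l - k) (snd z))"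
      by (intro trig_add trig_base[OF sm])
    ultimately show ?thesis by simp
  qed
  then have "trig (\<lambda>z. \<Sum>k\<le>K. \<Sum>l\<le>L. (P k (fst z) * cosine k (snd z)) * (Q l (fst z) * cosine l (snd z)))"
    by (intro trig_sum) auto
  then show ?thesis unfolding P(2) Q(2) by (simp add: sum_product)
qed

lemma trig_continuous:
  assumes "trig f"
  shows "continuous_on S f"
proof -
  obtain K P where P: "\<forall>k. smooth (P k)" "f = (\<lambda>z. \<Sum>k\<le>K. P k (fst z) * cosine k (snd z))"
    using assms unfolding trig_def by blast
  show ?thesis unfolding P(2)
    by (intro continuous_on_sum continuous_on_mult
        continuous_on_compose2[OF smooth_continuous[of _ UNIV] continuous_on_fst[OF continuous_on_id]]
        continuous_on_compose2[OF smooth_continuous[of _ UNIV] continuous_on_snd[OF continuous_on_id]])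
      (use P(1) cosine_smooth in auto)
qed

text \<open>Points are separated by the first coordinate or else by \<open>cosine 1\<close>, which
  is injective on \<open>[p, q]\<close> because its argument stays in
  \<open>[0, pi]\<close>.\<close>

lemma trig_dense:
  assumes f: "continuous_on ({0..real N} \<times> {p..q}) f" and \<epsilon>: "0 < \<epsilon>"
  shows "\<exists>g. trig g \<and> (\<forall>z\<in>{0..real N} \<times> {p..q}. \<bar>f z - g z\<bar> < \<epsilon>)"
proof (rule Stone_Weierstrass_HOL[OF _ _ _ _ _ _ f \<epsilon>])
  show "compact ({0..real N} \<times> {p..q})" by (intro compact_Times compact_Icc)
  show "trig (\<lambda>_. c)" for c
    using trig_base[OF smooth_const[of c], of 0] by (simp add: cosine_def mode_def)
  show "continuous_on ({0..real N} \<times> {p..q}) g" if "trig g" for g using that by (rule trig_continuous)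
  show "trig (\<lambda>x. g x + h x)" if "trig g \<and> trig h" for g h using that trig_add by blast
  show "trig (\<lambda>x. g x * h x)" if "trig g \<and> trig h" for g h using that trig_mult by blast
  fix z w :: "real \<times> real"
  assume zw: "z \<in> {0..real N} \<times> {p..q} \<and> w \<in> {0..real N} \<times> {p..q} \<and> z \<noteq> w"
  show "\<exists>g. trig g \<and> g z \<noteq> g w"
  proof (cases "fst z = fst w")
    case False
    have "trig (\<lambda>z. fst z * cosine 0 (snd z))" by (rule trig_base[OF smooth_id])
    then show ?thesis using False
      by (intro exI[of _ "\<lambda>z. fst z * cosine 0 (snd z)"]) (simp add: cosine_def mode_def)
  next
    case True
    then have ne: "snd z \<noteq> snd w" using zw by (simp add: prod_eq_iff)
    have range: "0 \<le> mode 1 * (y - p) \<and> mode 1 * (y - p) \<le> pi" if "y \<in> {p..q}" for y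
      using that pq by (simp add: mode_def divide_simps mult_left_mono)
    have "cosine 1 (snd z) \<noteq> cosine 1 (snd w)"
    proof
      assume c: "cosine 1 (snd z) = cosine 1 (snd w)"
      have "snd z \<in> {p..q}" "snd w \<in> {p..q}" using zw by auto
      note r = range[OF this(1)] range[OF this(2)]
      have "mode 1 * (snd z - p) = mode 1 * (snd w - p)"
        by (rule cos_inj_pi) (use r c[unfolded cosine_def] in blast)+
      then show False using ne mode_pos[of 1] by simp
    qed
    moreover have "trig (\<lambda>z. 1 * cosine 1 (snd z))" by (rule trig_base[OF smooth_const])
    ultimately show ?thesis by (intro exI[of _ "\<lambda>z. 1 * cosine 1 (snd z)"]) simp
  qed
qed

section \<open>Approximation of test functions by sine sums with first derivatives\<close>

lemma pd1_as_integral: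
  assumes \<phi>: "\<phi> \<in> test_functions R" and y: "p \<le> y"
  shows "pd1 \<phi> (x, y) = integral {p..y} (\<lambda>s. pd1 (pd2 \<phi>) (x, s))"
proof -
  have Ck: "\<forall>k. Ck k \<phi>" using test_functions_Ck[OF \<phi>] by blast
  then have Ck2: "\<forall>k. Ck k (pd2 \<phi>)" using Ck_pd(2) by blast
  then have Ck12: "Ck 0 (pd1 (pd2 \<phi>))" using Ck_pd(1) by blast
  have \<phi>I: "integral (cbox p y) (\<lambda>s. pd2 \<phi> (x, s)) = \<phi> (x, y)" for x
  proof -
    have "integral {p..y} (\<lambda>s. pd2 \<phi> (x, s)) = \<phi> (x, y) - \<phi> (x, p)"
      by (rule integral_eq_of_antiderivative[OF pd2_deriv[OF Ck] y])
    moreover have "\<phi> (x, p) = 0" by (rule test_functions_outside[OF \<phi>]) simp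
    ultimately show ?thesis by simp
  qed
  \<comment> \<open>Differentiation under the integral of \<open>pd2 \<phi>\<close>. That integral
    reproduces \<open>\<phi>\<close>, because \<open>\<phi>\<close> vanishes on the edge
    \<open>y = p\<close>.\<close>
  have "((\<lambda>x. integral (cbox p y) (\<lambda>s. pd2 \<phi> (x, s))) has_field_derivative
      integral (cbox p y) (\<lambda>s. pd1 (pd2 \<phi>) (x, s))) (at x within UNIV)"
  proof (rule leibniz_rule_field_derivative)
    show "((\<lambda>x. pd2 \<phi> (x, t)) has_real_derivative pd1 (pd2 \<phi>) (x, t)) (at x within UNIV)" for x t
      using pd1_deriv[OF Ck2] by simp
    have "continuous_on UNIV (pd2 \<phi>)" using Ck2 Ck_continuous by blast
    then show "(\<lambda>s. pd2 \<phi> (x, s)) integrable_on cbox p y" for x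
      by (intro integrable_continuous continuous_on_compose2[of UNIV "pd2 \<phi>" _ "Pair x"] continuous_intros) auto
    have "(\<lambda>(x, t). pd1 (pd2 \<phi>) (x, t)) = pd1 (pd2 \<phi>)" by auto
    then show "continuous_on (UNIV \<times> cbox p y) (\<lambda>(x, t). pd1 (pd2 \<phi>) (x, t))"
      using Ck_continuous[OF Ck12] by simp
  qed auto
  then have "((\<lambda>x. \<phi> (x, y)) has_real_derivative integral {p..y} (\<lambda>s. pd1 (pd2 \<phi>) (x, s))) (at x)"
    unfolding \<phi>I by simp
  then show ?thesis using DERIV_unique[OF pd1_deriv[OF Ck]] by blast
qed

lemma pd_boundary:
  assumes \<phi>: "\<phi> \<in> test_functions R"
  shows "pd2 \<phi> (0, y) = 0" "pd2 \<phi> (real N, y) = 0" "pd1 \<phi> (x, q) = 0"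
proof -
  have Ck: "\<forall>k. Ck k \<phi>" using test_functions_Ck[OF \<phi>] by blast
  have z: "\<phi> (0, y) = 0" "\<phi> (real N, y) = 0" "\<phi> (y, q) = 0" for y
    by (rule test_functions_outside[OF \<phi>], simp)+
  show "pd2 \<phi> (0, y) = 0" "pd2 \<phi> (real N, y) = 0" "pd1 \<phi> (x, q) = 0"
    using DERIV_unique[OF pd2_deriv[OF Ck, of 0 y]] DERIV_unique[OF pd2_deriv[OF Ck, of "real N" y]]
      DERIV_unique[OF pd1_deriv[OF Ck, of q x]] unfolding z by (auto intro: DERIV_const)
qed

text \<open>The mixed derivative is approximated by a cosine sum; removing its means in both
  directions, which are small because those of the mixed derivative vanish, and integrating twice
  yields a sine sum vanishing on the boundary and close to \<open>\<phi>\<close> in \<open>C\<^sup>1\<close>.\<close>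

lemma sine_sum_approximation:
  assumes \<phi>: "\<phi> \<in> test_functions R" and \<delta>: "0 < \<delta>"
  shows "\<exists>K g. (\<forall>k. smooth (g k) \<and> g k 0 = 0 \<and> g k (real N) = 0) \<and> (\<forall>z\<in>R.
     \<bar>pd1 \<phi> z - (\<Sum>k\<in>{1..K}. deriv (g k) (fst z) * sine k (snd z))\<bar> \<le> \<delta> \<and>
     \<bar>pd2 \<phi> z - (\<Sum>k\<in>{1..K}. g k (fst z) * deriv (sine k) (snd z))\<bar> \<le> \<delta>)"
proof -
  have Ck: "\<forall>k. Ck k \<phi>" using test_functions_Ck[OF \<phi>] by blast
  then have Ck2: "\<forall>k. Ck k (pd2 \<phi>)" using Ck_pd(2) by blast
  then have Ck12: "Ck 0 (pd1 (pd2 \<phi>))" using Ck_pd(1) by blast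
  define \<psi> where "\<psi> = pd1 (pd2 \<phi>)"
  have \<psi>c: "continuous_on S \<psi>" for S unfolding \<psi>_def by (rule Ck_continuous[OF Ck12])
  have \<psi>y: "continuous_on S (\<lambda>s. \<psi> (x, s))" for S x
    by (rule continuous_on_compose2[OF \<psi>c[of UNIV]]) (auto intro!: continuous_intros)
  have \<psi>D: "((\<lambda>x. pd2 \<phi> (x, y)) has_real_derivative \<psi> (x, y)) (at x)" for x y
    unfolding \<psi>_def by (rule pd1_deriv[OF Ck2])
  have Npos: "0 < real N" using N by simp
  \<comment> \<open>Both final errors are at most \<open>4 * \<epsilon>\<close> times the length of
    a side of the rectangle.\<close>
  define \<epsilon> where "\<epsilon> = \<delta> / (4 * (q - p) + 4 * real N)"
  have \<epsilon>: "0 < \<epsilon>" "4 * \<epsilon> * (q - p) \<le> \<delta>" "4 * \<epsilon> * real N \<le> \<delta>"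
  proof -
    have s: "0 < 4 * (q - p) + 4 * real N" using pq Npos by simp
    then show e: "0 < \<epsilon>" using \<delta> by (simp add: \<epsilon>_def)
    have "\<epsilon> * (4 * (q - p) + 4 * real N) = \<delta>" using s by (simp add: \<epsilon>_def)
    moreover have "0 \<le> 4 * \<epsilon> * real N" "0 \<le> 4 * \<epsilon> * (q - p)" using e pq by auto
    ultimately show "4 * \<epsilon> * (q - p) \<le> \<delta>" "4 * \<epsilon> * real N \<le> \<delta>" by (simp_all add: algebra_simps)
  qed
  obtain K P where P: "\<forall>k. smooth (P k)"
    and app: "\<And>z. z \<in> {0..real N} \<times> {p..q} \<Longrightarrow> \<bar>\<psi> z - (\<Sum>k\<le>K. P k (fst z) * cosine k (snd z))\<bar> < \<epsilon>"
    using trig_dense[OF \<psi>c \<epsilon>(1)] unfolding trig_def by blast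
  have split: "(\<Sum>k\<le>K. P k x * cosine k y) = P 0 x + (\<Sum>k\<in>{1..K}. P k x * cosine k y)" for x y
  proof -
    have "{..K} = insert 0 {1..K}" by auto
    then show ?thesis by (simp add: cosine_def mode_def)
  qed
  have cint: "((\<lambda>y. \<Sum>k\<in>{1..K}. c k * (sine k y / mode k)) has_real_derivative
      (\<Sum>k\<in>{1..K}. c k * cosine k y)) (at y)" for c y
  proof (intro DERIV_sum DERIV_cmult)
    fix k assume "k \<in> {1..K}"
    then have "mode k \<noteq> 0" using mode_pos[of k] by auto
    then show "((\<lambda>y. sine k y / mode k) has_real_derivative cosine k y) (at y)"
      using DERIV_cdivide[OF sine_deriv[of k y], of "mode k"] by simp
  qed
  have ccont: "continuous_on S (\<lambda>y. \<Sum>k\<in>{1..K}. c k * cosine k y)" for c S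
    by (intro continuous_on_sum continuous_on_mult continuous_on_const smooth_continuous cosine_smooth)
  have I\<psi>: "integral {p..y} (\<lambda>s. \<psi> (x, s) - (c0 + (\<Sum>k\<in>{1..K}. c k * cosine k s)))
      = pd1 \<phi> (x, y) - (c0 * (y - p) + (\<Sum>k\<in>{1..K}. c k * (sine k y / mode k)))" if y: "p \<le> y" for x y c0 c
  proof -
    have "((\<lambda>y. c0 * y + (\<Sum>k\<in>{1..K}. c k * (sine k y / mode k))) has_real_derivative
       c0 * 1 + (\<Sum>k\<in>{1..K}. c k * cosine k y)) (at y)" for y
      by (intro DERIV_add DERIV_cmult DERIV_ident cint)
    from integral_eq_of_antiderivative[OF this y]
    have "integral {p..y} (\<lambda>s. c0 + (\<Sum>k\<in>{1..K}. c k * cosine k s)) = c0 * (y - p) + (\<Sum>k\<in>{1..K}. c k * (sine k y / mode k))"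
      by (simp add: sine_boundary algebra_simps)
    moreover have "integral {p..y} (\<lambda>s. \<psi> (x, s) - (c0 + (\<Sum>k\<in>{1..K}. c k * cosine k s)))
       = integral {p..y} (\<lambda>s. \<psi> (x, s)) - integral {p..y} (\<lambda>s. c0 + (\<Sum>k\<in>{1..K}. c k * cosine k s))"
      by (intro integral_diff integrable_continuous_real \<psi>y continuous_on_add continuous_on_const ccont)
    ultimately show ?thesis using pd1_as_integral[OF \<phi> y] by (simp add: \<psi>_def)
  qed
  have Ibound: "\<bar>pd1 \<phi> (x, y) - (c0 * (y - p) + (\<Sum>k\<in>{1..K}. c k * (sine k y / mode k)))\<bar> \<le> B * (y - p)"
    if y: "p \<le> y" and B: "\<And>s. s \<in> {p..y} \<Longrightarrow> \<bar>\<psi> (x, s) - (c0 + (\<Sum>k\<in>{1..K}. c k * cosine k s))\<bar> \<le> B" for x y c0 c B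
  proof -
    have "norm (integral {p..y} (\<lambda>s. \<psi> (x, s) - (c0 + (\<Sum>k\<in>{1..K}. c k * cosine k s)))) \<le> B * (y - p)"
      using y B by (intro integral_bound continuous_on_diff \<psi>y continuous_on_add continuous_on_const ccont) auto
    then show ?thesis unfolding I\<psi>[OF y] by simp
  qed
  have P0: "\<bar>P 0 x\<bar> \<le> \<epsilon>" if x: "x \<in> {0..real N}" for x
  proof -
    have "\<bar>pd1 \<phi> (x, q) - (P 0 x * (q - p) + (\<Sum>k\<in>{1..K}. P k x * (sine k q / mode k)))\<bar> \<le> \<epsilon> * (q - p)"
      using app[of "(x, s)" for s] x pq by (intro Ibound) (auto simp: split less_imp_le)
    then have "\<bar>P 0 x\<bar> * (q - p) \<le> \<epsilon> * (q - p)"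
      using pq by (simp add: sine_boundary pd_boundary[OF \<phi>] abs_mult)
    then show ?thesis using pq by simp
  qed
  have app1: "\<bar>\<psi> (x, y) - (\<Sum>k\<in>{1..K}. P k x * cosine k y)\<bar> \<le> 2 * \<epsilon>" if "x \<in> {0..real N}" "y \<in> {p..q}" for x y
    using app[of "(x, y)"] P0[of x] that by (simp add: split)
  have "\<exists>F. \<forall>x. (F has_real_derivative P k x) (at x)" for k
    using smooth_antiderivative[of "P k"] P by metis
  then obtain F where F: "\<And>k x. (F k has_real_derivative P k x) (at x)" by metis
  \<comment> \<open>Subtracting the mean of \<open>P k\<close> makes the antiderivative vanish at
    \<open>real N\<close> as well as at \<open>0\<close>.\<close>
  define m where "m k = (F k (real N) - F k 0) / real N" for k
  define f where "f k x = F k x - F k 0 - m k * x" for k x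
  have fD: "(f k has_real_derivative P k x - m k) (at x)" for k x
  proof -
    have "((\<lambda>x. F k x - F k 0 - m k * x) has_real_derivative P k x - 0 - m k * 1) (at x)"
      by (intro DERIV_diff DERIV_cmult DERIV_ident DERIV_const F)
    then show ?thesis by (simp add: f_def[abs_def])
  qed
  have f0: "f k 0 = 0" "f k (real N) = 0" for k using Npos by (simp_all add: f_def m_def)
  have fs: "smooth (f k)" for k
  proof (rule smoothI_deriv[OF fD])
    show "smooth (\<lambda>x. P k x - m k)" by (rule smooth_diff[OF _ smooth_const]) (use P in blast)
  qed
  have bound: "\<bar>G x - G 0\<bar> \<le> B * x" if "\<And>t. (G has_real_derivative h t) (at t)"
    "\<And>t. t \<in> {0..x} \<Longrightarrow> \<bar>h t\<bar> \<le> B" "0 \<le> x" for G h B x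
  proof -
    have "norm (G x - G 0) \<le> B * norm (x - 0)"
      by (rule field_differentiable_bound[of "{0..x}" G h])
        (use that in \<open>auto intro: has_field_derivative_at_within\<close>)
    then show ?thesis using that(3) by simp
  qed
  \<comment> \<open>The single means \<open>m k\<close> are not controlled, only their cosine sum:
    it is the mean in the first variable of an approximation to the mixed derivative, whose own mean
    vanishes because \<open>pd2 \<phi>\<close> is zero on both vertical edges.\<close>
  have r: "\<bar>\<Sum>k\<in>{1..K}. m k * cosine k y\<bar> \<le> 2 * \<epsilon>" if y: "y \<in> {p..q}" for y
  proof -
    have "\<bar>(pd2 \<phi> (real N, y) - (\<Sum>k\<in>{1..K}. F k (real N) * cosine k y))
        - (pd2 \<phi> (0, y) - (\<Sum>k\<in>{1..K}. F k 0 * cosine k y))\<bar> \<le> 2 * \<epsilon> * real N"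
    proof (rule bound)
      show "((\<lambda>x. pd2 \<phi> (x, y) - (\<Sum>k\<in>{1..K}. F k x * cosine k y)) has_real_derivative
          \<psi> (t, y) - (\<Sum>k\<in>{1..K}. P k t * cosine k y)) (at t)" for t
        by (intro DERIV_diff \<psi>D DERIV_sum DERIV_cmult_right F)
    qed (use app1 y in auto)
    moreover have "(\<Sum>k\<in>{1..K}. F k (real N) * cosine k y) - (\<Sum>k\<in>{1..K}. F k 0 * cosine k y)
        = real N * (\<Sum>k\<in>{1..K}. m k * cosine k y)"
      unfolding sum_subtractf[symmetric] sum_distrib_left
      using Npos by (intro sum.cong refl) (simp add: m_def field_simps)
    ultimately have "\<bar>real N * (\<Sum>k\<in>{1..K}. m k * cosine k y)\<bar> \<le> 2 * \<epsilon> * real N"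
      unfolding pd_boundary[OF \<phi>] by linarith
    then have "real N * \<bar>\<Sum>k\<in>{1..K}. m k * cosine k y\<bar> \<le> real N * (2 * \<epsilon>)"
      unfolding abs_mult by (simp add: mult.commute)
    then show ?thesis using Npos by (simp only: mult_le_cancel_left_pos)
  qed
  have app2: "\<bar>\<psi> (x, y) - (\<Sum>k\<in>{1..K}. (P k x - m k) * cosine k y)\<bar> \<le> 4 * \<epsilon>"
    if "x \<in> {0..real N}" "y \<in> {p..q}" for x y
  proof -
    have "(\<Sum>k\<in>{1..K}. (P k x - m k) * cosine k y) = (\<Sum>k\<in>{1..K}. P k x * cosine k y) - (\<Sum>k\<in>{1..K}. m k * cosine k y)"
      by (simp add: left_diff_distrib sum_subtractf)
    then show ?thesis using app1[OF that] r[OF that(2)] by linarith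
  qed
  \<comment> \<open>Integrating the cosine in the second variable divides by its frequency.\<close>
  define g where "g k x = 1 / mode k * f k x" for k x
  have g: "smooth (g k)" "g k 0 = 0" "g k (real N) = 0" for k
    unfolding g_def[abs_def] using smooth_cmult[OF fs, of "1 / mode k" k] by (simp_all add: f0)
  have dg: "deriv (g k) x = (P k x - m k) / mode k" for k x
    using DERIV_imp_deriv[OF DERIV_cmult[OF fD[of k x], of "1 / mode k"]] unfolding g_def[abs_def] by simp
  have "\<bar>pd1 \<phi> z - (\<Sum>k\<in>{1..K}. deriv (g k) (fst z) * sine k (snd z))\<bar> \<le> \<delta> \<and>
     \<bar>pd2 \<phi> z - (\<Sum>k\<in>{1..K}. g k (fst z) * deriv (sine k) (snd z))\<bar> \<le> \<delta>" if z: "z \<in> R" for z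
  proof
    obtain x y where xy: "z = (x, y)" "0 < x" "x < real N" "p < y" "y < q" using z by (cases z) auto
    have "\<bar>pd1 \<phi> (x, y) - (0 * (y - p) + (\<Sum>k\<in>{1..K}. (P k x - m k) * (sine k y / mode k)))\<bar> \<le> 4 * \<epsilon> * (y - p)"
      using app2[of x] xy by (intro Ibound) auto
    also have "\<dots> \<le> 4 * \<epsilon> * (q - p)" using xy \<epsilon> by (intro mult_left_mono) auto
    also have "\<dots> \<le> \<delta>" by (rule \<epsilon>)
    finally show "\<bar>pd1 \<phi> z - (\<Sum>k\<in>{1..K}. deriv (g k) (fst z) * sine k (snd z))\<bar> \<le> \<delta>"
      by (simp add: xy(1) dg)
    have "\<bar>(pd2 \<phi> (x, y) - (\<Sum>k\<in>{1..K}. f k x * cosine k y))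
        - (pd2 \<phi> (0, y) - (\<Sum>k\<in>{1..K}. f k 0 * cosine k y))\<bar> \<le> 4 * \<epsilon> * x"
    proof (rule bound)
      show "((\<lambda>x. pd2 \<phi> (x, y) - (\<Sum>k\<in>{1..K}. f k x * cosine k y)) has_real_derivative
          \<psi> (t, y) - (\<Sum>k\<in>{1..K}. (P k t - m k) * cosine k y)) (at t)" for t
        by (intro DERIV_diff \<psi>D DERIV_sum DERIV_cmult_right fD)
    qed (use app2 xy in auto)
    also have "\<dots> \<le> 4 * \<epsilon> * real N" using xy \<epsilon> by (intro mult_left_mono) auto
    also have "\<dots> \<le> \<delta>" by (rule \<epsilon>)
    finally have "\<bar>pd2 \<phi> (x, y) - (\<Sum>k\<in>{1..K}. f k x * cosine k y)\<bar> \<le> \<delta>"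
      by (simp add: pd_boundary[OF \<phi>] f0)
    moreover have "(\<Sum>k\<in>{1..K}. g k x * deriv (sine k) y) = (\<Sum>k\<in>{1..K}. f k x * cosine k y)"
    proof (intro sum.cong refl)
      fix k assume "k \<in> {1..K}"
      then have "mode k \<noteq> 0" using mode_pos[of k] by auto
      then show "g k x * deriv (sine k) y = f k x * cosine k y" by (simp add: g_def deriv_sine)
    qed
    ultimately show "\<bar>pd2 \<phi> z - (\<Sum>k\<in>{1..K}. g k (fst z) * deriv (sine k) (snd z))\<bar> \<le> \<delta>"
      by (simp add: xy(1))
  qed
  then show ?thesis using g by (intro exI[of _ K] exI[of _ g]) blast
qed

text \<open>One function used as the piece of every layer. It is cut to zero at the other indices
  because \<open>tens_decomposition\<close> asks for this above \<open>N\<close>.\<close>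

definition spread :: "(real \<Rightarrow> real) \<Rightarrow> nat \<Rightarrow> real \<Rightarrow> real" where
  "spread g i = (if i \<in> {1..N} then g else (\<lambda>_. 0))"

lemma spread_pieces: "smooth g \<Longrightarrow> g 0 = 0 \<Longrightarrow> g (real N) = 0 \<Longrightarrow> spread g \<in> pieces N"
  using N by (auto simp: pieces_def spread_def smooth_const)

lemma spread_gradient:
  assumes "smooth g" "g 0 = 0" "g (real N) = 0"
  shows "AE z in lebesgue_on R. weak_gradient R (tens (spread g) (sine k)) z =
     (deriv g (fst z) * sine k (snd z), g (fst z) * deriv (sine k) (snd z))"
proof -
  have r: "AE z in lebesgue_on R. z \<in> R" by (rule AE_I2) simp
  show ?thesis
    using tens_weak_gradient[OF spread_pieces[OF assms] sine_smooth, of k] r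
  proof eventually_elim
    case (elim z)
    have "0 < fst z" "fst z < real N" using elim(2) by auto
    then have "0 < \<lceil>fst z\<rceil>" "\<lceil>fst z\<rceil> \<le> int N" by (simp_all add: ceiling_le_iff)
    then have "nat \<lceil>fst z\<rceil> \<le> N" by linarith
    then have "max 1 (nat \<lceil>fst z\<rceil>) \<in> {1..N}"
      using N unfolding atLeastAtMost_iff max.bounded_iff by (intro conjI max.cobounded1)
    then have "glue (spread g) (fst z) = g (fst z)" "glue (\<lambda>i. deriv (spread g i)) (fst z) = deriv g (fst z)"
      unfolding glue_def spread_def by (simp_all only: if_True)
    then show ?case using elim(1) by simp
  qed
qed

lemma H1_sum:
  assumes "finite I" "\<And>i. i \<in> I \<Longrightarrow> f i \<in> H1 R"
  shows "AE z in lebesgue_on R. weak_gradient R (\<Sum>i\<in>I. f i) z = (\<Sum>i\<in>I. weak_gradient R (f i) z)"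
  using assms
proof (induction I rule: finite_induct)
  case empty
  show ?case
    using H1_scale(2)[OF subspace_0[OF H1_subspace], of 0] unfolding sum.empty scaleR_zero_left .
next
  case (insert i I)
  have "(\<Sum>i\<in>I. f i) \<in> H1 R" using insert.prems by (intro subspace_sum[OF H1_subspace]) auto
  then have "AE z in lebesgue_on R. weak_gradient R (f i + (\<Sum>i\<in>I. f i)) z = weak_gradient R (f i) z + weak_gradient R (\<Sum>i\<in>I. f i) z"
    using insert.prems by (intro H1_add) auto
  moreover have "AE z in lebesgue_on R. weak_gradient R (\<Sum>i\<in>I. f i) z = (\<Sum>i\<in>I. weak_gradient R (f i) z)"
    using insert.prems by (intro insert.IH) blast
  ultimately show ?case
    unfolding sum.insert[OF insert.hyps]
  proof eventually_elim
    case (elim z)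
    then show ?case by (simp only:)
  qed
qed

text \<open>A test function close to \<open>v\<close> is replaced by a sine sum that is uniformly
  close in the first derivatives; on a rectangle of finite area this controls the gradient
  form.\<close>

lemma separated_dense:
  assumes v: "v \<in> H10 R" and \<epsilon>: "0 < \<epsilon>"
  shows "\<exists>K g. (\<forall>k. smooth (g k) \<and> g k 0 = 0 \<and> g k (real N) = 0) \<and>
     grad_form R (v - (\<Sum>k\<in>{1..K}. tens (spread (g k)) (sine k))) (v - (\<Sum>k\<in>{1..K}. tens (spread (g k)) (sine k))) < \<epsilon>"
proof -
  interpret G: psd_form "H1 R" "grad_form R" by (rule grad_form_psd) (use R_sets in auto)
  have e: "0 < sqrt \<epsilon> / 2" using \<epsilon> by simp
  obtain \<phi> where \<phi>: "\<phi> \<in> test_functions R" "H1.nrm (v - \<phi>) < sqrt \<epsilon> / 2"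
    using v e unfolding H10_iff by blast
  define c where "c = (LINT z|lebesgue_on R. (1 :: real))"
  have c: "0 \<le> c" by (simp add: c_def)
  \<comment> \<open>\<open>c\<close> is the area. The squared gradient error is at most
    \<open>2 * \<delta>\<^sup>2\<close> pointwise, so its integral is below
    \<open>\<epsilon> / 4\<close>, and each of the two approximations uses up half of
    \<open>sqrt \<epsilon>\<close>.\<close>
  define \<delta> where "\<delta> = sqrt (\<epsilon> / (16 * (c + 1)))"
  have \<delta>: "0 < \<delta>" using \<epsilon> c by (simp add: \<delta>_def)
  have \<delta>2: "2 * \<delta>\<^sup>2 * c < \<epsilon> / 4"
  proof -
    have "\<delta>\<^sup>2 = \<epsilon> / (16 * (c + 1))" using \<epsilon> c by (simp add: \<delta>_def)
    then have "2 * \<delta>\<^sup>2 * c \<le> 2 * \<delta>\<^sup>2 * (c + 1)" "2 * \<delta>\<^sup>2 * (c + 1) = \<epsilon> / 8"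
      using c by (auto intro: mult_left_mono simp: field_simps)
    then show ?thesis using \<epsilon> by linarith
  qed
  obtain K g where g: "\<And>k. smooth (g k)" "\<And>k. g k 0 = 0" "\<And>k. g k (real N) = 0"
    and app: "\<And>z. z \<in> R \<Longrightarrow> \<bar>pd1 \<phi> z - (\<Sum>k\<in>{1..K}. deriv (g k) (fst z) * sine k (snd z))\<bar> \<le> \<delta>"
      "\<And>z. z \<in> R \<Longrightarrow> \<bar>pd2 \<phi> z - (\<Sum>k\<in>{1..K}. g k (fst z) * deriv (sine k) (snd z))\<bar> \<le> \<delta>"
    using sine_sum_approximation[OF \<phi>(1) \<delta>] by blast
  define T where "T k = tens (spread (g k)) (sine k)" for k
  have TH: "T k \<in> H1 R" for k
    unfolding T_def by (intro H10_H1 tens_H10 spread_pieces g sine_smooth sine_boundary)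
  define \<Phi> where "\<Phi> = (\<Sum>k\<in>{1..K}. T k)"
  have \<Phi>H: "\<Phi> \<in> H1 R" unfolding \<Phi>_def by (intro subspace_sum[OF H1_subspace] TH)
  note \<phi>H = test_function_H1[OF \<phi>(1)]
  have "AE z in lebesgue_on R. \<forall>k\<in>{1..K}. weak_gradient R (T k) z =
     (deriv (g k) (fst z) * sine k (snd z), g k (fst z) * deriv (sine k) (snd z))"
    unfolding T_def by (intro AE_finite_allI spread_gradient g) auto
  moreover have "AE z in lebesgue_on R. weak_gradient R \<Phi> z = (\<Sum>k\<in>{1..K}. weak_gradient R (T k) z)"
    unfolding \<Phi>_def by (intro H1_sum TH) auto
  moreover have "AE z in lebesgue_on R. z \<in> R" by (rule AE_I2) simp
  ultimately have bd: "AE z in lebesgue_on R. weak_gradient R (\<phi> - \<Phi>) z \<bullet> weak_gradient R (\<phi> - \<Phi>) z \<le> 2 * \<delta>\<^sup>2"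
    using H1_diff[OF \<phi>H(1) \<Phi>H] \<phi>H(2)
  proof eventually_elim
    case (elim z)
    have "weak_gradient R \<Phi> z = (\<Sum>k\<in>{1..K}. (deriv (g k) (fst z) * sine k (snd z), g k (fst z) * deriv (sine k) (snd z)))"
      unfolding elim(2) using elim(1) by (intro sum.cong refl) auto
    then have w: "weak_gradient R (\<phi> - \<Phi>) z = (pd1 \<phi> z - (\<Sum>k\<in>{1..K}. deriv (g k) (fst z) * sine k (snd z)),
        pd2 \<phi> z - (\<Sum>k\<in>{1..K}. g k (fst z) * deriv (sine k) (snd z)))"
      unfolding elim(4) elim(5) gradient_plane by (simp add: prod_eq_iff fst_sum snd_sum)
    have sq: "x * x \<le> \<delta>\<^sup>2" if "\<bar>x\<bar> \<le> \<delta>" for x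
      using that \<delta> abs_le_square_iff[of x \<delta>] by (simp add: power2_eq_square)
    show ?case unfolding w using sq[OF app(1)[OF elim(3)]] sq[OF app(2)[OF elim(3)]] by (simp add: inner_prod_def)
  qed
  have dH: "\<phi> - \<Phi> \<in> H1 R" using \<phi>H(1) \<Phi>H by simp
  have "grad_form R (\<phi> - \<Phi>) (\<phi> - \<Phi>) \<le> (LINT z|lebesgue_on R. 2 * \<delta>\<^sup>2)"
    unfolding grad_form_def L2_inner_def
    by (rule integral_mono_AE[OF L2_inner_integrable[OF H1_D(2)[OF dH] H1_D(2)[OF dH]] _ bd])
      (rule bounded_integrable_on[OF _ R_lmeasurable order.refl], simp)
  also have "\<dots> = 2 * \<delta>\<^sup>2 * c" unfolding c_def by (simp flip: integral_mult_right_zero)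
  finally have "grad_form R (\<phi> - \<Phi>) (\<phi> - \<Phi>) < \<epsilon> / 4" using \<delta>2 by linarith
  then have "G.nrm (\<phi> - \<Phi>) < sqrt (\<epsilon> / 4)" by (simp add: G.nrm_def)
  then have 1: "G.nrm (\<phi> - \<Phi>) < sqrt \<epsilon> / 2" by (simp add: real_sqrt_divide)
  have vH: "v \<in> H1 R" by (rule H10_H1[OF v])
  have 2: "G.nrm (v - \<phi>) < sqrt \<epsilon> / 2"
  proof -
    have d: "v - \<phi> \<in> H1 R" using vH \<phi>H(1) by simp
    have "G.nrm (v - \<phi>) \<le> H1.nrm (v - \<phi>)"
      using grad_form_le_H1[OF d order.refl R_sets] d real_le_lsqrt unfolding G.nrm_def by (simp add: G.psd)
    then show ?thesis using \<phi>(2) by linarith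
  qed
  have "G.nrm (v - \<Phi>) \<le> G.nrm (v - \<phi>) + G.nrm (\<phi> - \<Phi>)"
    using G.nrm_triangle[of "v - \<phi>" "\<phi> - \<Phi>"] vH \<phi>H(1) \<Phi>H by simp
  then have "G.nrm (v - \<Phi>) < sqrt \<epsilon>" using 1 2 by linarith
  then have "grad_form R (v - \<Phi>) (v - \<Phi>) < \<epsilon>" by (simp add: G.nrm_def)
  then show ?thesis using g unfolding \<Phi>_def T_def by blast
qed

text \<open>Each term of a separated sum splits into bubbles and hats. The bubbles of all modes in a
  layer are added up to a single vector \<open>b i\<close>, so that \<open>N\<close> bubble
  directions suffice later.\<close>

lemma layered_dense:
  assumes v: "v \<in> H10 R" and \<epsilon>: "0 < \<epsilon>"
  shows "\<exists>b c K. (\<forall>i\<in>{1..N}. b i \<in> Bub i) \<and>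
      (\<Sum>j\<in>{1..N}. grad_form (layer p q j)
         (v - ((\<Sum>i\<in>{1..N}. b i) + (\<Sum>k\<in>{1..K}. \<Sum>i\<in>{1..<N}. c k i *\<^sub>R hat k i)))
         (v - ((\<Sum>i\<in>{1..N}. b i) + (\<Sum>k\<in>{1..K}. \<Sum>i\<in>{1..<N}. c k i *\<^sub>R hat k i)))) < \<epsilon>"
proof -
  have Npos: "0 < real N" using N by simp
  then have "0 < \<epsilon> / real N" using \<epsilon> by simp
  then obtain K g where g: "\<And>k. smooth (g k)" "\<And>k. g k 0 = 0" "\<And>k. g k (real N) = 0"
    and app: "grad_form R (v - (\<Sum>k\<in>{1..K}. tens (spread (g k)) (sine k)))
        (v - (\<Sum>k\<in>{1..K}. tens (spread (g k)) (sine k))) < \<epsilon> / real N"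
    using separated_dense[OF v, of "\<epsilon> / real N"] by blast
  define b where "b i = (\<Sum>k\<in>{1..K}. tens (bubble k (spread (g k)) i) (sine k))" for i
  define c where "c k i = nodal (spread (g k)) i" for k i
  note sp = spread_pieces[OF g]
  have b: "b i \<in> Bub i" if "i \<in> {1..N}" for i
    unfolding b_def using that by (intro subspace_sum[OF Bub_subspace] bubble_Bub sp) auto
  have dec: "tens (spread (g k)) (sine k) = (\<Sum>i\<in>{1..N}. tens (bubble k (spread (g k)) i) (sine k)) + (\<Sum>i\<in>{1..<N}. c k i *\<^sub>R hat k i)" for k
    unfolding c_def by (rule tens_decomposition) (auto simp: spread_def)
  have sum: "(\<Sum>k\<in>{1..K}. tens (spread (g k)) (sine k))
      = (\<Sum>i\<in>{1..N}. b i) + (\<Sum>k\<in>{1..K}. \<Sum>i\<in>{1..<N}. c k i *\<^sub>R hat k i)"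
    unfolding dec sum.distrib b_def by (subst sum.swap) simp
  define w where "w = v - (\<Sum>k\<in>{1..K}. tens (spread (g k)) (sine k))"
  have wH: "w \<in> H1 R"
    unfolding w_def using v
    by (intro subspace_diff[OF H1_subspace] subspace_sum[OF H1_subspace] H10_H1 tens_H10 sp sine_smooth sine_boundary)
  \<comment> \<open>Each layer energy is at most the energy on \<open>R\<close>; the accuracy
    \<open>\<epsilon> / real N\<close> provides for the resulting factor.\<close>
  have "(\<Sum>j\<in>{1..N}. grad_form (layer p q j) w w) \<le> (\<Sum>j\<in>{1..N}. grad_form R w w)"
    unfolding grad_form_def
    by (intro sum_mono L2_inner_subset_le[OF H1_D(2)[OF wH] layer_subset layer_sets R_sets])
  also have "\<dots> = real N * grad_form R w w" by simp
  also have "\<dots> < \<epsilon>" using app Npos unfolding w_def[symmetric] by (simp add: field_simps)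
  finally show ?thesis using b unfolding w_def sum by blast
qed

section \<open>Finite-dimensional subspaces modulo null sets\<close>

definition null :: "(real \<times> real \<Rightarrow> real) set" where
  "null = {v \<in> H10 R. AE z in lebesgue_on R. v z = 0}"

lemma null_subspace: "subspace null"
proof (rule subspaceI)
  show "0 \<in> null" unfolding null_def using subspace_0[OF H10_subspace] by simp
next
  fix v w assume vw: "v \<in> null" "w \<in> null"
  then have "AE z in lebesgue_on R. v z = 0" "AE z in lebesgue_on R. w z = 0" by (auto simp: null_def)
  then have "AE z in lebesgue_on R. (v + w) z = 0" by eventually_elim simp
  then show "v + w \<in> null" using vw subspace_add[OF H10_subspace] unfolding null_def by blast
next
  fix c v assume v: "v \<in> null"
  then have "AE z in lebesgue_on R. v z = 0" by (auto simp: null_def)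
  then have "AE z in lebesgue_on R. (c *\<^sub>R v) z = 0" by eventually_elim simp
  then show "c *\<^sub>R v \<in> null" using v subspace_scale[OF H10_subspace] unfolding null_def by blast
qed

text \<open>Null sets are invisible to the defining integrals, so both functions have literally the
  same set of weak gradients. The choice operator then returns the same function, and the equality
  holds everywhere.\<close>

lemma weak_gradient_cong_AE:
  assumes "AE z in lebesgue_on R. v z = w z" "v \<in> H1 R" "w \<in> H1 R"
  shows "weak_gradient R v = weak_gradient R w"
proof -
  have "(LINT z|lebesgue_on R. v z *\<^sub>R gradient \<phi> z) = (LINT z|lebesgue_on R. w z *\<^sub>R gradient \<phi> z)"
    if \<phi>: "\<phi> \<in> test_functions R" for \<phi>
  proof (rule integral_cong_AE)
    show "(\<lambda>z. v z *\<^sub>R gradient \<phi> z) \<in> borel_measurable (lebesgue_on R)"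
      using L2_scaleR_integrable[OF H1_D(1)[OF assms(2)] test_function_L2(2)[OF \<phi>]] by auto
    show "(\<lambda>z. w z *\<^sub>R gradient \<phi> z) \<in> borel_measurable (lebesgue_on R)"
      using L2_scaleR_integrable[OF H1_D(1)[OF assms(3)] test_function_L2(2)[OF \<phi>]] by auto
    show "AE z in lebesgue_on R. v z *\<^sub>R gradient \<phi> z = w z *\<^sub>R gradient \<phi> z"
      using assms(1) by eventually_elim simp
  qed
  then have "has_weak_gradient R v g \<longleftrightarrow> has_weak_gradient R w g" for g
    unfolding has_weak_gradient_def by auto
  then show ?thesis unfolding weak_gradient_def by simp
qed

lemma grad_form_cong_AE:
  assumes "AE z in lebesgue_on R. v z = v' z" "v \<in> H10 R" "v' \<in> H10 R"
  shows "grad_form T w v = grad_form T w v'" "grad_form T v w = grad_form T v' w"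
  unfolding grad_form_def using weak_gradient_cong_AE[OF assms(1)] assms(2,3) H10_H1 by auto

text \<open>Independence in \<open>H10_subspaces\<close> is modulo null sets; a linear choice of representatives turns it
  into ordinary linear independence.\<close>

lemma representatives:
  "\<exists>\<rho>. linear \<rho> \<and> (\<forall>x\<in>H10 R. x - \<rho> x \<in> null) \<and> (\<forall>x\<in>null. \<rho> x = 0)"
proof -
  \<comment> \<open>A basis of \<open>null\<close> is extended to a basis of \<open>H10 R\<close>;
    \<open>\<rho>\<close> annihilates the basis vectors from \<open>null\<close> and fixes the
    others.\<close>
  obtain B0 where B0: "B0 \<subseteq> null" "independent B0" "null \<subseteq> span B0"
    using maximal_independent_subset[of null] by blast
  have "B0 \<subseteq> H10 R" using B0(1) by (auto simp: null_def)
  then obtain B where B: "B0 \<subseteq> B" "B \<subseteq> H10 R" "independent B" "H10 R \<subseteq> span B"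
    using maximal_independent_subset_extend[OF _ B0(2)] by blast
  obtain \<rho> where \<rho>: "linear \<rho>" "\<forall>x\<in>B. \<rho> x = (if x \<in> B0 then 0 else x)"
    using linear_independent_extend[OF B(3), of "\<lambda>x. if x \<in> B0 then 0 else x"] by blast
  have "x - \<rho> x \<in> null" if "x \<in> span B" for x
    using that
  proof (induction rule: span_induct)
    case base
    show ?case
    proof (rule subspaceI)
      show "0 \<in> {x. x - \<rho> x \<in> null}" using linear_0[OF \<rho>(1)] subspace_0[OF null_subspace] by simp
      show "x + y \<in> {x. x - \<rho> x \<in> null}" if "x \<in> {x. x - \<rho> x \<in> null}" "y \<in> {x. x - \<rho> x \<in> null}" for x y
        using that subspace_add[OF null_subspace, of "x - \<rho> x" "y - \<rho> y"]
        by (simp add: linear_add[OF \<rho>(1)] algebra_simps)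
      show "c *\<^sub>R x \<in> {x. x - \<rho> x \<in> null}" if "x \<in> {x. x - \<rho> x \<in> null}" for c x
        using that subspace_scale[OF null_subspace, of "x - \<rho> x" c]
        by (simp add: linear_cmul[OF \<rho>(1)] scaleR_diff_right)
    qed
  next
    case (step x)
    show ?case
    proof (cases "x \<in> B0")
      case True
      then have "x - \<rho> x = x" using step \<rho>(2) by simp
      then show ?thesis using True B0(1) by (simp only:) blast
    next
      case False
      then have "x - \<rho> x = 0" using step \<rho>(2) by simp
      then show ?thesis using subspace_0[OF null_subspace] by (simp only:)
    qed
  qed
  moreover have "\<rho> x = 0" if "x \<in> null" for x
  proof -
    have "x \<in> span B0" using that B0(3) by blast
    then show ?thesis
      by (rule linear_eq_0_on_span[OF \<rho>(1), rotated]) (use \<rho>(2) B(1) in auto)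
  qed
  ultimately show ?thesis using \<rho>(1) B(4) by blast
qed

section \<open>Infinite dimension modulo null sets\<close>

definition parabola :: "real \<Rightarrow> real" where "parabola x = x * (real N - x)"

lemma parabola_props: "smooth parabola" "parabola 0 = 0" "parabola (real N) = 0"
  unfolding parabola_def[abs_def]
  by (auto intro!: smooth_mult[OF smooth_id smooth_diff[OF smooth_const smooth_id]])

text \<open>Orthogonality and positive energy in the first layer provide infinitely many independent
  functions for every \<open>N\<close>; hats cannot take this role, since there are none for
  \<open>N = 1\<close>.\<close>

lemma parabola_energy:
  assumes k: "k \<ge> 1" and l: "l \<ge> 1"
  shows "k \<noteq> l \<Longrightarrow> grad_form (layer p q 1) (tens (spread parabola) (sine k)) (tens (spread parabola) (sine l)) = 0"
    "0 < grad_form (layer p q 1) (tens (spread parabola) (sine k)) (tens (spread parabola) (sine k))"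
proof -
  have one: "1 \<in> {1..N}" using N by simp
  have sp: "spread parabola 1 = parabola" using N by (simp add: spread_def)
  note E = energy_tens[OF spread_pieces[OF parabola_props] spread_pieces[OF parabola_props] one, unfolded sp]
  show "grad_form (layer p q 1) (tens (spread parabola) (sine k)) (tens (spread parabola) (sine l)) = 0" if "k \<noteq> l"
    using E[OF k l] that by simp
  have d: "deriv parabola x = real N - 2 * x" for x
    unfolding parabola_def[abs_def] by (rule DERIV_imp_deriv) (auto intro!: derivative_eq_intros)
  have "((\<lambda>x. - ((real N - 2 * x) ^ 3 / 6)) has_real_derivative deriv parabola x * deriv parabola x) (at x)" for x
    unfolding d by (auto intro!: derivative_eq_intros simp: power2_eq_square)
  from integral_eq_of_antiderivative[OF this, of 0 1]
  \<comment> \<open>The value is \<open>(N ^ 3 - (N - 2) ^ 3) / 6\<close>, arranged so that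
    positivity is visible.\<close>
  have I1: "integral {0..1} (\<lambda>x. deriv parabola x * deriv parabola x) = (6 * (real N - 1)\<^sup>2 + 2) / 6"
    by (simp add: power3_eq_cube power2_eq_square field_simps)
  have I2: "0 \<le> integral {0..1} (\<lambda>x. parabola x * parabola x)"
    by (intro integral_nonneg integrable_continuous_real smooth_continuous smooth_mult parabola_props) simp
  have "0 < (6 * (real N - 1)\<^sup>2 + 2) / 6" by (simp add: add_nonneg_pos)
  then show "0 < grad_form (layer p q 1) (tens (spread parabola) (sine k)) (tens (spread parabola) (sine k))"
  proof -
    assume "0 < (6 * (real N - 1)\<^sup>2 + 2) / 6"
    then have "0 < (q - p) / 2 * (integral {0..1} (\<lambda>x. deriv parabola x * deriv parabola x)
        + (mode k)\<^sup>2 * integral {0..1} (\<lambda>x. parabola x * parabola x))"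
      using I2 pq unfolding I1[symmetric] by (intro mult_pos_pos add_pos_nonneg mult_nonneg_nonneg) auto
    then show ?thesis using E[OF k k] by simp
  qed
qed

text \<open>Members of \<open>H10_subspaces R n\<close> have dimension exactly \<open>n\<close>, so
  smaller spaces must be enlarged by independent vectors. The energy with \<open>T l\<close>
  isolates the coefficient of \<open>T l\<close> and ignores null functions, hence independence
  survives the passage to representatives.\<close>

lemma H10_infinite_dimensional:
  assumes \<rho>: "linear \<rho>" "\<And>x. x \<in> H10 R \<Longrightarrow> x - \<rho> x \<in> null"
  shows "\<exists>S. finite S \<and> card S = n \<and> S \<subseteq> \<rho> ` H10 R \<and> independent S"
proof -
  define T where "T k = tens (spread parabola) (sine (Suc k))" for k
  have TH: "T k \<in> H10 R" for k
    unfolding T_def by (intro tens_H10 spread_pieces parabola_props sine_smooth sine_boundary)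
  have one: "1 \<in> {1..N}" using N by simp
  interpret F: psd_form "H10 R" "grad_form (layer p q 1)" by (rule layer_form[OF one])
  have key: "c l = 0" if z: "(\<Sum>k<n. c k *\<^sub>R \<rho> (T k)) = 0" and l: "l < n" for c :: "nat \<Rightarrow> real" and l
  proof -
    define v where "v = (\<Sum>k<n. c k *\<^sub>R T k)"
    have vH: "v \<in> H10 R" unfolding v_def by (intro F.V_sum F.V_closed(3) TH)
    have "\<rho> v = 0" unfolding v_def using z by (simp add: linear_sum[OF \<rho>(1)] linear_cmul[OF \<rho>(1)])
    then have "v \<in> null" using \<rho>(2)[OF vH] by simp
    then have "AE z in lebesgue_on R. v z = (0 :: real \<times> real \<Rightarrow> real) z" by (simp add: null_def)
    then have "grad_form (layer p q 1) v (T l) = grad_form (layer p q 1) 0 (T l)"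
      by (rule grad_form_cong_AE(2)[OF _ vH subspace_0[OF H10_subspace]])
    also have "\<dots> = 0" by (rule F.zero[OF TH])
    finally have "0 = grad_form (layer p q 1) v (T l)" by simp
    also have "\<dots> = (\<Sum>k<n. grad_form (layer p q 1) (c k *\<^sub>R T k) (T l))"
      unfolding v_def by (intro F.sum F.V_closed(3) TH) simp
    also have "\<dots> = (\<Sum>k<n. if k = l then c l * grad_form (layer p q 1) (T l) (T l) else 0)"
      by (intro sum.cong refl) (simp only: F.scale[OF TH TH], simp add: T_def parabola_energy(1) del: One_nat_def)
    also have "\<dots> = c l * grad_form (layer p q 1) (T l) (T l)" using l by (simp add: sum.delta)
    finally show ?thesis using parabola_energy(2)[of "Suc l" "Suc l"] by (simp add: T_def)
  qed
  have inj: "inj_on (\<lambda>k. \<rho> (T k)) {..<n}"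
  proof (rule inj_onI, rule ccontr)
    fix i j assume ij: "i \<in> {..<n}" "j \<in> {..<n}" "\<rho> (T i) = \<rho> (T j)" "i \<noteq> j"
    define c :: "nat \<Rightarrow> real" where "c k = (if k = i then 1 else if k = j then - 1 else 0)" for k
    have "(\<Sum>k<n. c k *\<^sub>R \<rho> (T k)) = (\<Sum>k\<in>{i, j}. c k *\<^sub>R \<rho> (T k))"
      using ij by (intro sum.mono_neutral_right) (auto simp: c_def)
    also have "\<dots> = 0" using ij by (simp add: c_def)
    finally show False using key[of c i] ij by (simp add: c_def)
  qed
  define S where "S = (\<lambda>k. \<rho> (T k)) ` {..<n}"
  have "independent S"
  proof (rule independent_if_scalars_zero)
    show "finite S" by (simp add: S_def)
    fix f x assume s: "(\<Sum>x\<in>S. f x *\<^sub>R x) = 0" and x: "x \<in> S"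
    obtain l where l: "l < n" "x = \<rho> (T l)" using x by (auto simp: S_def)
    have "(\<Sum>k<n. f (\<rho> (T k)) *\<^sub>R \<rho> (T k)) = 0"
      using s unfolding S_def by (simp add: sum.reindex[OF inj])
    then show "f x = 0" using key[of "\<lambda>k. f (\<rho> (T k))" l] l by simp
  qed
  moreover have "card S = n" unfolding S_def using card_image[OF inj] by simp
  ultimately show ?thesis using TH by (intro exI[of _ S]) (auto simp: S_def)
qed

text \<open>Representatives of \<open>W\<close> are reduced to a basis and completed to exactly
  \<open>n\<close> independent vectors inside the range of \<open>\<rho>\<close>. There, vanishing
  almost everywhere means vanishing, so ordinary independence is independence modulo null sets. The
  finite set \<open>B\<close> is recorded for the construction of projections.\<close>

lemma subspace_containing:
  assumes W: "finite W" "W \<subseteq> H10 R" "card W \<le> n"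
  shows "\<exists>X\<in>H10_subspaces R n. span W \<subseteq> X \<and> (\<exists>B. finite B \<and> B \<subseteq> H10 R \<and>
    X = {v \<in> H10 R. \<exists>x\<in>span B. AE z in lebesgue_on R. v z = x z})"
proof -
  obtain \<rho> where \<rho>: "linear \<rho>" "\<And>x. x \<in> H10 R \<Longrightarrow> x - \<rho> x \<in> null" "\<And>x. x \<in> null \<Longrightarrow> \<rho> x = 0"
    using representatives by blast
  have \<rho>H: "\<rho> x \<in> H10 R" if "x \<in> H10 R" for x
  proof -
    have d: "x - \<rho> x \<in> H10 R" using \<rho>(2)[OF that] by (simp only: null_def mem_Collect_eq)
    have "x - (x - \<rho> x) \<in> H10 R" by (rule subspace_diff[OF H10_subspace that d])
    then show ?thesis by simp
  qed
  have \<rho>\<rho>: "\<rho> (\<rho> x) = \<rho> x" if "x \<in> H10 R" for x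
    using \<rho>(3)[OF \<rho>(2)[OF that]] by (simp add: linear_diff[OF \<rho>(1)])
  define V where "V = \<rho> ` H10 R"
  have VH: "V \<subseteq> H10 R" using \<rho>H by (auto simp: V_def)
  have V_sub: "subspace V" unfolding V_def by (rule linear_subspace_image[OF \<rho>(1) H10_subspace])
  have V_null: "v = 0" if v: "v \<in> V" and ae: "AE z in lebesgue_on R. v z = 0" for v
  proof -
    have "v \<in> null" using v VH ae by (auto simp: null_def)
    then have "\<rho> v = 0" by (rule \<rho>(3))
    moreover have "\<rho> v = v" using v \<rho>\<rho> by (auto simp: V_def)
    ultimately show ?thesis by simp
  qed
  define W' where "W' = \<rho> ` W"
  have W': "finite W'" "W' \<subseteq> V" "card W' \<le> n"
    using W card_image_le[OF W(1), of \<rho>] by (auto simp: W'_def V_def)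
  obtain B0 where B0: "B0 \<subseteq> W'" "independent B0" "W' \<subseteq> span B0"
    using maximal_independent_subset[of W'] by blast
  have "B0 \<subseteq> V" using B0(1) W'(2) by blast
  then obtain B where B: "B0 \<subseteq> B" "B \<subseteq> V" "independent B" "V \<subseteq> span B"
    using maximal_independent_subset_extend[OF _ B0(2)] by blast
  have "infinite B"
  proof
    assume fin: "finite B"
    obtain S where S: "finite S" "card S = Suc (card B)" "S \<subseteq> V" "independent S"
      using H10_infinite_dimensional[OF \<rho>(1,2), of "Suc (card B)"] unfolding V_def by blast
    then have "card S \<le> card B" using independent_span_bound[OF fin S(4)] B(4) by auto
    then show False using S(2) by simp
  qed
  have finB0: "finite B0" using B0(1) W'(1) finite_subset by blast
  have cardB0: "card B0 \<le> n" using card_mono[OF W'(1) B0(1)] W'(3) by simp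
  have "infinite (B - B0)" using \<open>infinite B\<close> finB0 by simp
  then obtain B1 where B1: "B1 \<subseteq> B - B0" "finite B1" "card B1 = n - card B0"
    using infinite_arbitrarily_large by blast
  define B' where "B' = B0 \<union> B1"
  have B': "finite B'" "card B' = n" "B' \<subseteq> V" "independent B'" "W' \<subseteq> span B'"
  proof -
    show "finite B'" using finB0 B1 by (simp add: B'_def)
    have "B0 \<inter> B1 = {}" using B1(1) by blast
    then show "card B' = n" using card_Un_disjoint[OF finB0 B1(2)] B1(3) cardB0 by (simp add: B'_def)
    have sub: "B' \<subseteq> B" using B(1) B1(1) by (auto simp: B'_def)
    then show "B' \<subseteq> V" using B(2) by blast
    show "independent B'" by (rule independent_mono[OF B(3) sub])
    show "W' \<subseteq> span B'" using B0(3) span_mono[of B0 B'] by (auto simp: B'_def)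
  qed
  obtain w where w: "bij_betw w {..<n} B'"
    using ex_bij_betw_nat_finite[OF B'(1)] B'(2) by (auto simp: lessThan_atLeast0)
  have wB: "w ` {..<n} = B'" "inj_on w {..<n}" using w by (auto simp: bij_betw_def)
  have spanB: "x \<in> span B' \<longleftrightarrow> (\<exists>c. x = (\<Sum>j<n. c j *\<^sub>R w j))" for x
  proof
    assume "x \<in> span B'"
    then obtain f where "x = (\<Sum>b\<in>B'. f b *\<^sub>R b)" using span_finite[OF B'(1)] by auto
    also have "\<dots> = (\<Sum>j<n. f (w j) *\<^sub>R w j)"
      unfolding wB(1)[symmetric] by (simp add: sum.reindex[OF wB(2)])
    finally show "\<exists>c. x = (\<Sum>j<n. c j *\<^sub>R w j)" by (rule exI[of _ "\<lambda>j. f (w j)"])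
  next
    assume "\<exists>c. x = (\<Sum>j<n. c j *\<^sub>R w j)"
    then obtain c where c: "x = (\<Sum>j<n. c j *\<^sub>R w j)" by (rule exE)
    show "x \<in> span B'" unfolding c by (intro span_sum span_scale span_base) (use wB(1) in blast)
  qed
  have app: "(\<Sum>j<n. c j *\<^sub>R w j) z = (\<Sum>j<n. c j * w j z)" for c z
    by (simp only: sum_fun_apply scaleR_fun_apply real_scaleR_def)
  define X where "X = {v \<in> H10 R. \<exists>c. AE z in lebesgue_on R. v z = (\<Sum>j<n. c j * w j z)}"
  have X_eq: "X = {v \<in> H10 R. \<exists>x\<in>span B'. AE z in lebesgue_on R. v z = x z}"
  proof -
    have "(\<exists>c. AE z in lebesgue_on R. v z = (\<Sum>j<n. c j * w j z)) \<longleftrightarrow>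
        (\<exists>x\<in>span B'. AE z in lebesgue_on R. v z = x z)" for v
      unfolding Bex_def spanB app[symmetric] by blast
    then show ?thesis unfolding X_def by blast
  qed
  have "X \<in> H10_subspaces R n"
    unfolding H10_subspaces_def
  proof (intro CollectI exI[of _ w] conjI allI impI)
    show "w j \<in> H10 R" if "j < n" for j using that wB(1) B'(3) VH by blast
    show "c j = 0" if ae: "AE z in lebesgue_on R. (\<Sum>j<n. c j * w j z) = 0" and j: "j < n" for c j
    proof -
      have inV: "(\<Sum>j<n. c j *\<^sub>R w j) \<in> V"
        using wB(1) B'(3) by (intro subspace_sum[OF V_sub] subspace_scale[OF V_sub]) auto
      have z: "(\<Sum>j<n. c j *\<^sub>R w j) = 0"
        by (rule V_null[OF inV]) (use ae in \<open>simp only: app\<close>)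
      have "(\<Sum>b\<in>B'. c (inv_into {..<n} w b) *\<^sub>R b) = (\<Sum>j<n. c j *\<^sub>R w j)"
        unfolding wB(1)[symmetric] by (simp add: sum.reindex[OF wB(2)] inv_into_f_f[OF wB(2)])
      then have "(\<Sum>b\<in>B'. c (inv_into {..<n} w b) *\<^sub>R b) = 0" using z by simp
      then have "c (inv_into {..<n} w (w j)) = 0"
        using independentD[OF B'(4) B'(1) order.refl, of "\<lambda>b. c (inv_into {..<n} w b)" "w j"] wB(1) j by blast
      then show ?thesis using inv_into_f_f[OF wB(2)] j by simp
    qed
    show "X = {v \<in> H10 R. \<exists>c. AE z in lebesgue_on R. v z = (\<Sum>j<n. c j * w j z)}" by (rule X_def)
  qed
  moreover have "span W \<subseteq> X"
  proof
    fix x assume x: "x \<in> span W"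
    have xH: "x \<in> H10 R" using span_minimal[OF W(2) H10_subspace] x by blast
    have "\<rho> x \<in> \<rho> ` span W" using x by blast
    also have "\<dots> = span W'" unfolding W'_def by (rule linear_span_image[OF \<rho>(1), symmetric])
    also have "\<dots> \<subseteq> span B'" by (rule span_minimal[OF B'(5) subspace_span])
    finally have "\<rho> x \<in> span B'" .
    moreover have "AE z in lebesgue_on R. x z = \<rho> x z"
    proof -
      have "AE z in lebesgue_on R. (x - \<rho> x) z = 0" using \<rho>(2)[OF xH] by (simp only: null_def mem_Collect_eq)
      then show ?thesis by eventually_elim (simp add: fun_diff_def)
    qed
    ultimately show "x \<in> X" unfolding X_eq using xH by blast
  qed
  ultimately show ?thesis using X_eq B'(1,3) VH by blast
qed

section \<open>The width estimate\<close>

text \<open>\<open>cosh\<close> is at least half the exponential, whence the power of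
  \<open>2\<close>. An exponent of at least \<open>q - p\<close> compensates the denominator of
  \<open>mode k = k * (pi / (q - p))\<close>.\<close>

lemma \<sigma>_bounds:
  assumes k: "k \<ge> 1"
  shows "0 \<le> \<sigma> k" "\<sigma> k \<le> \<sigma> 1" "\<sigma> k ^ nat \<lceil>q - p\<rceil> \<le> 2 ^ nat \<lceil>q - p\<rceil> * exp (- pi * real k)"
proof -
  show n: "0 \<le> \<sigma> k" by (simp add: \<sigma>_def)
  have m: "mode 1 \<le> mode k" using k pq by (simp add: mode_def mult_right_mono divide_right_mono)
  have "cosh (mode 1) \<le> cosh (mode k)"
    using m mode_pos[of 1] by (simp add: cosh_real_nonneg_le_iff)
  then show "\<sigma> k \<le> \<sigma> 1" unfolding \<sigma>_def by (intro divide_left_mono) auto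
  define J where "J = nat \<lceil>q - p\<rceil>"
  have J: "q - p \<le> real J" unfolding J_def by (rule real_nat_ceiling_ge)
  have "exp (mode k) / 2 \<le> cosh (mode k)" by (simp add: cosh_def)
  then have "\<sigma> k \<le> 1 / (exp (mode k) / 2)" unfolding \<sigma>_def by (intro divide_left_mono) auto
  then have "\<sigma> k \<le> 2 * exp (- mode k)" by (simp add: exp_minus field_simps)
  then have "\<sigma> k ^ J \<le> (2 * exp (- mode k)) ^ J" using n by (intro power_mono)
  also have "\<dots> = 2 ^ J * exp (- (real J * mode k))" by (simp add: power_mult_distrib exp_of_nat_mult[symmetric])
  also have "\<dots> \<le> 2 ^ J * exp (- pi * real k)"
  proof -
    have "pi * real k = (q - p) * mode k" using pq by (simp add: mode_def)
    also have "\<dots> \<le> real J * mode k" using J mode_pos[OF k] by (intro mult_right_mono) auto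
    finally show ?thesis by simp
  qed
  finally show "\<sigma> k ^ nat \<lceil>q - p\<rceil> \<le> 2 ^ nat \<lceil>q - p\<rceil> * exp (- pi * real k)" by (simp add: J_def)
qed

lemma layered_system_layers:
  "layered_system (H10 R) N (\<lambda>j. grad_form (layer p q j)) hat Bub \<alpha> \<sigma> (\<sigma> 1) (2 ^ nat \<lceil>q - p\<rceil>) (nat \<lceil>q - p\<rceil>)"
proof (rule layered_system.intro)
  fix i j k l i' :: nat and b v :: "real \<times> real \<Rightarrow> real" and c e :: real
  show "N \<ge> 1" by (rule N)
  show "psd_form (H10 R) (grad_form (layer p q j))" if "j \<in> {1..N}" using that by (rule layer_form)
  show "hat k i \<in> H10 R" if "k \<ge> 1" "i \<in> {1..<N}" using that by (rule hat_H10)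
  show "b \<in> H10 R" if "i \<in> {1..N}" "b \<in> Bub i" using that by (simp add: Bub_def)
  show "c *\<^sub>R b \<in> Bub i" if "i \<in> {1..N}" "b \<in> Bub i" using that subspace_scale[OF Bub_subspace] by blast
  show "grad_form (layer p q j) b v = 0"
    if "i \<in> {1..N}" "j \<in> {1..N}" "i \<noteq> j" "b \<in> Bub i" "v \<in> H10 R"
  proof -
    have "\<forall>j\<in>{1..N}. j \<noteq> i \<longrightarrow> (\<forall>v\<in>H10 R. grad_form (layer p q j) b v = 0)"
      using that(4) unfolding Bub_def by blast
    then show ?thesis using that by metis
  qed
  show "grad_form (layer p q j) (hat k l) b = 0"
    if "i \<in> {1..N}" "j \<in> {1..N}" "b \<in> Bub i" "k \<ge> 1" "l \<in> {1..<N}" using that unfolding Bub_def by blast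
  show "grad_form (layer p q j) (hat k i) (hat l i') = 0"
    if "j \<in> {1..N}" "k \<ge> 1" "l \<ge> 1" "k \<noteq> l" "i \<in> {1..<N}" "i' \<in> {1..<N}"
    unfolding hat_def using that by (subst energy_hatp) (auto intro!: hatp_pieces)
  show "grad_form (layer p q j) (\<Sum>i\<in>{1..<N}. x i *\<^sub>R hat k i) (\<Sum>i\<in>{1..<N}. y i *\<^sub>R hat k i) =
        \<alpha> k * (x (j - 1) * y (j - 1) + x j * y j - \<sigma> k * (x (j - 1) * y j + x j * y (j - 1)))"
    if j: "j \<in> {1..N}" and k: "k \<ge> 1" and xy: "x 0 = 0" "x N = 0" "y 0 = 0" "y N = 0" for x y
  proof -
    \<comment> \<open>\<open>hat_sum\<close> truncates the nodal vectors to the interior. Up to node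
      \<open>N\<close> nothing is changed by this, as the end values are zero.\<close>
    have m: "(if i \<in> {1..<N} then x i else 0) = x i" "(if i \<in> {1..<N} then y i else 0) = y i" if "i \<le> N" for i
      using that xy by (cases "i = 0"; cases "i = N"; simp)+
    have jj: "j \<le> N" "j - 1 \<le> N" using j by auto
    show ?thesis
      unfolding hat_sum by (subst energy_hatp_hatp[OF k _ _ _ _ j]) (simp_all only: m[OF jj(1)] m[OF jj(2)], use xy in auto)
  qed
  show "0 < \<alpha> k" if "k \<ge> 1" using mode_pos[OF that] pq by (simp add: \<alpha>_def)
  show "0 \<le> \<sigma> k" "\<sigma> k \<le> \<sigma> 1" "\<sigma> k ^ nat \<lceil>q - p\<rceil> \<le> 2 ^ nat \<lceil>q - p\<rceil> * exp (- pi * real k)" if "k \<ge> 1"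
    using that by (rule \<sigma>_bounds)+
  have "cosh 0 < cosh (mode 1)" using mode_pos[of 1] by (subst cosh_real_nonneg_less_iff) auto
  then show "\<sigma> 1 < 1" by (simp add: \<sigma>_def)
  show "\<exists>b c K. (\<forall>i\<in>{1..N}. b i \<in> Bub i) \<and>
      (\<Sum>j\<in>{1..N}. grad_form (layer p q j)
         (v - ((\<Sum>i\<in>{1..N}. b i) + (\<Sum>k\<in>{1..K}. \<Sum>i\<in>{1..<N}. c k i *\<^sub>R hat k i)))
         (v - ((\<Sum>i\<in>{1..N}. b i) + (\<Sum>k\<in>{1..K}. \<Sum>i\<in>{1..<N}. c k i *\<^sub>R hat k i)))) < e"
    if "v \<in> H10 R" "0 < e" using that by (rule layered_dense)
qed

sublocale S: layered_system "H10 R" N "\<lambda>j. grad_form (layer p q j)" hat Bub \<alpha> \<sigma> "\<sigma> 1"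
  "2 ^ nat \<lceil>q - p\<rceil>" "nat \<lceil>q - p\<rceil>"
  by (rule layered_system_layers)

section \<open>Energy projections and the relative width\<close>

lemma energy_inner_eq: "energy_inner N p q y v w = S.A y v w"
  by (simp add: energy_inner_def S.A_def R_eq grad_form_def)

lemma energy_norm_eq: "energy_norm N p q y v = sqrt (S.A y v v)"
  by (simp add: energy_norm_def energy_inner_eq)

lemma A_cong_AE:
  assumes "AE z in lebesgue_on R. v z = v' z" "v \<in> H10 R" "v' \<in> H10 R"
  shows "S.A y w v = S.A y w v'"
  unfolding S.A_def using grad_form_cong_AE(1)[OF assms] by simp

text \<open>\<open>energy_proj\<close> is a choice, so existence comes first: the projection onto
  \<open>span B\<close> is orthogonal to all of \<open>X\<close>, because each element of
  \<open>X\<close> agrees almost everywhere with one of \<open>span B\<close> and the energy cannot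
  tell them apart. Optimality is Pythagoras, as \<open>w - x\<close> lies in \<open>X\<close>
  again.\<close>

lemma energy_proj_optimal:
  assumes y: "\<And>j. j \<in> {1..N} \<Longrightarrow> 0 \<le> y j" and B: "finite B" "B \<subseteq> H10 R"
    and X: "X = {v \<in> H10 R. \<exists>x\<in>span B. AE z in lebesgue_on R. v z = x z}"
    and u: "u \<in> H10 R" and x: "x \<in> X"
  shows "energy_norm N p q y (\<lambda>z. u z - energy_proj N p q y X u z) \<le> energy_norm N p q y (u - x)"
proof -
  interpret Y: psd_form "H10 R" "S.A y" by (rule S.psd_form_A[OF y])
  have sB: "span B \<subseteq> H10 R" using span_minimal[OF B(2) H10_subspace] .
  have XH: "v \<in> H10 R" if "v \<in> X" for v using that X by simp
  obtain w0 where w0: "w0 \<in> span B" "\<forall>v\<in>span B. S.A y (u - w0) v = 0"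
    using Y.projection_exists[OF B u] by blast
  have "w0 \<in> X" using w0(1) sB unfolding X by auto
  moreover have "S.A y (u - w0) v = 0" if v: "v \<in> X" for v
  proof -
    obtain x where x: "x \<in> span B" "AE z in lebesgue_on R. v z = x z" using v X by blast
    then have "S.A y (u - w0) v = S.A y (u - w0) x" using XH[OF v] sB by (intro A_cong_AE) auto
    then show ?thesis using w0(2) x(1) by simp
  qed
  ultimately have "\<exists>w. w \<in> X \<and> (\<forall>v\<in>X. S.A y (u - w) v = 0)" by blast
  then have P: "energy_proj N p q y X u \<in> X" "\<forall>v\<in>X. S.A y (u - energy_proj N p q y X u) v = 0"
    unfolding energy_proj_def energy_inner_eq minus_fun_eq by (rule someI2_ex; blast)+
  define w where "w = energy_proj N p q y X u"
  have "w - x \<in> X"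
  proof -
    obtain w1 where w1: "w1 \<in> span B" "AE z in lebesgue_on R. w z = w1 z" using P(1) X unfolding w_def by blast
    obtain x1 where x1: "x1 \<in> span B" "AE z in lebesgue_on R. x z = x1 z" using x X by blast
    have "AE z in lebesgue_on R. (w - x) z = (w1 - x1) z"
      using w1(2) x1(2) by eventually_elim (simp add: fun_diff_def)
    moreover have "w - x \<in> H10 R" using XH P(1) x unfolding w_def by (intro Y.V_closed(4)) auto
    moreover have "w1 - x1 \<in> span B" using w1(1) x1(1) by (rule span_diff)
    ultimately show ?thesis unfolding X by blast
  qed
  then have "S.A y (u - w) (w - x) = 0" using P(2) unfolding w_def by blast
  then have "Y.nrm (u - w) \<le> Y.nrm (u - x)"
    using XH[OF x] XH[OF P(1)] u unfolding w_def[symmetric] by (intro Y.projection_optimal) auto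
  then have "sqrt (S.A y (u - w) (u - w)) \<le> sqrt (S.A y (u - x) (u - x))" unfolding Y.nrm_def .
  then show ?thesis
    by (simp only: minus_fun_eq energy_norm_eq w_def[symmetric])
qed

end

theorem theorem6p1:
  fixes N :: nat and p q m M :: real
    and D :: "(nat \<Rightarrow> real) set"
    and f :: "real \<times> real \<Rightarrow> real"
    and u :: "(nat \<Rightarrow> real) \<Rightarrow> real \<times> real \<Rightarrow> real"
  assumes "N \<ge> 1" and "p < q" and "m > 0" and "M > 0"
    and "D \<subseteq> {1..N} \<rightarrow>\<^sub>E {m<..<M}"
    and "f \<in> L2 (layered_domain N p q)"
    and "\<And>y. y \<in> D \<Longrightarrow> u y \<in> H10 (layered_domain N p q)"
    and "\<And>y v. y \<in> D \<Longrightarrow> v \<in> H10 (layered_domain N p q) \<Longrightarrow>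
           energy_inner N p q y (u y) v = L2_inner (layered_domain N p q) f v"
  shows "\<exists>C::real. \<forall>n\<^sub>s::nat.
           relative_width N p q D u (2 * N - 1 + (N - 1) * n\<^sub>s)
             \<le> ennreal (C * exp (- pi * (real n\<^sub>s + 1)))"
proof -
  interpret layers N p q by unfold_locales (use assms in auto)
  have D: "m < y j \<and> y j < M" if "y \<in> D" "j \<in> {1..N}" for y j
  proof -
    have "y \<in> {1..N} \<rightarrow>\<^sub>E {m<..<M}" using that(1) assms(5) by blast
    then have "y j \<in> {m<..<M}" using that(2) by (rule PiE_mem)
    then show ?thesis by simp
  qed
  have uH: "u y \<in> H10 R" if "y \<in> D" for y using assms(7)[OF that] by (simp add: R_eq)
  have eq: "S.A y (u y) v = S.A z (u z) v" if "y \<in> D" "z \<in> D" "v \<in> H10 R" for y z v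
  proof -
    have "v \<in> H10 (layered_domain N p q)" using that(3) by (simp add: R_eq)
    then show ?thesis using assms(8)[OF that(1)] assms(8)[OF that(2)] by (simp add: energy_inner_eq)
  qed
  have "\<exists>C. \<forall>n. \<exists>W. finite W \<and> W \<subseteq> H10 R \<and> card W \<le> N + (N - 1) * n \<and>
    (\<forall>y\<in>D. \<exists>x\<in>span W. sqrt (S.A y (u y - x) (u y - x)) \<le> C * exp (- pi * (real n + 1)) * sqrt (S.A y (u y) (u y)))"
  proof (rule S.relative_approximation[of D m M u])
    show "m < y j \<and> y j < M" if "y \<in> D" "j \<in> {1..N}" for y j using that by (rule D)
    show "S.A y (u y) v = S.A z (u z) v" if "y \<in> D" "z \<in> D" "v \<in> H10 R" for y z v using that by (rule eq)
  qed (use assms(3) uH in auto)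
  then obtain C where C: "\<forall>n. \<exists>W. finite W \<and> W \<subseteq> H10 R \<and> card W \<le> N + (N - 1) * n \<and>
    (\<forall>y\<in>D. \<exists>x\<in>span W. sqrt (S.A y (u y - x) (u y - x)) \<le> C * exp (- pi * (real n + 1)) * sqrt (S.A y (u y) (u y)))"
    by (rule exE)
  show ?thesis
  \<comment> \<open>Where an energy vanishes the quotient is \<open>0\<close>, and the bound still
    has to be nonnegative; hence the absolute value.\<close>
  proof (intro exI[of _ "\<bar>C\<bar>"] allI)
    fix n
    obtain W where W: "finite W" "W \<subseteq> H10 R" "card W \<le> N + (N - 1) * n"
      and app: "\<forall>y\<in>D. \<exists>x\<in>span W. sqrt (S.A y (u y - x) (u y - x)) \<le> C * exp (- pi * (real n + 1)) * sqrt (S.A y (u y) (u y))"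
      using spec[OF C, of n] by (elim exE conjE)
    \<comment> \<open>\<open>N \<le> 2 * N - 1\<close> leaves \<open>N - 1\<close> spare dimensions,
      which \<open>subspace_containing\<close> fills with arbitrary independent vectors.\<close>
    have "card W \<le> 2 * N - 1 + (N - 1) * n" using W(3) N by linarith
    from subspace_containing[OF W(1,2) this]
    obtain X B where X: "X \<in> H10_subspaces R (2 * N - 1 + (N - 1) * n)" "span W \<subseteq> X" and B: "finite B" "B \<subseteq> H10 R"
      "X = {v \<in> H10 R. \<exists>x\<in>span B. AE z in lebesgue_on R. v z = x z}"
      by (elim bexE exE conjE)
    have "energy_norm N p q y (\<lambda>z. u y z - energy_proj N p q y X (u y) z) / energy_norm N p q y (u y)
        \<le> \<bar>C\<bar> * exp (- pi * (real n + 1))" if y: "y \<in> D" for y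
    proof -
      have y0: "0 \<le> y j" if "j \<in> {1..N}" for j using D[OF y that] assms(3) by linarith
      interpret Y: psd_form "H10 R" "S.A y" by (rule S.psd_form_A[OF y0])
      have nn: "0 \<le> energy_norm N p q y (u y)" using Y.psd[OF uH[OF y]] by (simp add: energy_norm_eq)
      obtain x where x: "x \<in> span W"
        "sqrt (S.A y (u y - x) (u y - x)) \<le> C * exp (- pi * (real n + 1)) * sqrt (S.A y (u y) (u y))"
        using app y by blast
      have "energy_norm N p q y (\<lambda>z. u y z - energy_proj N p q y X (u y) z) \<le> energy_norm N p q y (u y - x)"
        by (rule energy_proj_optimal[OF y0 B uH[OF y] subsetD[OF X(2) x(1)]])
      also have "\<dots> \<le> C * exp (- pi * (real n + 1)) * energy_norm N p q y (u y)"
        using x(2) by (simp add: energy_norm_eq)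
      also have "\<dots> \<le> \<bar>C\<bar> * exp (- pi * (real n + 1)) * energy_norm N p q y (u y)"
        using nn by (intro mult_right_mono) auto
      finally show ?thesis
        using nn by (cases "energy_norm N p q y (u y) = 0") (auto simp: divide_le_eq)
    qed
    then have "(SUP y\<in>D. ennreal (energy_norm N p q y (\<lambda>z. u y z - energy_proj N p q y X (u y) z) / energy_norm N p q y (u y)))
        \<le> ennreal (\<bar>C\<bar> * exp (- pi * (real n + 1)))"
      by (intro SUP_least ennreal_leI)
    then show "relative_width N p q D u (2 * N - 1 + (N - 1) * n) \<le> ennreal (\<bar>C\<bar> * exp (- pi * (real n + 1)))"
      unfolding relative_width_def R_eq using X(1) by (rule INF_lower2[rotated])
  qed
qed

end
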